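(* Let $J$ be a two-sided ideal of $\mathrm{U}(W_+)$. Let $I=\operatorname{gr}_d(J)$, a two-sided ideal of $\mathrm{U}(W_+)$, and let $K=\operatorname{gr}_o(I)=\operatorname{gr}_{do}(I)$, an ideal of $\mathrm{S}(W_+)$. Then $$\operatorname{GKdim}\mathrm{U}(W_+)/J=\operatorname{GKdim}\mathrm{U}(W_+)/I=\operatorname{PGKdim}\mathrm{S}(W_+)/K.$$
   Context: $\Bbbk$ is a field of characteristic zero. The positive Witt algebra $W_+$ is the Lie algebra over $\Bbbk$ with basis $\{e_n : n\in\mathbb{Z}_{\geq 1}\}$ and bracket $[e_i,e_j]=(j-i)e_{i+j}$; $\mathrm{U}(W_+)$ is its universal enveloping algebra. Its symmetric algebra $\mathrm{S}(W_+)=\Bbbk[x_1,x_2,\dots]$ ($x_i$ the image of $e_i$) has the Poisson bracket determined by $\{x_i,x_j\}=(j-i)x_{i+j}$ and the Leibniz rule. The degree grading $d$ on $\mathrm{U}(W_+)$ has $d(e_i)=i$. The order filtration $o$ on $\mathrm{U}(W_+)$ is the standard filtration with $o(e_i)=1$. The degree-order filtration $do$ is the filtration whose $n$-th piece is spanned by the products $e_{i_1}\cdots e_{i_\ell}$ with $i_1\le\dots\le i_\ell$ and $i_1+\dots+i_\ell+\ell\le n$. The associated graded rings for both $o$ and $do$ are $\mathrm{S}(W_+)$. For an ideal $J$ of $\mathrm{U}(W_+)$: $\operatorname{gr}_d(J)\subseteq\mathrm{U}(W_+)$ is the span of the top-$d$-degree homogeneous components of elements of $J$ (the associated graded ideal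 for the filtration by degree $\le n$); $\operatorname{gr}_o(J)$ and $\operatorname{gr}_{do}(J)\subseteq\mathrm{S}(W_+)$ are the associated graded ideals, spanned by leading symbols with respect to $o$ and $do$. For $d$-graded $I$ one has $\operatorname{gr}_o(I)=\operatorname{gr}_{do}(I)$, and this is a Poisson ideal. $\operatorname{GKdim}R=\sup_V\limsup_{n}\log_n\dim_\Bbbk\left(\sum_{k=0}^nV^k\right)$ over finite-dimensional subspaces $V$ of the $\Bbbk$-algebra $R$. Poisson GK-dimension: for a (commutative) Poisson $\Bbbk$-algebra $A$ and a subspace $V\subseteq A$, put $V^{\{0\}}=\Bbbk$, $V^{\{n+1\}}=VV^{\{n\}}+\{V,V^{\{n\}}\}$ (spans), and for $V$ finite-dimensional $\operatorname{pd}_V(n)=\dim_\Bbbk\left(\sum_{k=0}^nV^{\{k\}}\right)$. If $A$ is generated as a Poisson algebra by a finite-dimensional $V$, then $\operatorname{PGKdim}A=\limsup_n\log_n\operatorname{pd}_V(n)$ (independent of $V$); in general $\operatorname{PGKdim}A$ is the supremum of $\operatorname{PGKdim}A'$ over finitely generated Poisson subalgebras $A'$. *)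

theory Defs
  imports
    "HOL-Library.Extended_Real"
    "HOL-Library.Poly_Mapping"
    "HOL-Algebra.QuotRing"
    "Jordan_Normal_Form.VS_Connect"
begin

section \<open>Algebras over a field, as records\<close>

text \<open>
  A (not necessarily commutative) algebra over a field \<open>'k\<close> is represented by a
  \<^typ>\<open>('k, 'a) module\<close> record, whose ring operations carry the product; linear algebra over
  the ground field \<open>class_ring\<close> is that of the locale \<^locale>\<open>vectorspace\<close>.
\<close>

definition lspan :: "('k::field, 'a, 'm) module_scheme \<Rightarrow> 'a set \<Rightarrow> 'a set" where
  "lspan A X = LinearCombinations.module.span class_ring A X"

definition ldim :: "('k::field, 'a, 'm) module_scheme \<Rightarrow> 'a set \<Rightarrow> nat" where
  "ldim A W = vectorspace.dim (class_ring :: 'k ring) (A\<lparr>carrier := W\<rparr>)"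

definition fin_dim_subspace :: "('k::field, 'a, 'm) module_scheme \<Rightarrow> 'a set \<Rightarrow> bool" where
  "fin_dim_subspace A W \<longleftrightarrow>
     VectorSpace.subspace (class_ring :: 'k ring) W A \<and>
     vectorspace.fin_dim (class_ring :: 'k ring) (A\<lparr>carrier := W\<rparr>)"

text \<open>\<^term>\<open>A Quot J\<close> with the induced scalar multiplication.\<close>

definition quot_algebra :: "('k, 'a, 'm) module_scheme \<Rightarrow> 'a set \<Rightarrow> ('k, 'a set) module" where
  "quot_algebra A J =
     ring.extend (A Quot J)
       (module.fields (\<lambda>c X. \<Union>x\<in>X. J +>\<^bsub>A\<^esub> (c \<odot>\<^bsub>A\<^esub> x)))"

record ('k, 'a) poisson = "('k, 'a) module" +
  pbracket :: "'a \<Rightarrow> 'a \<Rightarrow> 'a"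

definition poisson_ideal :: "('k, 'a, 'm) poisson_scheme \<Rightarrow> 'a set \<Rightarrow> bool" where
  "poisson_ideal A K \<longleftrightarrow>
     ideal K A \<and> (\<forall>a\<in>carrier A. \<forall>k\<in>K. pbracket A a k \<in> K)"

definition quot_poisson :: "('k, 'a, 'm) poisson_scheme \<Rightarrow> 'a set \<Rightarrow> ('k, 'a set) poisson" where
  "quot_poisson A K =
     module.extend (quot_algebra A K)
       (poisson.fields (\<lambda>X Y. \<Union>x\<in>X. \<Union>y\<in>Y. K +>\<^bsub>A\<^esub> pbracket A x y))"

lemma quot_algebra_simps [simp]:
  "carrier (quot_algebra A J) = a_rcosets\<^bsub>A\<^esub> J"
  "mult (quot_algebra A J) = rcoset_mult A J"
  "one (quot_algebra A J) = J +>\<^bsub>A\<^esub> \<one>\<^bsub>A\<^esub>"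
  "zero (quot_algebra A J) = J"
  "add (quot_algebra A J) = set_add A"
  "smult (quot_algebra A J) c X = (\<Union>x\<in>X. J +>\<^bsub>A\<^esub> (c \<odot>\<^bsub>A\<^esub> x))"
  by (simp_all add: quot_algebra_def FactRing_def ring.defs module.defs)

lemma quot_poisson_simps [simp]:
  "carrier (quot_poisson A J) = a_rcosets\<^bsub>A\<^esub> J"
  "mult (quot_poisson A J) = rcoset_mult A J"
  "one (quot_poisson A J) = J +>\<^bsub>A\<^esub> \<one>\<^bsub>A\<^esub>"
  "zero (quot_poisson A J) = J"
  "add (quot_poisson A J) = set_add A"
  "smult (quot_poisson A J) c X = (\<Union>x\<in>X. J +>\<^bsub>A\<^esub> (c \<odot>\<^bsub>A\<^esub> x))"
  "pbracket (quot_poisson A J) X Y = (\<Union>x\<in>X. \<Union>y\<in>Y. J +>\<^bsub>A\<^esub> pbracket A x y)"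
  by (simp_all add: quot_poisson_def quot_algebra_def FactRing_def ring.defs module.defs poisson.defs)

lemma quot_smult_coset:
  fixes A :: "('k::field, 'a, 'm) module_scheme"
  assumes "Module.module class_ring A" and "ideal J A"
    and sm: "\<And>c x. x \<in> J \<Longrightarrow> c \<odot>\<^bsub>A\<^esub> x \<in> J" and x: "x \<in> carrier A"
  shows "(\<Union>y\<in>J +>\<^bsub>A\<^esub> x. J +>\<^bsub>A\<^esub> (c \<odot>\<^bsub>A\<^esub> y)) = J +>\<^bsub>A\<^esub> (c \<odot>\<^bsub>A\<^esub> x)"
proof -
  interpret M: Module.module class_ring A by fact
  interpret J: ideal J A by fact
  have cx: "c \<odot>\<^bsub>A\<^esub> x \<in> carrier A" using x by simp
  have "J +>\<^bsub>A\<^esub> (c \<odot>\<^bsub>A\<^esub> y) = J +>\<^bsub>A\<^esub> (c \<odot>\<^bsub>A\<^esub> x)" if "y \<in> J +>\<^bsub>A\<^esub> x" for y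
  proof -
    from that obtain h where h: "h \<in> J" "y = h \<oplus>\<^bsub>A\<^esub> x"
      by (auto simp: a_r_coset_def')
    then have "h \<in> carrier A" using J.a_subset by auto
    then have "c \<odot>\<^bsub>A\<^esub> y = c \<odot>\<^bsub>A\<^esub> h \<oplus>\<^bsub>A\<^esub> c \<odot>\<^bsub>A\<^esub> x"
      using h x by (simp add: M.smult_r_distr)
    then have "c \<odot>\<^bsub>A\<^esub> y \<in> J +>\<^bsub>A\<^esub> (c \<odot>\<^bsub>A\<^esub> x)"
      using sm[OF h(1)] by (auto simp: a_r_coset_def')
    then show ?thesis
      using abelian_group.a_repr_independence[OF M.M.abelian_group_axioms _ cx J.a_subgroup] by auto
  qed
  moreover have "x \<in> J +>\<^bsub>A\<^esub> x" using J.a_rcos_self[OF x] .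
  ultimately show ?thesis by blast
qed


section \<open>Gelfand--Kirillov and Poisson Gelfand--Kirillov dimension\<close>

text \<open>
  \<open>log\<^sub>n d\<close> with \<open>log\<^sub>n 0 = - \<infinity>\<close>; the value \<open>0\<close> of \<open>d\<close> only arises for the zero algebra.
  The junk values at \<open>n \<le> 1\<close> do not affect a limes superior.
\<close>

definition log_dim :: "nat \<Rightarrow> nat \<Rightarrow> ereal" where
  "log_dim n d = (if d = 0 then - \<infinity> else ereal (log (real n) (real d)))"

primrec alg_power :: "('k::field, 'a, 'm) module_scheme \<Rightarrow> 'a set \<Rightarrow> nat \<Rightarrow> 'a set" where
  "alg_power A V 0 = lspan A {\<one>\<^bsub>A\<^esub>}"
| "alg_power A V (Suc n) = lspan A {v \<otimes>\<^bsub>A\<^esub> w | v w. v \<in> V \<and> w \<in> alg_power A V n}"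

definition GKdim :: "('k::field, 'a, 'm) module_scheme \<Rightarrow> ereal" where
  "GKdim A =
     (SUP V\<in>{V. fin_dim_subspace A V}.
        limsup (\<lambda>n. log_dim n (ldim A (lspan A (\<Union>k\<le>n. alg_power A V k)))))"

primrec poisson_power :: "('k::field, 'a, 'm) poisson_scheme \<Rightarrow> 'a set \<Rightarrow> nat \<Rightarrow> 'a set" where
  "poisson_power A V 0 = lspan A {\<one>\<^bsub>A\<^esub>}"
| "poisson_power A V (Suc n) =
     lspan A ({v \<otimes>\<^bsub>A\<^esub> w | v w. v \<in> V \<and> w \<in> poisson_power A V n} \<union>
              {pbracket A v w | v w. v \<in> V \<and> w \<in> poisson_power A V n})"

definition poisson_pd :: "('k::field, 'a, 'm) poisson_scheme \<Rightarrow> 'a set \<Rightarrow> nat \<Rightarrow> nat" where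
  "poisson_pd A V n = ldim A (lspan A (\<Union>k\<le>n. poisson_power A V k))"

definition poisson_subalgebra :: "('k::field, 'a, 'm) poisson_scheme \<Rightarrow> 'a set \<Rightarrow> bool" where
  "poisson_subalgebra A B \<longleftrightarrow>
     VectorSpace.subspace (class_ring :: 'k ring) B A \<and> \<one>\<^bsub>A\<^esub> \<in> B \<and>
     (\<forall>a\<in>B. \<forall>b\<in>B. a \<otimes>\<^bsub>A\<^esub> b \<in> B \<and> pbracket A a b \<in> B)"

definition poisson_generates ::
    "('k::field, 'a, 'm) poisson_scheme \<Rightarrow> 'a set \<Rightarrow> 'a set \<Rightarrow> bool" where
  "poisson_generates A V B \<longleftrightarrow>
     poisson_subalgebra A B \<and> V \<subseteq> B \<and>
     (\<forall>C. poisson_subalgebra A C \<and> V \<subseteq> C \<longrightarrow> B \<subseteq> C)"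

text \<open>
  The supremum over the finitely generated Poisson subalgebras \<open>B\<close> of
  \<open>limsup log\<^sub>n pd\<^sub>V(n)\<close>, where \<open>V\<close> is a finite-dimensional generating subspace of \<open>B\<close>.
  As this limes superior depends only on \<open>B\<close>, no \<open>V\<close> is singled out.  The Poisson powers of \<open>V\<close>
  are computed by the operations of \<open>A\<close>, which are those of \<open>B\<close>.
\<close>

definition PGKdim :: "('k::field, 'a, 'm) poisson_scheme \<Rightarrow> ereal" where
  "PGKdim A =
     Sup {limsup (\<lambda>n. log_dim n (poisson_pd A V n)) | V B.
            fin_dim_subspace A V \<and> poisson_generates A V B}"


section \<open>The index set of positive integers\<close>

typedef pnat = "{n::nat. 1 \<le> n}"
  morphisms nat_of_pnat pnat_of_nat
  by auto

setup_lifting type_definition_pnat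

instantiation pnat :: "{linorder, ab_semigroup_add}"
begin

lift_definition plus_pnat :: "pnat \<Rightarrow> pnat \<Rightarrow> pnat" is "(+)" by simp

lift_definition less_eq_pnat :: "pnat \<Rightarrow> pnat \<Rightarrow> bool" is "(\<le>)" .

lift_definition less_pnat :: "pnat \<Rightarrow> pnat \<Rightarrow> bool" is "(<)" .

instance by intro_classes (transfer; auto)+

end

lifting_forget pnat.lifting

text \<open>The structure constants: \<open>witt_coeff i j = j - i\<close>.\<close>

definition witt_coeff :: "pnat \<Rightarrow> pnat \<Rightarrow> 'k::ring_1" where
  "witt_coeff i j = of_nat (nat_of_pnat j) - of_nat (nat_of_pnat i)"


section \<open>The universal enveloping algebra of the positive Witt algebra\<close>

datatype 'i word = Word (letters: "'i list")

instantiation word :: (type) monoid_add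
begin

definition zero_word :: "'i word" where "zero_word = Word []"

definition plus_word :: "'i word \<Rightarrow> 'i word \<Rightarrow> 'i word" where
  "plus_word v w = Word (letters v @ letters w)"

instance by standard (auto simp: zero_word_def plus_word_def)

end

text \<open>
  The monoid algebra of the free monoid on the positive integers is the tensor algebra of
  \<open>W\<^sub>+\<close>, by way of the basis \<open>e\<^sub>i\<close>.
\<close>

type_synonym 'k tensor_alg = "pnat word \<Rightarrow>\<^sub>0 'k"

definition tgen :: "pnat \<Rightarrow> 'k::field_char_0 tensor_alg" where
  "tgen i = Poly_Mapping.single (Word [i]) 1"

definition witt_relators :: "'k::field_char_0 tensor_alg set" where
  "witt_relators =
     {tgen i * tgen j - tgen j * tgen i - Poly_Mapping.single 0 (witt_coeff i j) * tgen (i + j)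
       | i j. True}"

definition witt_rel_ideal :: "'k::field_char_0 tensor_alg set" where
  "witt_rel_ideal = genideal class_ring witt_relators"

lemma ideal_witt_rel_ideal:
  "ideal (witt_rel_ideal :: 'k::field_char_0 tensor_alg set) class_ring"
  unfolding witt_rel_ideal_def by (rule ring.genideal_ideal[OF class_ring.ring_axioms]) simp


lemma witt_rel_ideal_closed:
  fixes a b :: "'k::field_char_0 tensor_alg"
  shows witt_rel_ideal_zero: "0 \<in> (witt_rel_ideal :: 'k tensor_alg set)"
    and witt_rel_ideal_add: "a \<in> witt_rel_ideal \<Longrightarrow> b \<in> witt_rel_ideal \<Longrightarrow> a + b \<in> witt_rel_ideal"
    and witt_rel_ideal_mult_left: "a \<in> witt_rel_ideal \<Longrightarrow> b * a \<in> witt_rel_ideal"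
    and witt_rel_ideal_mult_right: "a \<in> witt_rel_ideal \<Longrightarrow> a * b \<in> witt_rel_ideal"
proof -
  interpret I: ideal "witt_rel_ideal :: 'k tensor_alg set" class_ring
    by (rule ideal_witt_rel_ideal)
  show "0 \<in> (witt_rel_ideal :: 'k tensor_alg set)"
    using I.zero_closed by simp
  show "a \<in> witt_rel_ideal \<Longrightarrow> b \<in> witt_rel_ideal \<Longrightarrow> a + b \<in> witt_rel_ideal"
    using I.a_closed by simp
  show "a \<in> witt_rel_ideal \<Longrightarrow> b * a \<in> witt_rel_ideal"
    using I.I_l_closed by simp
  show "a \<in> witt_rel_ideal \<Longrightarrow> a * b \<in> witt_rel_ideal"
    using I.I_r_closed by simp
qed

lemma witt_rel_ideal_uminus:
  "a \<in> witt_rel_ideal \<Longrightarrow> - a \<in> (witt_rel_ideal :: 'k::field_char_0 tensor_alg set)"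
  using witt_rel_ideal_mult_left[of a "- 1"] by simp

lemma witt_rel_ideal_diff:
  "a \<in> witt_rel_ideal \<Longrightarrow> b \<in> witt_rel_ideal \<Longrightarrow>
     a - b \<in> (witt_rel_ideal :: 'k::field_char_0 tensor_alg set)"
  using witt_rel_ideal_add[OF _ witt_rel_ideal_uminus] by fastforce

definition tensor_aug :: "'k::field_char_0 tensor_alg \<Rightarrow> 'k" where
  "tensor_aug p = Poly_Mapping.lookup p 0"

lemma word_add_eq_0_iff: "(v :: 'i word) + w = 0 \<longleftrightarrow> v = 0 \<and> w = 0"
  by (cases v; cases w) (auto simp: zero_word_def plus_word_def)

lemma tensor_aug_mult: "tensor_aug (p * q) = tensor_aug p * tensor_aug q"
proof -
  have *: "(\<Sum>r. Poly_Mapping.lookup q r when 0 = l + r) =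
      (Poly_Mapping.lookup q 0 when l = 0)" for l :: "pnat word"
  proof -
    have "(\<lambda>r. Poly_Mapping.lookup q r when 0 = l + r) =
        (\<lambda>r. (Poly_Mapping.lookup q 0 when l = 0) when r = 0)"
      by (rule ext) (auto simp: when_def word_add_eq_0_iff eq_commute[of 0 "_ + _"])
    then show ?thesis by (simp only: Sum_any_when_equal)
  qed
  have **: "(\<lambda>l. Poly_Mapping.lookup p l * (\<Sum>r. Poly_Mapping.lookup q r when 0 = l + r)) =
      (\<lambda>l. (Poly_Mapping.lookup p 0 * Poly_Mapping.lookup q 0) when l = 0)"
    by (rule ext) (simp only: *, simp add: when_def)
  show ?thesis
    by (simp only: tensor_aug_def times_poly_mapping.rep_eq prod_fun_def ** Sum_any_when_equal)
qed

lemma tensor_aug_add: "tensor_aug (p + q) = tensor_aug p + tensor_aug q"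
  by (simp add: tensor_aug_def lookup_add)

lemma tensor_aug_diff: "tensor_aug (p - q) = tensor_aug p - tensor_aug q"
  by (simp add: tensor_aug_def lookup_minus)

lemma witt_rel_ideal_aug: "p \<in> witt_rel_ideal \<Longrightarrow> tensor_aug p = 0"
proof -
  let ?M = "{p :: 'a tensor_alg. tensor_aug p = 0}"
  have "ideal ?M class_ring"
  proof (rule idealI)
    show "ring (class_ring :: 'a tensor_alg ring)" by (rule class_ring.ring_axioms)
    show "subgroup ?M (add_monoid class_ring)"
    proof (rule group.subgroupI)
      show "Group.group (add_monoid (class_ring :: 'a tensor_alg ring))"
        by (intro comm_group.axioms abelian_group.a_comm_group ring.is_abelian_group
            class_ring.ring_axioms)
      show "?M \<noteq> {}" by (auto intro!: exI[of _ 0] simp: tensor_aug_def)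
      fix a :: "'a tensor_alg" assume "a \<in> ?M"
      moreover have "inv\<^bsub>add_monoid class_ring\<^esub> a = - a"
        using class_ring_simps by (metis a_inv_def)
      ultimately show "inv\<^bsub>add_monoid class_ring\<^esub> a \<in> ?M"
        by (simp add: tensor_aug_def)
    qed (auto simp: tensor_aug_add)
  qed (auto simp: tensor_aug_mult)
  moreover have "witt_relators \<subseteq> ?M"
    by (auto simp: witt_relators_def tensor_aug_diff tensor_aug_mult)
       (auto simp: tensor_aug_def tgen_def lookup_single zero_word_def)
  ultimately have "witt_rel_ideal \<subseteq> ?M"
    unfolding witt_rel_ideal_def by (rule ring.genideal_minimal[OF class_ring.ring_axioms])
  then show "p \<in> witt_rel_ideal \<Longrightarrow> tensor_aug p = 0" by auto
qed

quotient_type (overloaded) 'k witt_env =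
  "'k::field_char_0 tensor_alg" / "\<lambda>a b. a - b \<in> witt_rel_ideal"
proof (rule equivpI)
  show "reflp (\<lambda>a b :: 'k tensor_alg. a - b \<in> witt_rel_ideal)"
    by (rule reflpI) (simp add: witt_rel_ideal_zero)
  show "symp (\<lambda>a b :: 'k tensor_alg. a - b \<in> witt_rel_ideal)"
  proof (rule sympI)
    fix a b :: "'k tensor_alg" assume "a - b \<in> witt_rel_ideal"
    from witt_rel_ideal_uminus[OF this] show "b - a \<in> witt_rel_ideal" by simp
  qed
  show "transp (\<lambda>a b :: 'k tensor_alg. a - b \<in> witt_rel_ideal)"
  proof (rule transpI)
    fix a b c :: "'k tensor_alg"
    assume "a - b \<in> witt_rel_ideal" "b - c \<in> witt_rel_ideal"
    from witt_rel_ideal_add[OF this] show "a - c \<in> witt_rel_ideal" by simp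
  qed
qed

instantiation witt_env :: (field_char_0) ring_1
begin

lift_definition zero_witt_env :: "'a witt_env" is 0 .

lift_definition one_witt_env :: "'a witt_env" is 1 .

lift_definition plus_witt_env :: "'a witt_env \<Rightarrow> 'a witt_env \<Rightarrow> 'a witt_env" is "(+)"
proof -
  fix a b c d :: "'a tensor_alg"
  assume "a - b \<in> witt_rel_ideal" "c - d \<in> witt_rel_ideal"
  from witt_rel_ideal_add[OF this] show "a + c - (b + d) \<in> witt_rel_ideal"
    by (simp add: algebra_simps)
qed

lift_definition uminus_witt_env :: "'a witt_env \<Rightarrow> 'a witt_env" is uminus
proof -
  fix a b :: "'a tensor_alg"
  assume "a - b \<in> witt_rel_ideal"
  from witt_rel_ideal_uminus[OF this] show "- a - - b \<in> witt_rel_ideal" by simp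
qed

lift_definition minus_witt_env :: "'a witt_env \<Rightarrow> 'a witt_env \<Rightarrow> 'a witt_env" is "(-)"
proof -
  fix a b c d :: "'a tensor_alg"
  assume "a - b \<in> witt_rel_ideal" "c - d \<in> witt_rel_ideal"
  from witt_rel_ideal_diff[OF this] show "a - c - (b - d) \<in> witt_rel_ideal"
    by (simp add: algebra_simps)
qed

lift_definition times_witt_env :: "'a witt_env \<Rightarrow> 'a witt_env \<Rightarrow> 'a witt_env" is "(*)"
proof -
  fix a b c d :: "'a tensor_alg"
  assume "a - b \<in> witt_rel_ideal" "c - d \<in> witt_rel_ideal"
  then have "(a - b) * c + b * (c - d) \<in> witt_rel_ideal"
    by (intro witt_rel_ideal_add witt_rel_ideal_mult_left witt_rel_ideal_mult_right)
  then show "a * c - b * d \<in> witt_rel_ideal"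
    by (simp add: algebra_simps)
qed

instance
proof
  show "(0 :: 'a witt_env) \<noteq> 1"
  proof
    assume "(0 :: 'a witt_env) = 1"
    then have "0 - 1 \<in> (witt_rel_ideal :: 'a tensor_alg set)"
      by transfer
    then have "tensor_aug (0 - 1 :: 'a tensor_alg) = 0" by (rule witt_rel_ideal_aug)
    then show False by (simp add: tensor_aug_def lookup_minus lookup_one)
  qed
qed (transfer; simp add: algebra_simps witt_rel_ideal_zero)+

end

lift_definition witt_smult :: "'k::field_char_0 \<Rightarrow> 'k witt_env \<Rightarrow> 'k witt_env"
  is "\<lambda>c p. Poly_Mapping.single 0 c * p"
proof -
  fix c :: 'k and a b :: "'k tensor_alg"
  assume "a - b \<in> witt_rel_ideal"
  then have "Poly_Mapping.single 0 c * (a - b) \<in> witt_rel_ideal"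
    by (rule witt_rel_ideal_mult_left)
  then show "Poly_Mapping.single 0 c * a - Poly_Mapping.single 0 c * b \<in> witt_rel_ideal"
    by (simp add: algebra_simps)
qed

lift_definition e_gen :: "pnat \<Rightarrow> 'k::field_char_0 witt_env" is tgen .

definition U_witt :: "('k::field_char_0, 'k witt_env) module" where
  "U_witt = ring.extend class_ring (module.fields witt_smult)"

lemma U_witt_simps [simp]:
  "carrier U_witt = UNIV" "mult U_witt = (*)" "one U_witt = 1" "zero U_witt = 0"
  "add U_witt = (+)" "smult U_witt = witt_smult"
  by (simp_all add: U_witt_def ring.defs module.defs)

lemma ring_U_witt: "ring (U_witt :: ('k::field_char_0, 'k witt_env) module)"
proof (rule ringI)
  show "abelian_group (U_witt :: ('k, 'k witt_env) module)"
    by (rule abelian_groupI) (auto simp: algebra_simps intro: exI[of _ "- z" for z])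
  show "Group.monoid (U_witt :: ('k, 'k witt_env) module)"
    by (rule Group.monoidI) (auto simp: algebra_simps)
qed (auto simp: algebra_simps)

lemma vectorspace_U_witt:
  "vectorspace class_ring (U_witt :: ('k::field_char_0, 'k witt_env) module)"
proof (intro vectorspace.intro Module.moduleI)
  show "abelian_group (U_witt :: ('k, 'k witt_env) module)"
    by (rule ring.is_abelian_group[OF ring_U_witt])
  have 1: "witt_smult (a + b) u = witt_smult a u + witt_smult b (u :: 'k witt_env)" for a b u
    by transfer (simp add: single_add distrib_right witt_rel_ideal_zero)
  have 2: "witt_smult a (u + v) = witt_smult a u + witt_smult a (v :: 'k witt_env)" for a u v
    by transfer (simp add: distrib_left witt_rel_ideal_zero)
  have 3: "witt_smult (a * b) u = witt_smult a (witt_smult b (u :: 'k witt_env))" for a b u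
    by transfer (simp add: mult_single witt_rel_ideal_zero flip: mult.assoc)
  have 4: "witt_smult 1 u = (u :: 'k witt_env)" for u
    by transfer (simp add: witt_rel_ideal_zero)
  fix a b :: 'k and u v :: "'k witt_env"
  show "(a \<oplus>\<^bsub>class_ring\<^esub> b) \<odot>\<^bsub>U_witt\<^esub> u = a \<odot>\<^bsub>U_witt\<^esub> u \<oplus>\<^bsub>U_witt\<^esub> b \<odot>\<^bsub>U_witt\<^esub> u"
    by (simp add: 1)
  show "a \<odot>\<^bsub>U_witt\<^esub> (u \<oplus>\<^bsub>U_witt\<^esub> v) = a \<odot>\<^bsub>U_witt\<^esub> u \<oplus>\<^bsub>U_witt\<^esub> a \<odot>\<^bsub>U_witt\<^esub> v"
    by (simp add: 2)
  show "(a \<otimes>\<^bsub>class_ring\<^esub> b) \<odot>\<^bsub>U_witt\<^esub> u = a \<odot>\<^bsub>U_witt\<^esub> (b \<odot>\<^bsub>U_witt\<^esub> u)"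
    by (simp add: 3)
  show "\<one>\<^bsub>class_ring\<^esub> \<odot>\<^bsub>U_witt\<^esub> u = u"
    by (simp add: 4)
qed (simp_all add: class_cring.cring_axioms class_field.field_axioms)

lemma e_gen_commutator:
  "e_gen i * e_gen j - e_gen j * e_gen i = witt_smult (witt_coeff i j) (e_gen (i + j))"
proof transfer
  fix i j
  have "tgen i * tgen j - tgen j * tgen i - Poly_Mapping.single 0 (witt_coeff i j) * tgen (i + j)
      \<in> (witt_relators :: 'a tensor_alg set)"
    by (auto simp: witt_relators_def)
  then show "tgen i * tgen j - tgen j * tgen i
      - Poly_Mapping.single 0 (witt_coeff i j) * tgen (i + j) \<in> (witt_rel_ideal :: 'a tensor_alg set)"
    unfolding witt_rel_ideal_def
    using ring.genideal_self[OF class_ring.ring_axioms, of witt_relators] by auto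
qed


section \<open>The symmetric algebra and its Poisson bracket\<close>

text \<open>
  The monoid algebra of the free commutative monoid on the positive integers, that is,
  \<open>'k[x\<^sub>1, x\<^sub>2, \<dots>]\<close>; the monomial \<open>x\<^bsub>i\<^sub>1\<^esub> \<cdots> x\<^bsub>i\<^sub>l\<^esub>\<close> is the multiset of its indices.
\<close>

type_synonym 'k witt_sym = "pnat multiset \<Rightarrow>\<^sub>0 'k"

definition x_gen :: "pnat \<Rightarrow> 'k::field_char_0 witt_sym" where
  "x_gen i = Poly_Mapping.single {#i#} 1"

definition sym_vars :: "'k::field_char_0 witt_sym \<Rightarrow> pnat set" where
  "sym_vars p = (\<Union>m\<in>Poly_Mapping.keys p. set_mset m)"

definition sym_partial :: "pnat \<Rightarrow> 'k::field_char_0 witt_sym \<Rightarrow> 'k witt_sym" where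
  "sym_partial i p =
     (\<Sum>m\<in>Poly_Mapping.keys p.
        Poly_Mapping.single (m - {#i#}) (of_nat (count m i) * Poly_Mapping.lookup p m))"

text \<open>
  \<open>{p, q} = \<Sum>\<^sub>i\<^sub>,\<^sub>j {x\<^sub>i, x\<^sub>j} (\<partial>p/\<partial>x\<^sub>i) (\<partial>q/\<partial>x\<^sub>j)\<close>, the unique extension of
  \<open>{x\<^sub>i, x\<^sub>j} = (j - i) x\<^bsub>i+j\<^esub>\<close> satisfying the Leibniz rule.
\<close>

definition sym_bracket ::
    "'k::field_char_0 witt_sym \<Rightarrow> 'k witt_sym \<Rightarrow> 'k witt_sym" where
  "sym_bracket p q =
     (\<Sum>i\<in>sym_vars p. \<Sum>j\<in>sym_vars q.
        Poly_Mapping.single 0 (witt_coeff i j) * x_gen (i + j) * sym_partial i p * sym_partial j q)"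

definition S_witt :: "('k::field_char_0, 'k witt_sym) poisson" where
  "S_witt =
     module.extend
       (ring.extend class_ring (module.fields (\<lambda>c p. Poly_Mapping.single 0 c * p)))
       (poisson.fields sym_bracket)"

lemma sym_bracket_gen:
  "sym_bracket (x_gen i) (x_gen j) = Poly_Mapping.single 0 (witt_coeff i j) * x_gen (i + j)"
  by (simp add: sym_bracket_def sym_vars_def sym_partial_def x_gen_def)

lemma S_witt_simps [simp]:
  "carrier S_witt = UNIV" "mult S_witt = (*)" "one S_witt = 1" "zero S_witt = 0"
  "add S_witt = (+)" "smult S_witt = (\<lambda>c p. Poly_Mapping.single 0 c * p)"
  "pbracket S_witt = sym_bracket"
  by (simp_all add: S_witt_def ring.defs module.defs poisson.defs)

lemma poly_mapping_induct_single:
  assumes "\<And>m c. P (Poly_Mapping.single m c)" and "\<And>p q. P p \<Longrightarrow> P q \<Longrightarrow> P (p + q)"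
  shows "P (p :: 'm \<Rightarrow>\<^sub>0 'k::comm_monoid_add)"
proof (induction p rule: Poly_Mapping.update_induct)
  case const
  show ?case using assms(1)[of undefined 0] by simp
next
  case (update f a b)
  have "Poly_Mapping.update a b f = f + Poly_Mapping.single a b"
    using update(1)
    by (intro poly_mapping_eqI) (auto simp: lookup_update lookup_add lookup_single in_keys_iff)
  then show ?case using assms update by metis
qed

lemma sym_vars_finite [simp]: "finite (sym_vars p)"
  by (simp add: sym_vars_def)

lemma sym_partial_superset:
  "finite M \<Longrightarrow> Poly_Mapping.keys p \<subseteq> M \<Longrightarrow>
   sym_partial i p = (\<Sum>m\<in>M. Poly_Mapping.single (m - {#i#}) (of_nat (count m i) * Poly_Mapping.lookup p m))"
  unfolding sym_partial_def by (rule sum.mono_neutral_left) (auto simp: in_keys_iff)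

lemma sym_partial_add: "sym_partial i (p + q) = sym_partial i p + sym_partial i q"
proof -
  let ?M = "Poly_Mapping.keys p \<union> Poly_Mapping.keys q"
  have "Poly_Mapping.keys (p + q) \<subseteq> ?M" by (rule Poly_Mapping.keys_add)
  then show ?thesis
    by (simp add: sym_partial_superset[of ?M] lookup_add algebra_simps single_add sum.distrib)
qed

lemma sym_partial_single:
  "sym_partial i (Poly_Mapping.single m c) = Poly_Mapping.single (m - {#i#}) (of_nat (count m i) * c)"
  by (simp add: sym_partial_def)

lemma sym_partial_mult: "sym_partial i (p * q) = sym_partial i p * q + p * sym_partial i q"
proof -
  have mono: "sym_partial i (Poly_Mapping.single m c * Poly_Mapping.single n d) =
     sym_partial i (Poly_Mapping.single m c) * Poly_Mapping.single n d +
     Poly_Mapping.single m c * sym_partial i (Poly_Mapping.single n d)" for m n and c d :: 'a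
  proof -
    have 1: "Poly_Mapping.single (m + n - {#i#}) (of_nat (count m i) * c * d) =
      Poly_Mapping.single (m - {#i#} + n) (of_nat (count m i) * c * d)"
      by (cases "i \<in># m") (auto simp: not_in_iff)
    have 2: "Poly_Mapping.single (m + n - {#i#}) (c * (of_nat (count n i) * d)) =
      Poly_Mapping.single (m + (n - {#i#})) (c * (of_nat (count n i) * d))"
      by (cases "i \<in># n") (auto simp: not_in_iff)
    have 3: "of_nat (count (m + n) i) * (c * d) =
       of_nat (count m i) * c * d + c * (of_nat (count n i) * d)" by (simp add: algebra_simps)
    show ?thesis
      by (simp only: sym_partial_single mult_single single_add 1 2 3)
  qed
  have step: "sym_partial i (Poly_Mapping.single m c * q) =
     sym_partial i (Poly_Mapping.single m c) * q + Poly_Mapping.single m c * sym_partial i q" for m c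
    by (induction q rule: poly_mapping_induct_single)
       (simp_all only: mono distrib_left sym_partial_add add_ac)
  show ?thesis
    by (induction p rule: poly_mapping_induct_single)
       (simp_all only: step distrib_right sym_partial_add add_ac)
qed

lemma sym_partial_not_var: "i \<notin> sym_vars p \<Longrightarrow> sym_partial i p = 0"
  unfolding sym_partial_def
  by (rule sum.neutral) (auto simp: sym_vars_def not_in_iff)

lemma sym_bracket_superset:
  assumes "finite X" "finite Y" "sym_vars p \<subseteq> X" "sym_vars q \<subseteq> Y"
  shows "sym_bracket p q = (\<Sum>i\<in>X. \<Sum>j\<in>Y.
        Poly_Mapping.single 0 (witt_coeff i j) * x_gen (i + j) * sym_partial i p * sym_partial j q)"
proof -
  have "sym_bracket p q = (\<Sum>i\<in>sym_vars p. \<Sum>j\<in>Y.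
        Poly_Mapping.single 0 (witt_coeff i j) * x_gen (i + j) * sym_partial i p * sym_partial j q)"
    unfolding sym_bracket_def
    by (intro sum.cong[OF refl] sum.mono_neutral_left)
      (use assms in \<open>auto simp: sym_partial_not_var\<close>)
  also have "\<dots> = (\<Sum>i\<in>X. \<Sum>j\<in>Y.
        Poly_Mapping.single 0 (witt_coeff i j) * x_gen (i + j) * sym_partial i p * sym_partial j q)"
    by (intro sum.mono_neutral_left) (use assms in \<open>auto simp: sym_partial_not_var\<close>)
  finally show ?thesis .
qed

lemma sym_bracket_Leibniz: "sym_bracket p (q * r) = sym_bracket p q * r + q * sym_bracket p r"
proof -
  let ?X = "sym_vars p" and ?Y = "sym_vars q \<union> sym_vars r \<union> sym_vars (q * r)"
  have *: "sym_bracket p s = (\<Sum>i\<in>?X. \<Sum>j\<in>?Y.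
      Poly_Mapping.single 0 (witt_coeff i j) * x_gen (i + j) * sym_partial i p * sym_partial j s)"
    if "sym_vars s \<subseteq> ?Y" for s
    by (rule sym_bracket_superset) (use that in auto)
  let ?c = "\<lambda>i j. Poly_Mapping.single 0 (witt_coeff i j) * x_gen (i + j) * sym_partial i p"
  have "sym_bracket p (q * r) =
      (\<Sum>i\<in>?X. \<Sum>j\<in>?Y. ?c i j * sym_partial j q * r + q * (?c i j * sym_partial j r))"
    unfolding *[OF Un_upper2] sym_partial_mult
    by (intro sum.cong refl) (simp only: distrib_left mult_ac)
  also have "\<dots> = (\<Sum>i\<in>?X. \<Sum>j\<in>?Y. ?c i j * sym_partial j q) * r
      + q * (\<Sum>i\<in>?X. \<Sum>j\<in>?Y. ?c i j * sym_partial j r)"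
    by (simp only: sum.distrib sum_distrib_left sum_distrib_right)
  also have "(\<Sum>i\<in>?X. \<Sum>j\<in>?Y. ?c i j * sym_partial j q) = sym_bracket p q"
    by (rule *[symmetric]) blast
  also have "(\<Sum>i\<in>?X. \<Sum>j\<in>?Y. ?c i j * sym_partial j r) = sym_bracket p r"
    by (rule *[symmetric]) blast
  finally show ?thesis .
qed

lemma sym_bracket_antisym: "sym_bracket p q = - sym_bracket q p"
proof -
  have "sym_bracket q p = (\<Sum>i\<in>sym_vars p. \<Sum>j\<in>sym_vars q.
     Poly_Mapping.single 0 (witt_coeff j i) * x_gen (j + i) * sym_partial j q * sym_partial i p)"
    unfolding sym_bracket_def by (rule sum.swap)
  also have "\<dots> = (\<Sum>i\<in>sym_vars p. \<Sum>j\<in>sym_vars q.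
     - (Poly_Mapping.single 0 (witt_coeff i j) * x_gen (i + j) * sym_partial i p * sym_partial j q))"
  proof (intro sum.cong refl)
    fix i j :: pnat
    have 1: "j + i = i + j"
      by (simp add: nat_of_pnat_inject[symmetric] plus_pnat.rep_eq)
    have 2: "witt_coeff j i = - (witt_coeff i j :: 'a)" by (simp add: witt_coeff_def)
    show "Poly_Mapping.single 0 (witt_coeff j i) * x_gen (j + i) * sym_partial j q * sym_partial i p
      = - (Poly_Mapping.single 0 (witt_coeff i j) * x_gen (i + j) * sym_partial i p * sym_partial j q)"
      unfolding 1 2 single_uminus by (simp add: mult_ac)
  qed
  also have "\<dots> = - sym_bracket p q"
    by (simp add: sym_bracket_def sum_negf)
  finally show ?thesis by simp
qed


section \<open>Filtrations and associated graded ideals\<close>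

definition word_prod :: "pnat list \<Rightarrow> 'k::field_char_0 witt_env" where
  "word_prod ws = prod_list (map e_gen ws)"

definition word_deg :: "pnat list \<Rightarrow> nat" where
  "word_deg ws = sum_list (map nat_of_pnat ws)"

definition U_deg :: "nat \<Rightarrow> 'k::field_char_0 witt_env set" where
  "U_deg n = lspan U_witt {word_prod ws | ws. word_deg ws = n}"

text \<open>
  In the three definitions of associated graded ideals, the quantified \<open>n\<close> is the filtration
  degree, and elements of \<open>J\<close> are considered modulo the pieces of degree \<open>< n\<close>.  The leading
  term may vanish, which does not affect the span.
\<close>

definition gr_d :: "'k::field_char_0 witt_env set \<Rightarrow> 'k witt_env set" where
  "gr_d J =
     lspan U_witt {v. \<exists>n. \<exists>u\<in>J. v \<in> U_deg n \<and> u - v \<in> lspan U_witt (\<Union>k<n. U_deg k)}"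

definition ord_filt :: "nat \<Rightarrow> 'k::field_char_0 witt_env set" where
  "ord_filt n = lspan U_witt {word_prod ws | ws. length ws \<le> n}"

definition do_filt :: "nat \<Rightarrow> 'k::field_char_0 witt_env set" where
  "do_filt n =
     lspan U_witt {word_prod ws | ws. sorted ws \<and> word_deg ws + length ws \<le> n}"

definition S_ord :: "nat \<Rightarrow> 'k::field_char_0 witt_sym set" where
  "S_ord n = lspan S_witt {Poly_Mapping.single m 1 | m. size m = n}"

definition S_do :: "nat \<Rightarrow> 'k::field_char_0 witt_sym set" where
  "S_do n =
     lspan S_witt {Poly_Mapping.single m 1 | m. (\<Sum>i\<in>#m. nat_of_pnat i) + size m = n}"

definition pbw :: "'k::field_char_0 witt_sym \<Rightarrow> 'k witt_env" where
  "pbw p =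
     (\<Sum>m\<in>Poly_Mapping.keys p.
        witt_smult (Poly_Mapping.lookup p m) (word_prod (sorted_list_of_multiset m)))"

text \<open>
  The identification of the associated graded ring of either filtration \<open>F\<close> with \<open>S(W\<^sub>+)\<close>
  sends a homogeneous \<open>p\<close> of degree \<open>n\<close> to the class of \<^term>\<open>pbw p\<close> modulo the pieces of
  degree \<open>< n\<close>.  So \<open>p\<close> is the symbol in degree \<open>n\<close> of \<open>u\<close> iff \<open>u\<close> and \<^term>\<open>pbw p\<close> are
  congruent modulo these.
\<close>

definition is_symbol ::
    "(nat \<Rightarrow> 'k::field_char_0 witt_env set) \<Rightarrow> (nat \<Rightarrow> 'k witt_sym set) \<Rightarrow>
       nat \<Rightarrow> 'k witt_env \<Rightarrow> 'k witt_sym \<Rightarrow> bool" where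
  "is_symbol F S n u p \<longleftrightarrow> p \<in> S n \<and> u - pbw p \<in> lspan U_witt (\<Union>k<n. F k)"

definition gr_o :: "'k::field_char_0 witt_env set \<Rightarrow> 'k witt_sym set" where
  "gr_o J = lspan S_witt {p. \<exists>n. \<exists>u\<in>J. is_symbol ord_filt S_ord n u p}"

definition gr_do :: "'k::field_char_0 witt_env set \<Rightarrow> 'k witt_sym set" where
  "gr_do J = lspan S_witt {p. \<exists>n. \<exists>u\<in>J. is_symbol do_filt S_do n u p}"

end

theory Submission
  imports Defs "HOL-Library.Product_Lexorder" "HOL-Library.Countable"
begin

text \<open>
  The three dimensions are limits superior of \<open>log\<^sub>n\<close> of one and the same counting function.
  Order the monomials in the \<open>e\<^sub>i\<close> (or \<open>x\<^sub>i\<close>) by degree, then by length, then arbitrarily; each has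
  finitely many predecessors.  For a subspace, call a monomial standard if it is not,
  modulo that subspace, a combination of its predecessors.  The standard monomials of degree at most \<open>n\<close>
  are a basis of the image of the filtration piece of degree \<open>n\<close>, and passing from \<open>J\<close> to
  \<open>gr\<^sub>d J\<close> and then to \<open>gr\<^sub>o\<close> does not change which monomials are standard, because the order
  refines the degree and then the length.  Only the straightening half of the
  Poincare--Birkhoff--Witt theorem enters: the symbols of \<open>0\<close> lie in \<open>K\<close> anyway.

  On the other hand, by \<open>[e\<^sub>1, e\<^sub>j] = (j - 1) e\<^bsub>j+1\<^esub>\<close> the span of \<open>e\<^sub>1, e\<^sub>2\<close> generates each \<open>e\<^sub>i\<close>
  in \<open>i\<close> steps.  So the powers of this subspace contain the degree filtration, while the
  powers of any finite-dimensional subspace lie in a linear rescaling of it, which the limit superior does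
  not notice.  The same holds for Poisson powers in \<open>S(W\<^sub>+)\<close>.
\<close>

section \<open>Dimensions of subspaces and quotients\<close>

text \<open>The pieces of the order filtration are infinite-dimensional, so dimensions can be
  counted by degree only; this is why the degree is compared before the length.

  The delicate point is the lower bound for Poisson powers. They are built by letting single
  elements of V act on the left, by product or by bracket, so it is not enough that x_i lies in the
  i-th power of V: multiplication by x_i has to carry the n-th piece of the growth filtration into
  the (n+i)-th. By the Leibniz rule the commutator of the operator {x_1, -} with multiplication by
  x_j is (j-1) times multiplication by x_{1+j}, so this follows by induction on the index. In U(W_+)
  left multiplication by e_1 takes the place of {x_1, -}. The factor j-1 vanishes for j = 1, hence
  the second generator of index 2, and characteristic zero makes it invertible for j at least 2. The
  opposite bound is easy, since products and brackets both add degrees.\<close>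

context vectorspace
begin

lemma span_subset_iff: "S \<subseteq> carrier V \<Longrightarrow> subspace K N V \<Longrightarrow> span S \<subseteq> N \<longleftrightarrow> S \<subseteq> N"
  using in_own_span[of S] span_is_subset[of S N] by auto

lemma lin_indpt_insert:
  assumes "S \<subseteq> carrier V" "lin_indpt S" "x \<in> carrier V" "x \<notin> span S"
  shows "lin_indpt (insert x S)"
proof -
  have "x \<notin> S" using assms in_own_span by blast
  then show ?thesis using lin_dep_iff_in_span[of S x] assms by auto
qed

lemma span_insert_absorb:
  assumes "S \<subseteq> carrier V" "x \<in> span S"
  shows "span (insert x S) = span S"
proof
  have "x \<in> carrier V" using assms span_is_subset2 by blast
  then show "span (insert x S) \<subseteq> span S"
    using assms in_own_span[of S] span_is_subspace[OF assms(1)] by (subst span_subset_iff) auto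
  show "span S \<subseteq> span (insert x S)" by (rule span_is_monotone) auto
qed

lemma span_insert_cong:
  assumes "S \<subseteq> carrier V" "T \<subseteq> carrier V" "span S = span T" "x \<in> carrier V"
  shows "span (insert x S) = span (insert x T)"
proof -
  have "span (insert x S) \<subseteq> span (insert x T)"
    if "S \<subseteq> carrier V" "T \<subseteq> carrier V" "span S = span T" for S T
  proof -
    have "subspace K (span (insert x T)) V" using that assms by (intro span_is_subspace) auto
    moreover have "S \<subseteq> span (insert x T)"
      using that in_own_span[of S] span_is_monotone[OF subset_insertI[of T x]] by auto
    moreover have "x \<in> span (insert x T)" using in_own_span[of "insert x T"] that assms by auto
    ultimately show ?thesis using that assms by (subst span_subset_iff) auto
  qed
  from this[of S T] this[of T S] assms show ?thesis by auto
qed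

lemma dim_span_lin_indpt:
  assumes "finite B" "B \<subseteq> carrier V" "lin_indpt B"
  shows "vectorspace.dim K (vs (span B)) = card B"
proof -
  have sub: "subspace K (span B) V" using assms by (intro span_is_subspace)
  then interpret W: vectorspace K "vs (span B)" by (rule subspace_is_vs)
  have "W.basis B"
    using span_li_not_depend[OF in_own_span is_module[OF sub], OF assms(2)] assms in_own_span[of B]
    by (auto simp: W.basis_def)
  then show ?thesis by (rule W.dim_basis[OF assms(1)])
qed

text \<open>Greedily discarding each vector that depends on its predecessors leaves a basis.\<close>

lemma dim_span_ordered_family:
  fixes key :: "'i \<Rightarrow> 'o::linorder"
  assumes "finite M" "inj_on key M" "v ` M \<subseteq> carrier V"
  shows "vectorspace.dim K (vs (span (v ` M))) =
    card {m \<in> M. v m \<notin> span (v ` {m' \<in> M. key m' < key m})}"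
proof -
  define new where "new M m \<longleftrightarrow> v m \<notin> span (v ` {m' \<in> M. key m' < key m})" for M m
  let ?N = "\<lambda>M. {m \<in> M. new M m}"
  have "inj_on v (?N M) \<and> lin_indpt (v ` ?N M) \<and> span (v ` ?N M) = span (v ` M)"
    using assms
  \<comment> \<open>Indices are inserted in ascending order of \<open>key\<close>, so an insertion
    does not change the predecessors of the indices already present.\<close>
  proof (induction M rule: finite_ranking_induct[where f = key])
    case empty
    have "lin_indpt {}" by (auto simp: lin_dep_def)
    then show ?case by simp
  next
    case (insert x S)
    show ?case
    proof (cases "x \<in> S")
      case True
      then show ?thesis using insert by (simp add: insert_absorb)
    next
      case False
      have lt: "key y < key x" if "y \<in> S" for y
        using that insert.hyps(2)[of y] insert.prems(1) False by (auto simp: inj_on_def order_less_le)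
      have "{m' \<in> insert x S. key m' < key x} = S" using lt by auto
      then have x: "new (insert x S) x \<longleftrightarrow> v x \<notin> span (v ` S)" by (simp only: new_def)
      have y: "new (insert x S) y \<longleftrightarrow> new S y" if "y \<in> S" for y
      proof -
        have "{m' \<in> insert x S. key m' < key y} = {m' \<in> S. key m' < key y}" using lt[OF that] by auto
        then show ?thesis by (simp only: new_def)
      qed
      have N: "?N (insert x S) = (if v x \<in> span (v ` S) then ?N S else insert x (?N S))"
        using x y False by auto
      have IH: "inj_on v (?N S)" "lin_indpt (v ` ?N S)" "span (v ` ?N S) = span (v ` S)"
        using insert.IH insert.prems by auto
      have c: "v ` ?N S \<subseteq> carrier V" "v ` S \<subseteq> carrier V" "v x \<in> carrier V"
        using insert.prems by auto
      show ?thesis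
      proof (cases "v x \<in> span (v ` S)")
        case True
        then show ?thesis unfolding N using IH c by (simp add: span_insert_absorb)
      next
        case nin: False
        then have "v x \<notin> v ` ?N S" using in_own_span[OF c(2)] by auto
        moreover have "lin_indpt (insert (v x) (v ` ?N S))"
          using nin IH c by (intro lin_indpt_insert) simp_all
        moreover have "span (insert (v x) (v ` ?N S)) = span (insert (v x) (v ` S))"
          using IH c by (intro span_insert_cong) simp_all
        ultimately show ?thesis
          unfolding N using nin IH(1) False by simp
      qed
    qed
  qed
  moreover have "vectorspace.dim K (vs (span (v ` ?N M))) = card (v ` ?N M)"
    using calculation assms by (intro dim_span_lin_indpt) auto
  ultimately show ?thesis by (simp add: card_image new_def)
qed

text \<open>Linear independence means the same in V, in \<open>W\<close> and in the span of
  \<open>F\<close>. So the independent subsets of \<open>W\<close> have bounded size, and a maximal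
  one is a basis of \<open>W\<close>.\<close>

lemma dim_subspace_le:
  assumes F: "finite F" "F \<subseteq> carrier V" and W: "subspace K W V" "W \<subseteq> span F"
  shows "vectorspace.fin_dim K (vs W)"
    and "vectorspace.dim K (vs W) \<le> vectorspace.dim K (vs (span F))"
proof -
  have sub: "subspace K (span F) V" using F by (intro span_is_subspace)
  interpret W: vectorspace K "vs W" using W(1) by (rule subspace_is_vs)
  interpret E: vectorspace K "vs (span F)" using sub by (rule subspace_is_vs)
  have "E.fin_dim"
    using span_li_not_depend[OF in_own_span is_module[OF sub], OF F(2)] F in_own_span[OF F(2)]
    by (auto simp: E.fin_dim_def)
  note E = E.li_le_dim[OF this]
  have li: "finite A \<and> card A \<le> E.dim" if "A \<subseteq> carrier (vs W) \<and> W.lin_indpt A" for A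
  proof -
    have "lin_indpt A" using that span_li_not_depend(2)[OF _ is_module[OF W(1)], of A] by auto
    then have "E.lin_indpt A"
      using that W span_li_not_depend(2)[OF _ is_module[OF sub], of A] by auto
    then show ?thesis using E[of A] that W by auto
  qed
  have "\<exists>A. finite A \<and> maximal A (\<lambda>S. S \<subseteq> carrier (vs W) \<and> W.lin_indpt S)"
  proof (rule maximal_exists)
    show "finite A \<and> card A \<le> E.dim" if "A \<subseteq> carrier (vs W) \<and> W.lin_indpt A" for A
      using that by (rule li)
    show "{} \<subseteq> carrier (vs W) \<and> W.lin_indpt {}" by (simp add: W.lin_dep_def)
  qed
  then obtain A where A: "finite A" "W.basis A"
    using W.max_li_is_basis by blast
  show "W.fin_dim" using A unfolding W.fin_dim_def W.basis_def by blast
  show "W.dim \<le> E.dim" using W.dim_basis[OF A] li[of A] A unfolding W.basis_def by argo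
qed

end

text \<open>Reduces linear algebra in a quotient record to spans of representatives in the
  type-class theory. The trivial instance, the identity with \<open>J = {0}\<close>, also identifies
  \<open>lspan\<close> in an algebra with its type-class span.\<close>

locale vs_quotient = vector_space scale
  for scale :: "'k::field \<Rightarrow> 'a::ab_group_add \<Rightarrow> 'a" +
  fixes Q :: "('k, 'b, 'n) module_scheme" and \<pi> :: "'a \<Rightarrow> 'b" and J :: "'a set"
  assumes vectorspace_Q: "vectorspace class_ring Q"
    and carrier_Q: "carrier Q = range \<pi>"
    and proj_add: "\<pi> (x + y) = \<pi> x \<oplus>\<^bsub>Q\<^esub> \<pi> y"
    and proj_scale: "\<pi> (scale c x) = c \<odot>\<^bsub>Q\<^esub> \<pi> x"
    and proj_eq_iff: "\<pi> x = \<pi> y \<longleftrightarrow> x - y \<in> J"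
begin

interpretation Q: vectorspace class_ring Q
  by (rule vectorspace_Q)

lemma proj_0: "\<pi> 0 = \<zero>\<^bsub>Q\<^esub>"
proof -
  have "\<pi> 0 \<oplus>\<^bsub>Q\<^esub> \<pi> 0 = \<pi> 0" using proj_add[of 0 0] by simp
  then show ?thesis
    using Q.M.show_r_zero[of "\<pi> 0" "\<pi> 0"] carrier_Q by simp
qed

lemma subspace_proj_image:
  assumes "subspace W"
  shows "VectorSpace.subspace class_ring (\<pi> ` W) Q"
proof -
  have "submodule class_ring (\<pi> ` W) Q"
  proof (unfold submodule_def, safe)
    show "Module.module class_ring Q" by (rule Q.module_axioms)
    show "\<pi> x \<in> carrier Q" for x by (simp add: carrier_Q)
    show "\<zero>\<^bsub>Q\<^esub> \<in> \<pi> ` W" using subspace_0[OF assms] proj_0 by force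
    show "\<pi> x \<oplus>\<^bsub>Q\<^esub> \<pi> y \<in> \<pi> ` W" if "x \<in> W" "y \<in> W" for x y
      using subspace_add[OF assms that] by (auto simp flip: proj_add)
    show "c \<odot>\<^bsub>Q\<^esub> \<pi> x \<in> \<pi> ` W" if "x \<in> W" for c x
      using subspace_scale[OF assms that] by (auto simp flip: proj_scale)
  qed
  then show ?thesis by (simp add: VectorSpace.subspace_def vectorspace_Q)
qed

lemma subspace_proj_vimage:
  assumes "VectorSpace.subspace class_ring W Q"
  shows "subspace {x. \<pi> x \<in> W}"
proof -
  interpret submodule class_ring W Q using assms by (simp add: VectorSpace.subspace_def)
  show ?thesis by (auto simp: subspace_def proj_0 proj_add proj_scale)
qed

lemma lspan_proj: "lspan Q (\<pi> ` X) = \<pi> ` span X"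
proof
  have X: "\<pi> ` X \<subseteq> carrier Q" by (auto simp: carrier_Q)
  show "lspan Q (\<pi> ` X) \<subseteq> \<pi> ` span X"
    unfolding lspan_def using X subspace_proj_image[OF subspace_span]
    by (subst Q.span_subset_iff) (auto intro: span_base)
  have "X \<subseteq> {x. \<pi> x \<in> lspan Q (\<pi> ` X)}"
    unfolding lspan_def using Q.in_own_span[OF X] by auto
  then have "span X \<subseteq> {x. \<pi> x \<in> lspan Q (\<pi> ` X)}"
    using Q.span_is_subspace[OF X] by (intro span_minimal subspace_proj_vimage) (auto simp: lspan_def)
  then show "\<pi> ` span X \<subseteq> lspan Q (\<pi> ` X)" by auto
qed

lemma proj_in_lspan_iff: "\<pi> x \<in> lspan Q (\<pi> ` X) \<longleftrightarrow> (\<exists>w\<in>span X. x - w \<in> J)"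
  by (simp add: lspan_proj image_iff proj_eq_iff Bex_def)

lemma fin_dim_subspace_proj:
  assumes "finite F"
  shows "fin_dim_subspace Q (\<pi> ` span F)"
proof -
  have F: "finite (\<pi> ` F)" "\<pi> ` F \<subseteq> carrier Q" using assms by (auto simp: carrier_Q)
  have W: "VectorSpace.subspace class_ring (\<pi> ` span F) Q"
    by (rule subspace_proj_image[OF subspace_span])
  show ?thesis
    using Q.dim_subspace_le(1)[OF F W] lspan_proj[of F] W
    unfolding fin_dim_subspace_def lspan_def by simp
qed

text \<open>Lifting a finite spanning set to representatives allows the growth of any admissible
  subspace of the quotient to be estimated before passing to the quotient.\<close>

lemma fin_dim_subspaceE:
  assumes "fin_dim_subspace Q W"
  obtains F where "finite F" "W = \<pi> ` span F"
proof -
  have sub: "VectorSpace.subspace class_ring W Q" using assms by (simp add: fin_dim_subspace_def)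
  then interpret W: vectorspace class_ring "Q\<lparr>carrier := W\<rparr>" by (rule Q.subspace_is_vs)
  obtain B where B: "finite B" "B \<subseteq> W" "W.span B = W"
    using assms by (auto simp: fin_dim_subspace_def W.fin_dim_def)
  have "W \<subseteq> range \<pi>"
    using sub by (auto simp: VectorSpace.subspace_def submodule_def carrier_Q)
  then have "B \<subseteq> \<pi> ` UNIV" using B(2) by simp
  from finite_subset_image[OF B(1) this] obtain F where F: "finite F" "B = \<pi> ` F" by metis
  have "W = lspan Q B"
    unfolding lspan_def using B(3) Q.span_li_not_depend(1)[OF B(2) Q.is_module[OF sub]] by argo
  then have "W = \<pi> ` span F" unfolding F(2) lspan_proj .
  with F(1) show ?thesis by (rule that)
qed

lemma ldim_proj_mono:
  assumes F: "finite F" and W: "subspace W" "subspace W'" "W \<subseteq> W'" "W' \<subseteq> span F"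
  shows "ldim Q (\<pi> ` W) \<le> ldim Q (\<pi> ` W')"
proof -
  have proj: "finite (\<pi> ` G) \<and> \<pi> ` G \<subseteq> carrier Q" if "finite G" for G
    using that by (auto simp: carrier_Q)
  have sub: "VectorSpace.subspace class_ring (\<pi> ` W') Q" by (rule subspace_proj_image[OF W(2)])
  have "vectorspace.fin_dim class_ring (Q\<lparr>carrier := \<pi> ` W'\<rparr>)"
    using Q.dim_subspace_le(1)[OF _ _ sub, of "\<pi> ` F"] proj[OF F] lspan_proj[of F]
      image_mono[OF W(4), of \<pi>] unfolding lspan_def by simp
  then have "fin_dim_subspace Q (\<pi> ` W')" using sub by (simp add: fin_dim_subspace_def)
  \<comment> \<open>\<open>F\<close> may span more than \<open>W'\<close>; the comparison of
    dimensions calls for a finite set whose image spans exactly the image of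
    \<open>W'\<close>.\<close>
  then obtain G where G: "finite G" "\<pi> ` W' = \<pi> ` span G" by (rule fin_dim_subspaceE)
  show ?thesis
    using Q.dim_subspace_le(2)[OF _ _ subspace_proj_image[OF W(1)], of "\<pi> ` G"] proj[OF G(1)]
      lspan_proj[of G] image_mono[OF W(3), of \<pi>]
    unfolding ldim_def lspan_def G(2) by simp
qed

text \<open>Turns a dimension into a number of standard indices: dependence on predecessors in the
  quotient is unwound to a congruence modulo \<open>J\<close> between representatives.\<close>

lemma ldim_proj_ordered_family:
  fixes key :: "'i \<Rightarrow> 'o::linorder"
  assumes "finite M" "inj_on key M"
  shows "ldim Q (\<pi> ` span (v ` M)) =
    card {m \<in> M. \<not> (\<exists>w\<in>span (v ` {m' \<in> M. key m' < key m}). v m - w \<in> J)}"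
proof -
  have "(\<lambda>m. \<pi> (v m)) ` M \<subseteq> carrier Q" by (auto simp: carrier_Q)
  from Q.dim_span_ordered_family[OF assms this] show ?thesis
    by (simp only: ldim_def lspan_def[symmetric] image_image[symmetric, of \<pi> v] lspan_proj
        proj_in_lspan_iff flip: lspan_proj)
qed

end

text \<open>Only the linear operations of \<open>Q\<close> are prescribed, so that the quotient
  records with and without a bracket are both covered.\<close>

lemma vs_quotientI:
  fixes A :: "('k::field, 'a::ab_group_add, 'm) module_scheme" and Q :: "('k, 'a set, 'n) module_scheme"
  assumes "vector_space (smult A)" and A: "vectorspace class_ring A"
    "carrier A = UNIV" "add A = (+)" "zero A = 0"
    and J: "ideal J A" "\<And>c x. x \<in> J \<Longrightarrow> c \<odot>\<^bsub>A\<^esub> x \<in> J"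
    and Q: "carrier Q = a_rcosets\<^bsub>A\<^esub> J" "zero Q = J" "add Q = set_add A"
    "smult Q = (\<lambda>c X. \<Union>x\<in>X. J +>\<^bsub>A\<^esub> (c \<odot>\<^bsub>A\<^esub> x))"
  shows "vs_quotient (smult A) Q (\<lambda>x. J +>\<^bsub>A\<^esub> x) J"
proof -
  interpret S: vector_space "smult A" by fact
  interpret A: vectorspace class_ring A by fact
  interpret J: ideal J A by fact
  have add: "J +>\<^bsub>A\<^esub> (x + y) = (J +>\<^bsub>A\<^esub> x) \<oplus>\<^bsub>Q\<^esub> (J +>\<^bsub>A\<^esub> y)" for x y
    using J.a_rcos_sum[of x y] A Q by simp
  have smult: "J +>\<^bsub>A\<^esub> (c \<odot>\<^bsub>A\<^esub> x) = c \<odot>\<^bsub>Q\<^esub> (J +>\<^bsub>A\<^esub> x)" for c x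
    using quot_smult_coset[OF A.module_axioms J(1) J(2), of x c] A Q by simp
  have carrier: "carrier Q = range (\<lambda>x. J +>\<^bsub>A\<^esub> x)"
    using A Q by (auto simp: A_RCOSETS_def')
  have closed: "x - y \<in> J" if "x \<in> J" "y \<in> J" for x y
    using J.a_closed[OF that(1) J(2)[OF that(2), of "- 1"]] A by simp
  have eq: "(J +>\<^bsub>A\<^esub> x = J +>\<^bsub>A\<^esub> y) \<longleftrightarrow> x - y \<in> J" for x y
  proof
    assume "J +>\<^bsub>A\<^esub> x = J +>\<^bsub>A\<^esub> y"
    then have "x \<in> J +>\<^bsub>A\<^esub> y" using J.a_rcos_self[of x] A by simp
    then show "x - y \<in> J" using A by (auto simp: a_r_coset_def')
  next
    assume "x - y \<in> J"
    then have "x \<in> J +>\<^bsub>A\<^esub> y" using A by (auto simp: a_r_coset_def' intro!: bexI[of _ "x - y"])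
    then show "J +>\<^bsub>A\<^esub> x = J +>\<^bsub>A\<^esub> y"
      using abelian_group.a_repr_independence[OF A.M.abelian_group_axioms _ _ J.a_subgroup] A by simp
  qed
  have zero: "\<zero>\<^bsub>Q\<^esub> = J +>\<^bsub>A\<^esub> 0" using J.a_rcos_const[of 0] A Q by (simp add: a_r_coset_def')
  have "abelian_group Q"
  proof (rule abelian_groupI)
    fix X assume "X \<in> carrier Q"
    then obtain x where "X = J +>\<^bsub>A\<^esub> x" by (auto simp: carrier)
    then have "(J +>\<^bsub>A\<^esub> (- x)) \<oplus>\<^bsub>Q\<^esub> X = \<zero>\<^bsub>Q\<^esub>" by (simp add: zero flip: add)
    then show "\<exists>Y\<in>carrier Q. Y \<oplus>\<^bsub>Q\<^esub> X = \<zero>\<^bsub>Q\<^esub>" by (auto simp: carrier)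
  qed (auto simp: carrier zero add_ac simp flip: add)
  then have "Module.module class_ring Q"
  proof (rule Module.moduleI[OF class_cring.cring_axioms])
  qed (auto simp: carrier S.scale_left_distrib S.scale_right_distrib simp flip: smult add)
  then have "vectorspace class_ring Q"
    by (simp add: vectorspace_def class_field.field_axioms)
  then show ?thesis
    using carrier add smult eq by (intro vs_quotient.intro vs_quotient_axioms.intro S.vector_space_axioms)
qed

text \<open>The quotient of ln (D n) by ln n tends to 1, so rescaling the argument by
  \<open>D\<close> does not affect the exponent of growth.\<close>

lemma limsup_log_dim_le:
  fixes f g :: "nat \<Rightarrow> nat"
  assumes le: "\<And>n. g n \<le> f (D * n)" and D: "D \<ge> 1"
  shows "limsup (\<lambda>n. log_dim n (g n)) \<le> limsup (\<lambda>n. log_dim n (f n))"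
proof (rule dense_ge)
  fix z assume z: "limsup (\<lambda>n. log_dim n (f n)) < z"
  \<comment> \<open>Two real bounds c < c' are inserted below \<open>z\<close>. The gap absorbs the
    constant: once ln n is at least c ln D / (c' - c), one has c (ln D + ln n) \<le> c' ln
    n.\<close>
  obtain c' where c': "limsup (\<lambda>n. log_dim n (f n)) < ereal c'" "ereal c' < z"
    using ereal_dense2[OF z] by blast
  obtain c where c: "limsup (\<lambda>n. log_dim n (f n)) < ereal c" "c < c'"
    using ereal_dense2[OF c'(1)] by auto
  have "eventually (\<lambda>n. log_dim n (f n) < ereal c) sequentially"
    using c(1) Limsup_le_iff[of sequentially "\<lambda>n. log_dim n (f n)" "limsup (\<lambda>n. log_dim n (f n))"] by auto
  moreover have "filterlim (\<lambda>n. D * n) sequentially sequentially"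
    using D by (intro filterlim_subseq) (auto simp: strict_mono_def)
  ultimately have "eventually (\<lambda>n. log_dim (D * n) (f (D * n)) < ereal c) sequentially"
    by (rule eventually_compose_filterlim)
  moreover have "filterlim (\<lambda>n. ln (real n)) at_top sequentially"
    by (rule filterlim_compose[OF ln_at_top filterlim_real_sequentially])
  then have "eventually (\<lambda>n. c * ln (real D) / (c' - c) \<le> ln (real n)) sequentially"
    by (simp add: filterlim_at_top)
  ultimately have "eventually (\<lambda>n. log_dim n (g n) \<le> ereal c') sequentially"
    using eventually_ge_at_top[of 2]
  proof eventually_elim
    case (elim n)
    show ?case
    proof (cases "g n = 0")
      case False
      then have "f (D * n) > 0" and fg: "real (g n) \<le> real (f (D * n))"
        using le[of n] by auto
      have n: "ln (real n) > 0" and D0: "ln (real D) \<ge> 0"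
        and eq: "ln (real (D * n)) = ln (real D) + ln (real n)"
        using elim(3) D by (simp_all add: ln_mult)
      then have Dn: "ln (real (D * n)) > 0" by linarith
      have "ln (real (f (D * n))) / ln (real (D * n)) < c"
        using elim(1) \<open>f (D * n) > 0\<close> by (simp add: log_dim_def log_def)
      then have "ln (real (f (D * n))) < c * (ln (real D) + ln (real n))"
        using Dn by (simp add: pos_divide_less_eq flip: eq)
      moreover have "ln (real (g n)) \<le> ln (real (f (D * n)))"
        using fg False by (subst ln_le_cancel_iff) auto
      moreover have "c * ln (real D) \<le> (c' - c) * ln (real n)"
        using elim(2) c(2) by (simp add: pos_divide_le_eq mult.commute)
      ultimately have "ln (real (g n)) \<le> c' * ln (real n)"
        by (simp add: algebra_simps)
      then show ?thesis using False n by (simp add: log_dim_def log_def pos_divide_le_eq)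
    qed (simp add: log_dim_def)
  qed
  then have "limsup (\<lambda>n. log_dim n (g n)) \<le> ereal c'" by (rule Limsup_bounded)
  with c'(2) show "limsup (\<lambda>n. log_dim n (g n)) \<le> z" by order
qed

section \<open>The degree grading of the enveloping algebra\<close>

interpretation env: vector_space "witt_smult :: 'k::field_char_0 \<Rightarrow> 'k witt_env \<Rightarrow> 'k witt_env"
proof -
  interpret U: vectorspace class_ring "U_witt :: ('k, 'k witt_env) module"
    by (rule vectorspace_U_witt)
  show "vector_space (witt_smult :: 'k \<Rightarrow> 'k witt_env \<Rightarrow> 'k witt_env)"
    using U.smult_l_distr U.smult_r_distr U.smult_assoc1 U.smult_one
    by (unfold_locales) simp_all
qed

lemma vs_quotient_id:
  fixes A :: "('k::field, 'a::ab_group_add, 'm) module_scheme"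
  assumes "vector_space (smult A)" "vectorspace class_ring A" "carrier A = UNIV" "add A = (+)"
  shows "vs_quotient (smult A) A id {0}"
  using assms by (simp add: vs_quotient_def vs_quotient_axioms_def)

lemma lspan_U_witt: "lspan U_witt X = env.span X"
  using vs_quotient.lspan_proj[OF vs_quotient_id[of U_witt], of X] vectorspace_U_witt
    env.vector_space_axioms by (simp)

lemma witt_smult_mult_left: "witt_smult c u * v = witt_smult c (u * v)"
  by transfer (simp add: mult.assoc witt_rel_ideal_zero)

lemma single_0_commute: "Poly_Mapping.single 0 c * p = p * Poly_Mapping.single 0 c"
  for p :: "'m::monoid_add \<Rightarrow>\<^sub>0 'k::comm_semiring_0"
  by (induction p rule: poly_mapping_induct_single) (simp_all add: mult_single mult.commute algebra_simps)

lemma witt_smult_mult_right: "u * witt_smult c v = witt_smult c (u * v)"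
proof (transfer, goal_cases)
  case (1 u c v)
  have "u * (Poly_Mapping.single 0 c * v) = Poly_Mapping.single 0 c * (u * v)"
    by (simp only: single_0_commute mult.assoc)
  then show ?case by (simp add: witt_rel_ideal_zero)
qed

lemma word_prod_simps [simp]:
  "word_prod [] = 1" "word_prod (i # ws) = e_gen i * word_prod ws"
  "word_prod (vs @ ws) = word_prod vs * word_prod ws"
  by (simp_all add: word_prod_def)

lemma word_deg_simps [simp]:
  "word_deg [] = 0" "word_deg (i # ws) = nat_of_pnat i + word_deg ws"
  "word_deg (vs @ ws) = word_deg vs + word_deg ws"
  by (simp_all add: word_deg_def)

lemma word_prod_eq_abs: "word_prod ws = abs_witt_env (Poly_Mapping.single (Word ws) 1)"
  by (induction ws)
    (simp_all add: one_witt_env_def zero_word_def[symmetric] e_gen.abs_eq times_witt_env.abs_eq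
      tgen_def mult_single plus_word_def)

lemma span_word_prod: "env.span (range word_prod) = UNIV"
proof -
  have "abs_witt_env p \<in> env.span (range word_prod)" for p :: "'k::field_char_0 tensor_alg"
  proof (induction p rule: poly_mapping_induct_single)
    case (1 m c)
    have "abs_witt_env (Poly_Mapping.single m c) = witt_smult c (word_prod (letters m))"
      by (simp add: word_prod_eq_abs witt_smult.abs_eq mult_single)
    then show ?case by (auto intro: env.span_scale env.span_base)
  next
    case (2 p q)
    then show ?case by (simp add: plus_witt_env.abs_eq[symmetric] env.span_add)
  qed
  then show ?thesis by (metis UNIV_eq_I Quotient_abs_rep Quotient_witt_env)
qed

section \<open>Homogeneous components of tensors and of the enveloping algebra\<close>

lift_definition pm_filter :: "('m \<Rightarrow> bool) \<Rightarrow> ('m \<Rightarrow>\<^sub>0 'k::zero) \<Rightarrow> 'm \<Rightarrow>\<^sub>0 'k"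
  is "\<lambda>P f m. f m when P m"
  by (rule finite_subset) auto

lemma pm_filter_add: "pm_filter P (p + q) = pm_filter P p + pm_filter P (q :: _ \<Rightarrow>\<^sub>0 'k::monoid_add)"
  by transfer (auto simp: when_def)

lemma pm_filter_zero: "pm_filter P 0 = 0"
  by transfer (auto simp: when_def)

lemma pm_filter_diff:
  "pm_filter P (p - q) = pm_filter P p - pm_filter P (q :: _ \<Rightarrow>\<^sub>0 'k::cancel_comm_monoid_add)"
  by transfer (auto simp: when_def)

lemma pm_filter_single: "pm_filter P (Poly_Mapping.single m c) = (if P m then Poly_Mapping.single m c else 0)"
  by transfer (auto simp: when_def)

lemma pm_filter_scale:
  "pm_filter P (Poly_Mapping.single 0 c * p) = Poly_Mapping.single 0 c * pm_filter P p"
  for p :: "'m::monoid_add \<Rightarrow>\<^sub>0 'k::semiring_0"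
  by (induction p rule: poly_mapping_induct_single)
    (simp_all add: mult_single pm_filter_single pm_filter_add algebra_simps)

abbreviation tensor_proj :: "nat \<Rightarrow> 'k::field_char_0 tensor_alg \<Rightarrow> 'k tensor_alg" where
  "tensor_proj d \<equiv> pm_filter (\<lambda>w. word_deg (letters w) = d)"

lemma tensor_proj_mult_single_right:
  "tensor_proj d (p * Poly_Mapping.single w c) =
    (if word_deg (letters w) \<le> d then tensor_proj (d - word_deg (letters w)) p * Poly_Mapping.single w c else 0)"
  by (induction p rule: poly_mapping_induct_single)
    (auto simp: mult_single pm_filter_single pm_filter_add algebra_simps plus_word_def)

lemma tensor_proj_mult_single_left:
  "tensor_proj d (Poly_Mapping.single w c * p) =
    (if word_deg (letters w) \<le> d then Poly_Mapping.single w c * tensor_proj (d - word_deg (letters w)) p else 0)"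
  by (induction p rule: poly_mapping_induct_single)
    (auto simp: mult_single pm_filter_single pm_filter_add algebra_simps plus_word_def)

lemma nat_of_pnat_add [simp]: "nat_of_pnat (i + j) = nat_of_pnat i + nat_of_pnat j"
  by (rule plus_pnat.rep_eq)

lemma ideal_recordI:
  fixes A :: "('a::ring_1, 'm) ring_scheme"
  assumes A: "ring A" "carrier A = UNIV" "add A = (+)" "zero A = 0" "mult A = (*)"
    and M: "0 \<in> M" "\<And>a b. a \<in> M \<Longrightarrow> b \<in> M \<Longrightarrow> a + b \<in> M"
    "\<And>a x. a \<in> M \<Longrightarrow> x * a \<in> M" "\<And>a x. a \<in> M \<Longrightarrow> a * x \<in> M"
  shows "ideal M A"
proof (rule idealI)
  interpret A: ring A by fact
  show "subgroup M (add_monoid A)"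
  proof (rule group.subgroupI)
    show "Group.group (add_monoid A)" by (rule A.add.group_axioms)
    show "M \<noteq> {}" using M(1) by auto
    fix a assume "a \<in> M"
    moreover have "\<ominus>\<^bsub>A\<^esub> a = - a" using A by (intro A.minus_equality) auto
    ultimately show "inv\<^bsub>add_monoid A\<^esub> a \<in> M"
      using M(3)[of a "- 1"] by (simp add: a_inv_def)
  qed (use A M in auto)
qed (use A M in auto)

lemma
  fixes A :: "('a::ring_1, 'm) ring_scheme"
  assumes "ideal M A" "carrier A = UNIV" "add A = (+)" "zero A = 0" "mult A = (*)"
  shows ideal_record_zero: "0 \<in> M"
    and ideal_record_add: "a \<in> M \<Longrightarrow> b \<in> M \<Longrightarrow> a + b \<in> M"
    and ideal_record_mult_left: "a \<in> M \<Longrightarrow> x * a \<in> M"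
    and ideal_record_mult_right: "a \<in> M \<Longrightarrow> a * x \<in> M"
proof -
  interpret M: additive_subgroup M A using assms(1) by (rule ideal.axioms(1))
  show "0 \<in> M" "a \<in> M \<Longrightarrow> b \<in> M \<Longrightarrow> a + b \<in> M" "a \<in> M \<Longrightarrow> x * a \<in> M" "a \<in> M \<Longrightarrow> a * x \<in> M"
    using M.zero_closed M.a_closed[of a b] ideal.I_l_closed[OF assms(1), of a x]
      ideal.I_r_closed[OF assms(1), of a x] assms by auto
qed

text \<open>The relator for \<open>i\<close> and \<open>j\<close> is homogeneous of degree i + j,
  and the tensors all of whose components lie in \<open>witt_rel_ideal\<close> form an ideal. This
  makes the degree projections descend to the enveloping algebra.\<close>

lemma witt_rel_ideal_homogeneous:
  fixes p :: "'k::field_char_0 tensor_alg"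
  assumes "p \<in> witt_rel_ideal"
  shows "tensor_proj d p \<in> witt_rel_ideal"
proof -
  let ?M = "{p :: 'k tensor_alg. \<forall>d. tensor_proj d p \<in> witt_rel_ideal}"
  have "ideal ?M class_ring"
  proof (rule ideal_recordI[OF class_ring.ring_axioms])
    show "0 \<in> ?M" by (simp add: pm_filter_zero witt_rel_ideal_zero)
    fix a x :: "'k tensor_alg" assume a: "a \<in> ?M"
    show "x * a \<in> ?M"
      by (induction x rule: poly_mapping_induct_single)
        (use a in \<open>auto simp: tensor_proj_mult_single_left distrib_right pm_filter_add
          witt_rel_ideal_add witt_rel_ideal_zero intro: witt_rel_ideal_mult_left\<close>)
    show "a * x \<in> ?M"
      by (induction x rule: poly_mapping_induct_single)
        (use a in \<open>auto simp: tensor_proj_mult_single_right distrib_left pm_filter_add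
          witt_rel_ideal_add witt_rel_ideal_zero intro: witt_rel_ideal_mult_right\<close>)
  qed (simp_all add: pm_filter_add witt_rel_ideal_add)
  moreover have "witt_relators \<subseteq> ?M"
  proof
    fix r :: "'k tensor_alg" assume r: "r \<in> witt_relators"
    then obtain i j where "r = tgen i * tgen j - tgen j * tgen i
        - Poly_Mapping.single 0 (witt_coeff i j) * tgen (i + j)"
      by (auto simp: witt_relators_def)
    then have "tensor_proj d r = (if d = nat_of_pnat i + nat_of_pnat j then r else 0)" for d
      by (auto simp: tgen_def mult_single pm_filter_single pm_filter_diff plus_word_def zero_word_def)
    moreover have "r \<in> witt_rel_ideal"
      unfolding witt_rel_ideal_def using r ring.genideal_self[OF class_ring.ring_axioms, of witt_relators]
      by auto
    ultimately show "r \<in> ?M" by (auto simp: witt_rel_ideal_zero)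
  qed
  ultimately have "witt_rel_ideal \<subseteq> ?M"
    unfolding witt_rel_ideal_def by (rule ring.genideal_minimal[OF class_ring.ring_axioms])
  then show ?thesis using assms by auto
qed

lift_definition env_proj :: "nat \<Rightarrow> 'k::field_char_0 witt_env \<Rightarrow> 'k witt_env" is tensor_proj
  by (simp add: witt_rel_ideal_homogeneous flip: pm_filter_diff)

interpretation env_proj: Vector_Spaces.linear witt_smult witt_smult
  "env_proj d :: 'k::field_char_0 witt_env \<Rightarrow> 'k witt_env" for d
proof -
  have "env_proj d (x + y) = env_proj d x + env_proj d (y :: 'k witt_env)" for x y
    by transfer (simp add: pm_filter_add witt_rel_ideal_zero)
  moreover have "env_proj d (witt_smult c x) = witt_smult c (env_proj d (x :: 'k witt_env))" for c x
    by transfer (simp add: pm_filter_scale witt_rel_ideal_zero)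
  ultimately show "Vector_Spaces.linear witt_smult witt_smult (env_proj d :: 'k witt_env \<Rightarrow> 'k witt_env)"
    by (intro Vector_Spaces.linear.intro module_hom.intro module_hom_axioms.intro
      env.vector_space_axioms env.module_axioms)
qed

lemma env_proj_word_prod: "env_proj d (word_prod ws) = (if word_deg ws = d then word_prod ws else 0)"
  by (simp add: word_prod_eq_abs env_proj.abs_eq pm_filter_single zero_witt_env_def)

text \<open>Linearity is spelled out as two equations so that the rule applies directly to ad hoc
  maps, such as multiplication by, or commutation with, a generator.\<close>

lemma (in vector_space_pair) span_image_into:
  assumes "\<And>x y. f (x + y) = f x + f y" "\<And>c x. f (s1 c x) = s2 c (f x)"
    and "\<And>x. x \<in> X \<Longrightarrow> f x \<in> W" "vs2.subspace W" "u \<in> vs1.span X"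
  shows "f u \<in> W"
proof -
  have "Vector_Spaces.linear s1 s2 f"
    using assms(1,2) by (intro Vector_Spaces.linear.intro module_hom.intro module_hom_axioms.intro
      vs1.module_axioms vs2.module_axioms vs1.vector_space_axioms vs2.vector_space_axioms)
  then have "vs1.span X \<subseteq> f -` W"
    using assms(3,4) by (intro vs1.span_minimal linear_subspace_vimage) auto
  then show ?thesis using assms(5) by auto
qed

interpretation env_env: vector_space_pair witt_smult "witt_smult :: 'k::field_char_0 \<Rightarrow> 'k witt_env \<Rightarrow> 'k witt_env"
  by unfold_locales

section \<open>Straightening of words\<close>

definition mdeg :: "pnat multiset \<Rightarrow> nat" where
  "mdeg m = (\<Sum>i\<in>#m. nat_of_pnat i)"

lemma mdeg_simps [simp]:
  "mdeg {#} = 0" "mdeg (add_mset i m) = nat_of_pnat i + mdeg m" "mdeg (m + n) = mdeg m + mdeg n"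
  by (simp_all add: mdeg_def)

lemma word_deg_eq_mdeg: "word_deg ws = mdeg (mset ws)"
  by (induction ws) simp_all

lemma nat_of_pnat_ge_1: "nat_of_pnat i \<ge> 1"
  using nat_of_pnat by simp

lemma size_le_mdeg: "size m \<le> mdeg m"
proof (induction m)
  case (add i m)
  then show ?case using nat_of_pnat_ge_1[of i] by simp
qed simp

lemma nat_of_pnat_le_mdeg: "i \<in># m \<Longrightarrow> nat_of_pnat i \<le> mdeg m"
  by (induction m) auto

text \<open>All letters have positive degree, so a bound on the degree bounds both the letters and
  their number. A bound on the length alone would leave the letters free.\<close>

lemma finite_mdeg_le: "finite {m. mdeg m \<le> n}"
proof (rule finite_subset)
  let ?A = "{i. nat_of_pnat i \<le> n}"
  have "inj_on nat_of_pnat ?A" by (auto simp: inj_on_def nat_of_pnat_inject)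
  moreover have "finite (nat_of_pnat ` ?A)" by (rule finite_subset[of _ "{..n}"]) auto
  ultimately have "finite ?A" by (rule finite_imageD[rotated])
  then show "finite (mset ` {xs. set xs \<subseteq> ?A \<and> length xs \<le> n})"
    by (intro finite_imageI finite_lists_length_le)
  show "{m. mdeg m \<le> n} \<subseteq> mset ` {xs. set xs \<subseteq> ?A \<and> length xs \<le> n}"
  proof
    fix m assume "m \<in> {m. mdeg m \<le> n}"
    then have m: "mdeg m \<le> n" by simp
    obtain xs where xs: "m = mset xs" by (metis ex_mset)
    have "set xs \<subseteq> ?A"
      using nat_of_pnat_le_mdeg[of _ m] m xs by fastforce
    moreover have "length xs \<le> n" using size_le_mdeg[of m] m xs by simp
    ultimately show "m \<in> mset ` {xs. set xs \<subseteq> ?A \<and> length xs \<le> n}" using xs by blast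
  qed
qed

definition pbw_mon :: "pnat multiset \<Rightarrow> 'k::field_char_0 witt_env" where
  "pbw_mon m = word_prod (sorted_list_of_multiset m)"

text \<open>The error terms of straightening: the commutation relation keeps the degree and can
  shorten a word. The strict bound makes this the space modulo which symbols of bidegree (d, l) are
  taken.\<close>

definition low_words :: "nat \<Rightarrow> nat \<Rightarrow> 'k::field_char_0 witt_env set" where
  "low_words d l = env.span {word_prod ws | ws. word_deg ws = d \<and> length ws < l}"

lemma subspace_low_words: "env.subspace (low_words d l)"
  by (simp add: low_words_def)

lemmas low_words_0 [simp] = env.subspace_0[OF subspace_low_words]
lemmas low_words_add = env.subspace_add[OF subspace_low_words]
lemmas low_words_diff = env.subspace_diff[OF subspace_low_words]
lemmas low_words_scale = env.subspace_scale[OF subspace_low_words]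

lemma word_prod_in_low_words: "word_deg ws = d \<Longrightarrow> length ws < l \<Longrightarrow> word_prod ws \<in> low_words d l"
  unfolding low_words_def by (rule env.span_base) auto

lemma low_words_mono: "u \<in> low_words d k \<Longrightarrow> k \<le> l \<Longrightarrow> u \<in> low_words d l"
  unfolding low_words_def
  using env.span_mono[of "{word_prod ws | ws. word_deg ws = d \<and> length ws < k}"
      "{word_prod ws | ws. word_deg ws = d \<and> length ws < l}"] by force

lemma low_words_mult_left:
  "u \<in> low_words d l \<Longrightarrow> e_gen i * u \<in> low_words (nat_of_pnat i + d) (Suc l)"
  unfolding low_words_def[of d l]
proof (erule env_env.span_image_into[where f = "\<lambda>u. e_gen i * u", rotated 4])
  show "e_gen i * x \<in> low_words (nat_of_pnat i + d) (Suc l)"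
    if "x \<in> {word_prod ws |ws. word_deg ws = d \<and> length ws < l}" for x :: "'a witt_env"
    using that word_prod_in_low_words[of "i # _" "nat_of_pnat i + d" "Suc l"] by auto
qed (simp_all add: distrib_left witt_smult_mult_right subspace_low_words)

lemma low_words_mult_right:
  "u \<in> low_words d l \<Longrightarrow> u * e_gen i \<in> low_words (nat_of_pnat i + d) (Suc l)"
  unfolding low_words_def[of d l]
proof (erule env_env.span_image_into[where f = "\<lambda>u. u * e_gen i", rotated 4])
  show "x * e_gen i \<in> low_words (nat_of_pnat i + d) (Suc l)"
    if "x \<in> {word_prod ws |ws. word_deg ws = d \<and> length ws < l}" for x :: "'a witt_env"
    using that word_prod_in_low_words[of "_ @ [i]" "nat_of_pnat i + d" "Suc l"] by auto
qed (simp_all add: distrib_right witt_smult_mult_left subspace_low_words)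

lemma e_gen_swap:
  fixes u :: "'k::field_char_0 witt_env"
  shows "e_gen i * (e_gen j * u) = e_gen j * (e_gen i * u) + witt_smult (witt_coeff i j) (e_gen (i + j) * u)"
proof -
  have "e_gen i * e_gen j * u = (e_gen j * e_gen i + witt_smult (witt_coeff i j) (e_gen (i + j))) * u"
    by (simp flip: e_gen_commutator)
  then show ?thesis by (simp add: distrib_right mult.assoc witt_smult_mult_left)
qed

text \<open>Moving \<open>i\<close> past a smaller letter \<open>j\<close> costs a multiple of the
  word in which the single letter i + j replaces both: same degree, one letter fewer.\<close>

lemma word_prod_insort:
  "(word_prod (i # ws) :: 'k::field_char_0 witt_env) - word_prod (insort i ws) \<in> low_words (word_deg (i # ws)) (length (i # ws))"
proof (induction ws)
  case (Cons j ws)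
  show ?case
  proof (cases "i \<le> j")
    case False
    have "(word_prod (i # j # ws) :: 'k witt_env) - word_prod (insort i (j # ws)) =
        witt_smult (witt_coeff i j) (word_prod ((i + j) # ws)) +
        e_gen j * (word_prod (i # ws) - word_prod (insort i ws))"
      using False by (simp add: e_gen_swap[of i j] algebra_simps)
    moreover have "witt_smult (witt_coeff i j) (word_prod ((i + j) # ws) :: 'k witt_env) \<in>
        low_words (word_deg (i # j # ws)) (length (i # j # ws))"
      by (intro low_words_scale word_prod_in_low_words) simp_all
    moreover have "e_gen j * (word_prod (i # ws) - word_prod (insort i ws) :: 'k witt_env) \<in>
        low_words (word_deg (i # j # ws)) (length (i # j # ws))"
      using low_words_mult_left[OF Cons, of j] by (simp add: add_ac)
    ultimately show ?thesis by (simp only: low_words_add)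
  qed simp
qed simp

lemma word_prod_straighten:
  "(word_prod ws :: 'k::field_char_0 witt_env) - pbw_mon (mset ws) \<in> low_words (word_deg ws) (length ws)"
proof -
  have "(word_prod ws :: 'k witt_env) - word_prod (sort ws) \<in> low_words (word_deg ws) (length ws)"
  proof (induction ws)
    case (Cons i ws)
    have "e_gen i * (word_prod ws - word_prod (sort ws) :: 'k witt_env) \<in> low_words (word_deg (i # ws)) (length (i # ws))"
      using low_words_mult_left[OF Cons] by simp
    moreover have "(word_prod (i # sort ws) :: 'k witt_env) - word_prod (insort i (sort ws)) \<in>
        low_words (word_deg (i # ws)) (length (i # ws))"
      using word_prod_insort[of i "sort ws"] by (simp add: word_deg_eq_mdeg)
    ultimately have "e_gen i * (word_prod ws - word_prod (sort ws) :: 'k witt_env) +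
        (word_prod (i # sort ws) - word_prod (insort i (sort ws))) \<in>
        low_words (word_deg (i # ws)) (length (i # ws))"
      by (rule low_words_add)
    then show ?case by (simp add: algebra_simps)
  qed simp
  then show ?thesis by (simp add: pbw_mon_def)
qed

lemma mon_in_low_words: "mdeg m = d \<Longrightarrow> size m < l \<Longrightarrow> pbw_mon m \<in> low_words d l"
  unfolding pbw_mon_def by (rule word_prod_in_low_words) (auto simp: word_deg_eq_mdeg simp flip: size_mset)

text \<open>Induction on \<open>l\<close> works because straightening a word of length at most
  \<open>l\<close> leaves an error made of strictly shorter words of the same degree, which the
  induction hypothesis already covers.\<close>

lemma low_words_eq:
  "(low_words d l :: 'k::field_char_0 witt_env set) = env.span (pbw_mon ` {m. mdeg m = d \<and> size m < l})"
proof
  show "env.span (pbw_mon ` {m. mdeg m = d \<and> size m < l}) \<subseteq> (low_words d l :: 'k witt_env set)"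
    by (rule env.span_minimal) (auto intro: mon_in_low_words subspace_low_words)
  show "(low_words d l :: 'k witt_env set) \<subseteq> env.span (pbw_mon ` {m. mdeg m = d \<and> size m < l})"
  proof (induction l)
    case 0
    then show ?case by (simp add: low_words_def)
  next
    case (Suc l)
    let ?M = "\<lambda>l. pbw_mon ` {m. mdeg m = d \<and> size m < l} :: 'k witt_env set"
    have mono: "env.span (?M l) \<subseteq> env.span (?M (Suc l))" by (rule env.span_mono) auto
    have "word_prod ws \<in> env.span (?M (Suc l))" if ws: "word_deg ws = d" "length ws < Suc l" for ws
    proof -
      have "(word_prod ws :: 'k witt_env) - pbw_mon (mset ws) \<in> low_words d l"
        using word_prod_straighten[of ws] low_words_mono[of _ d "length ws" l] ws by auto
      then have "word_prod ws - pbw_mon (mset ws) \<in> env.span (?M (Suc l))" using Suc mono by auto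
      moreover have "pbw_mon (mset ws) \<in> env.span (?M (Suc l))"
        using ws by (intro env.span_base) (auto simp: word_deg_eq_mdeg)
      ultimately show ?thesis by (metis diff_add_cancel env.span_add)
    qed
    then show ?case unfolding low_words_def by (intro env.span_minimal) auto
  qed
qed

lemma length_le_word_deg: "length ws \<le> word_deg ws"
  using size_le_mdeg[of "mset ws"] by (simp add: word_deg_eq_mdeg)

text \<open>A word is never longer than its degree, so the bound \<open>Suc n\<close> excludes
  nothing.\<close>

lemma U_deg_eq_low_words: "(U_deg n :: 'k::field_char_0 witt_env set) = low_words n (Suc n)"
proof -
  have "{word_prod ws :: 'k witt_env | ws. word_deg ws = n} = {word_prod ws | ws. word_deg ws = n \<and> length ws < Suc n}"
    using length_le_word_deg by (auto simp: less_Suc_eq_le)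
  then show ?thesis by (simp add: U_deg_def low_words_def lspan_U_witt)
qed

lemma low_words_subset_U_deg: "low_words d l \<subseteq> U_deg d"
  unfolding U_deg_def low_words_def lspan_U_witt by (rule env.span_mono) auto

lemma U_deg_eq_span_mon: "U_deg n = env.span (pbw_mon ` {m. mdeg m = n})"
proof -
  have "{m. mdeg m = n \<and> size m < Suc n} = {m. mdeg m = n}"
    using size_le_mdeg by (auto simp: less_Suc_eq_le)
  then show ?thesis by (simp add: U_deg_eq_low_words low_words_eq)
qed

lemma env_span_UN_span: "env.span (\<Union>k\<in>K. env.span (A k)) = env.span (\<Union>k\<in>K. A k)"
proof
  have "env.span (A k) \<subseteq> env.span (\<Union>k\<in>K. A k)" if "k \<in> K" for k
    using that by (intro env.span_mono) auto
  then show "env.span (\<Union>k\<in>K. env.span (A k)) \<subseteq> env.span (\<Union>k\<in>K. A k)"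
    by (intro env.span_minimal) auto
  show "env.span (\<Union>k\<in>K. A k) \<subseteq> env.span (\<Union>k\<in>K. env.span (A k))"
    by (intro env.span_mono) (auto intro: env.span_base)
qed

lemma span_U_deg_less:
  "env.span (\<Union>k<n. U_deg k :: 'k::field_char_0 witt_env set) = env.span (pbw_mon ` {m. mdeg m < n})"
proof -
  have "(\<Union>k<n. pbw_mon ` {m. mdeg m = k} :: 'k witt_env set) = pbw_mon ` {m. mdeg m < n}" by auto
  then show ?thesis by (simp add: U_deg_eq_span_mon env_span_UN_span)
qed

lemma env_proj_low_words: "u \<in> low_words d l \<Longrightarrow> env_proj d' u = (if d' = d then u else 0)"
proof -
  assume "u \<in> low_words d l"
  \<comment> \<open>An equality of two linear maps on a span, put as membership in the zero subspace
    so that \<open>span_image_into\<close> applies.\<close>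
  then have "env_proj d' u - (if d' = d then u else 0) \<in> {0}"
    unfolding low_words_def
    by (rule env_env.span_image_into[rotated 4])
      (auto simp: env_proj.add env_proj.scale env.scale_right_diff_distrib env_proj_word_prod)
  then show ?thesis by simp
qed

lemma env_proj_U_deg: "u \<in> U_deg d \<Longrightarrow> env_proj d' u = (if d' = d then u else 0)"
  unfolding U_deg_eq_low_words by (rule env_proj_low_words)

lemma env_proj_in_U_deg: "env_proj d (u :: 'k::field_char_0 witt_env) \<in> U_deg d"
proof -
  have "u \<in> env.span (range word_prod)" by (simp add: span_word_prod)
  then show ?thesis
  proof (rule env_env.span_image_into[rotated 4])
    show "env_proj d x \<in> U_deg d" if "x \<in> range word_prod" for x :: "'k witt_env"
      using that word_prod_in_low_words[OF _ le_imp_less_Suc[OF length_le_word_deg]]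
      by (auto simp: env_proj_word_prod U_deg_eq_low_words)
  qed (auto simp: env_proj.add env_proj.scale U_deg_eq_low_words subspace_low_words)
qed

text \<open>Asking for all large \<open>n\<close> rather than for one allows the decompositions of
  two summands to be taken up to a common degree.\<close>

lemma env_decompose: "\<exists>D. \<forall>n\<ge>D. (u :: 'k::field_char_0 witt_env) = (\<Sum>d\<le>n. env_proj d u)"
proof -
  let ?W = "{u :: 'k witt_env. \<exists>D. \<forall>n\<ge>D. u = (\<Sum>d\<le>n. env_proj d u)}"
  have "env.subspace ?W"
  proof (rule env.subspaceI)
    show "0 \<in> ?W" by (simp add: env_proj.zero)
    fix x y c assume "x \<in> ?W"
    then obtain D where D: "\<And>n. n \<ge> D \<Longrightarrow> x = (\<Sum>d\<le>n. env_proj d x)" by auto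
    show "witt_smult c x \<in> ?W"
      using D by (auto simp: env_proj.scale simp flip: env.scale_sum_right intro!: exI[of _ D])
    assume "y \<in> ?W"
    then obtain D' where D': "\<And>n. n \<ge> D' \<Longrightarrow> y = (\<Sum>d\<le>n. env_proj d y)" by auto
    have "x + y = (\<Sum>d\<le>n. env_proj d (x + y))" if "n \<ge> max D D'" for n
      using D[of n] D'[of n] that by (simp add: env_proj.add sum.distrib)
    then show "x + y \<in> ?W" by blast
  qed
  moreover have "word_prod ws \<in> ?W" for ws
    by (auto simp: env_proj_word_prod intro!: exI[of _ "word_deg ws"])
  ultimately have "env.span (range word_prod) \<subseteq> ?W" by (intro env.span_minimal) auto
  then show ?thesis by (auto simp: span_word_prod)
qed

section \<open>The symmetric algebra\<close>

abbreviation sym_smult :: "'k::field_char_0 \<Rightarrow> 'k witt_sym \<Rightarrow> 'k witt_sym" where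
  "sym_smult c p \<equiv> Poly_Mapping.single 0 c * p"

abbreviation sym_mon :: "pnat multiset \<Rightarrow> 'k::field_char_0 witt_sym" where
  "sym_mon m \<equiv> Poly_Mapping.single m 1"

interpretation sym: vector_space "sym_smult :: 'k::field_char_0 \<Rightarrow> 'k witt_sym \<Rightarrow> 'k witt_sym"
  by unfold_locales (simp_all add: algebra_simps single_add mult_single single_one flip: mult.assoc)

lemma ring_S_witt: "ring (S_witt :: ('k::field_char_0, 'k witt_sym) poisson)"
proof (rule ringI)
  show "abelian_group (S_witt :: ('k, 'k witt_sym) poisson)"
    by (rule abelian_groupI) (auto simp: algebra_simps intro: exI[of _ "- z" for z])
  show "Group.monoid (S_witt :: ('k, 'k witt_sym) poisson)"
    by (rule Group.monoidI) (auto simp: algebra_simps)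
qed (auto simp: algebra_simps)

lemma vectorspace_S_witt:
  "vectorspace class_ring (S_witt :: ('k::field_char_0, 'k witt_sym) poisson)"
proof (intro vectorspace.intro Module.moduleI)
  show "abelian_group (S_witt :: ('k, 'k witt_sym) poisson)"
    by (rule ring.is_abelian_group[OF ring_S_witt])
qed (simp_all add: class_cring.cring_axioms class_field.field_axioms sym.scale_left_distrib
  sym.scale_right_distrib)

lemma lspan_S_witt: "lspan S_witt X = sym.span X"
  using vs_quotient.lspan_proj[OF vs_quotient_id[of S_witt], of X] vectorspace_S_witt
    sym.vector_space_axioms by simp

interpretation sym_env: vector_space_pair
  "sym_smult :: 'k::field_char_0 \<Rightarrow> 'k witt_sym \<Rightarrow> 'k witt_sym" witt_smult
  by unfold_locales

interpretation sym_sym: vector_space_pair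
  "sym_smult :: 'k::field_char_0 \<Rightarrow> 'k witt_sym \<Rightarrow> 'k witt_sym" sym_smult
  by unfold_locales

section \<open>Ordered monomials as images of commutative polynomials\<close>

lemma pbw_superset:
  "finite M \<Longrightarrow> Poly_Mapping.keys p \<subseteq> M \<Longrightarrow>
    pbw p = (\<Sum>m\<in>M. witt_smult (Poly_Mapping.lookup p m) (pbw_mon m))"
  unfolding pbw_def pbw_mon_def by (rule sum.mono_neutral_left) (auto simp: in_keys_iff)

lemma pbw_single: "pbw (Poly_Mapping.single m c) = witt_smult c (pbw_mon m)"
  by (simp add: pbw_superset[of "{m}"])

lemma lookup_sym_smult: "Poly_Mapping.lookup (sym_smult c p) m = c * Poly_Mapping.lookup p m"
  by (induction p rule: poly_mapping_induct_single)
    (simp_all add: mult_single lookup_single lookup_add algebra_simps when_def)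

lemma keys_sym_smult: "Poly_Mapping.keys (sym_smult c p) \<subseteq> Poly_Mapping.keys p"
  by (auto simp: in_keys_iff lookup_sym_smult)

lemma sym_smult_mult_right: "q * sym_smult c p = sym_smult c (q * p)"
  by (rule mult.left_commute)

interpretation pbw: Vector_Spaces.linear "sym_smult :: 'k::field_char_0 \<Rightarrow> 'k witt_sym \<Rightarrow> 'k witt_sym"
  witt_smult pbw
proof -
  have "pbw (p + q) = pbw p + pbw (q :: 'k witt_sym)" for p q
    using Poly_Mapping.keys_add[of p q]
    by (simp add: pbw_superset[of "Poly_Mapping.keys p \<union> Poly_Mapping.keys q"] lookup_add
      env.scale_left_distrib sum.distrib)
  moreover have "pbw (sym_smult c p) = witt_smult c (pbw p)" for c and p :: "'k witt_sym"
    using keys_sym_smult[of c p]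
    by (simp add: pbw_superset[of "Poly_Mapping.keys p"] lookup_sym_smult env.scale_sum_right)
  ultimately show "Vector_Spaces.linear sym_smult witt_smult (pbw :: 'k witt_sym \<Rightarrow> 'k witt_env)"
    by (intro Vector_Spaces.linear.intro module_hom.intro module_hom_axioms.intro
      sym.vector_space_axioms sym.module_axioms env.vector_space_axioms env.module_axioms)
qed

definition sym_on :: "pnat multiset set \<Rightarrow> 'k::field_char_0 witt_sym set" where
  "sym_on A = {p. Poly_Mapping.keys p \<subseteq> A}"

lemma poly_mapping_sum_single:
  "(\<Sum>m\<in>Poly_Mapping.keys p. Poly_Mapping.single m (Poly_Mapping.lookup p m)) = p"
  by (rule poly_mapping_eqI) (auto simp: lookup_sum lookup_single when_def in_keys_iff)

lemma sym_on_eq_span: "sym_on A = (sym.span (sym_mon ` A) :: 'k::field_char_0 witt_sym set)"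
proof
  show "sym_on A \<subseteq> (sym.span (sym_mon ` A) :: 'k witt_sym set)"
  proof
    fix p :: "'k witt_sym" assume p: "p \<in> sym_on A"
    have "sym_smult (Poly_Mapping.lookup p m) (sym_mon m) \<in> sym.span (sym_mon ` A)"
      if "m \<in> Poly_Mapping.keys p" for m
      using that p by (intro sym.span_scale sym.span_base) (auto simp: sym_on_def)
    then have "(\<Sum>m\<in>Poly_Mapping.keys p. Poly_Mapping.single m (Poly_Mapping.lookup p m))
        \<in> sym.span (sym_mon ` A)"
      by (intro sym.span_sum) (simp add: mult_single)
    then show "p \<in> sym.span (sym_mon ` A)" by (simp add: poly_mapping_sum_single)
  qed
  have "sym.subspace (sym_on A :: 'k witt_sym set)"
  proof (rule sym.subspaceI)
    fix p q :: "'k witt_sym" and c assume p: "p \<in> sym_on A"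
    show "sym_smult c p \<in> sym_on A" using p keys_sym_smult[of c p] by (auto simp: sym_on_def)
    assume q: "q \<in> sym_on A"
    show "p + q \<in> sym_on A" using p q Poly_Mapping.keys_add[of p q] by (auto simp: sym_on_def)
  qed (simp add: sym_on_def)
  then show "(sym.span (sym_mon ` A) :: 'k witt_sym set) \<subseteq> sym_on A"
    by (intro sym.span_minimal) (auto simp: sym_on_def)
qed

lemma subspace_sym_on: "sym.subspace (sym_on A)"
  by (simp add: sym_on_eq_span)

lemma sym_on_mono: "A \<subseteq> B \<Longrightarrow> sym_on A \<subseteq> sym_on B"
  by (auto simp: sym_on_def)

text \<open>Combinations of ordered monomials are thereby represented by polynomials, which can be
  cut into bihomogeneous parts; length has no projection on the enveloping algebra itself.\<close>

lemma env_span_pbw_mon: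
  "(env.span (pbw_mon ` A) :: 'k::field_char_0 witt_env set) = pbw ` sym_on A"
proof -
  have "pbw_mon ` A = (pbw ` sym_mon ` A :: 'k witt_env set)" by (simp add: image_image pbw_single)
  then show ?thesis by (simp only: pbw.span_image sym_on_eq_span)
qed

definition bideg :: "nat \<Rightarrow> nat \<Rightarrow> pnat multiset set" where
  "bideg d l = {m. mdeg m = d \<and> size m = l}"

lemma pm_filter_sym_on: "p \<in> sym_on A \<Longrightarrow> pm_filter (\<lambda>m. m \<in> B) p \<in> sym_on (A \<inter> B)"
  by (auto simp: sym_on_def in_keys_iff pm_filter.rep_eq when_def subset_iff split: if_splits)

lemma pm_filter_id: "p \<in> sym_on A \<Longrightarrow> A \<subseteq> B \<Longrightarrow> pm_filter (\<lambda>m. m \<in> B) p = p"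
  by (rule poly_mapping_eqI) (auto simp: sym_on_def in_keys_iff pm_filter.rep_eq when_def)

lemma pm_filter_disjoint: "p \<in> sym_on A \<Longrightarrow> A \<inter> B = {} \<Longrightarrow> pm_filter (\<lambda>m. m \<in> B) p = 0"
  by (rule poly_mapping_eqI) (auto simp: sym_on_def in_keys_iff pm_filter.rep_eq when_def)

lemma env_proj_pbw_mon: "env_proj d (pbw_mon m) = (if mdeg m = d then pbw_mon m else 0)"
  by (simp add: pbw_mon_def env_proj_word_prod word_deg_eq_mdeg)

lemma env_proj_pbw: "env_proj d (pbw p) = pbw (pm_filter (\<lambda>m. mdeg m = d) p)"
proof (induction p rule: poly_mapping_induct_single)
  case (1 m c)
  then show ?case by (simp add: pbw_single pm_filter_single env_proj.scale env_proj_pbw_mon)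
qed (simp_all add: pbw.add env_proj.add pm_filter_add)

text \<open>Taking symbols respects multiplication by a generator: putting \<open>i\<close> in front
  of a sorted word and straightening changes it by shorter words only.\<close>

lemma e_gen_mult_pbw:
  fixes p :: "'k::field_char_0 witt_sym"
  assumes "p \<in> sym_on (bideg d l)"
  shows "e_gen i * pbw p - pbw (x_gen i * p) \<in> low_words (nat_of_pnat i + d) (Suc l)"
  using assms unfolding sym_on_eq_span
proof (rule sym_env.span_image_into[rotated 4, where f = "\<lambda>p. e_gen i * pbw p - pbw (x_gen i * p)"])
  show "e_gen i * pbw x - pbw (x_gen i * x) \<in> low_words (nat_of_pnat i + d) (Suc l)"
    if x: "x \<in> sym_mon ` bideg d l" for x :: "'k witt_sym"
  proof -
    obtain m where m: "x = sym_mon m" "mdeg m = d" "size m = l" using x unfolding bideg_def by blast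
    show ?thesis
      using word_prod_straighten[of "i # sorted_list_of_multiset m", where 'k = 'k] m(2,3)
      by (simp add: m(1) pbw_single x_gen_def mult_single word_deg_eq_mdeg pbw_mon_def[of m]
        flip: size_mset)
  qed
qed (simp_all add: subspace_low_words pbw.add pbw.scale distrib_left witt_smult_mult_right
  env.scale_right_diff_distrib sym_smult_mult_right)

lemma x_gen_mult_sym_on:
  assumes "p \<in> sym_on (bideg d l)"
  shows "x_gen i * p \<in> sym_on (bideg (nat_of_pnat i + d) (Suc l))"
  using assms Poly_Mapping.keys_mult[of "x_gen i" p] by (fastforce simp: sym_on_def bideg_def x_gen_def)

section \<open>Brackets and commutators with a generator\<close>

lemma sym_bracket_add: "sym_bracket p (q + r) = sym_bracket p q + sym_bracket p r"
proof -
  let ?Y = "sym_vars q \<union> sym_vars r \<union> sym_vars (q + r)"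
  have *: "sym_bracket p s = (\<Sum>i\<in>sym_vars p. \<Sum>j\<in>?Y.
      Poly_Mapping.single 0 (witt_coeff i j) * x_gen (i + j) * sym_partial i p * sym_partial j s)"
    if "sym_vars s \<subseteq> ?Y" for s
    by (rule sym_bracket_superset) (use that in auto)
  show ?thesis
    by (subst *, blast, subst *, blast, subst *, blast)
      (simp only: sym_partial_add distrib_left sum.distrib)
qed

lemma sym_bracket_const: "sym_bracket p (Poly_Mapping.single 0 c) = 0"
  by (simp add: sym_bracket_def sym_vars_def)

lemma sym_bracket_smult: "sym_bracket p (sym_smult c q) = sym_smult c (sym_bracket p q)"
  by (simp add: sym_bracket_Leibniz sym_bracket_const)

lemma sym_bracket_x_gen_mult:
  "sym_bracket (x_gen i) (x_gen j * p) =
    sym_smult (witt_coeff i j) (x_gen (i + j) * p) + x_gen j * sym_bracket (x_gen i) p"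
  by (simp add: sym_bracket_Leibniz sym_bracket_gen mult.assoc)

lemma sym_mon_add_mset: "Poly_Mapping.single (add_mset i m) c = x_gen i * Poly_Mapping.single m c"
  by (simp add: x_gen_def mult_single)

text \<open>Bracketing with \<open>x_gen i\<close> is a derivation that replaces one letter
  \<open>j\<close> at a time by i + j: the degree grows by that of \<open>i\<close>, the number of
  letters stays.\<close>

lemma sym_bracket_sym_mon:
  "sym_bracket (x_gen i) (sym_mon m) \<in>
    (sym_on (bideg (nat_of_pnat i + mdeg m) (size m)) :: 'k::field_char_0 witt_sym set)"
proof (induction m)
  case empty
  have "sym_bracket (x_gen i) (sym_mon {#}) = (0 :: 'k witt_sym)"
    using sym_bracket_const[of "x_gen i" "1 :: 'k"] by simp
  then show ?case by (simp add: sym_on_def)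
next
  case (add j m)
  have "x_gen (i + j) * sym_mon m \<in> (sym_on (bideg (nat_of_pnat (i + j) + mdeg m) (Suc (size m))) :: 'k witt_sym set)"
    by (rule x_gen_mult_sym_on) (simp add: sym_on_def bideg_def)
  moreover have "x_gen j * sym_bracket (x_gen i) (sym_mon m) \<in>
      (sym_on (bideg (nat_of_pnat j + (nat_of_pnat i + mdeg m)) (Suc (size m))) :: 'k witt_sym set)"
    by (rule x_gen_mult_sym_on[OF add])
  ultimately show ?case
    unfolding sym_mon_add_mset sym_bracket_x_gen_mult
    by (intro sym.subspace_add[OF subspace_sym_on] sym.subspace_scale[OF subspace_sym_on])
      (simp_all add: add_ac)
qed

lemma sym_bracket_sym_on:
  fixes p :: "'k::field_char_0 witt_sym"
  assumes "p \<in> sym_on (bideg d l)"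
  shows "sym_bracket (x_gen i) p \<in> sym_on (bideg (nat_of_pnat i + d) l)"
  using assms unfolding sym_on_eq_span[of "bideg d l"]
proof (rule sym_sym.span_image_into[rotated 4])
  show "sym_bracket (x_gen i) x \<in> sym_on (bideg (nat_of_pnat i + d) l)"
    if "x \<in> sym_mon ` bideg d l" for x :: "'k witt_sym"
    using that sym_bracket_sym_mon[of i] by (auto simp: bideg_def)
qed (simp_all add: sym_bracket_add sym_bracket_smult subspace_sym_on)

text \<open>The symbol of a commutator is the Poisson bracket. Commuting with \<open>e_gen i\<close>
  and bracketing with \<open>x_gen i\<close> are derivations with corresponding values on
  generators, so they can be compared letter by letter.\<close>

lemma commutator_word_prod:
  "e_gen i * word_prod ws - word_prod ws * e_gen i - pbw (sym_bracket (x_gen i) (sym_mon (mset ws))) \<in>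
    (low_words (nat_of_pnat i + word_deg ws) (length ws) :: 'k::field_char_0 witt_env set)"
proof (induction ws)
  case Nil
  have "sym_bracket (x_gen i) (sym_mon {#}) = (0 :: 'k witt_sym)"
    using sym_bracket_const[of "x_gen i" "1 :: 'k"] by simp
  then show ?case by (simp add: pbw.zero)
next
  case (Cons j ws)
  let ?w = "word_prod ws :: 'k witt_env" and ?X = "sym_mon (mset ws) :: 'k witt_sym"
  let ?L = "low_words (nat_of_pnat i + word_deg (j # ws)) (length (j # ws)) :: 'k witt_env set"
  \<comment> \<open>The three errors arise from straightening the word that contains i + j, from the
    induction hypothesis, and from multiplying the symbol by the letter \<open>j\<close>.\<close>
  have 1: "witt_smult (witt_coeff i j) (word_prod ((i + j) # ws) - pbw_mon (mset ((i + j) # ws))) \<in> ?L"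
    using word_prod_straighten[of "(i + j) # ws", where 'k = 'k]
    by (intro low_words_scale) (simp add: add_ac)
  have 2: "e_gen j * (e_gen i * ?w - ?w * e_gen i - pbw (sym_bracket (x_gen i) ?X)) \<in> ?L"
    using low_words_mult_left[OF Cons, of j] by (simp add: add_ac)
  have 3: "e_gen j * pbw (sym_bracket (x_gen i) ?X) - pbw (x_gen j * sym_bracket (x_gen i) ?X) \<in> ?L"
    using e_gen_mult_pbw[OF sym_bracket_sym_mon[of i "mset ws"], of j]
    by (simp add: add_ac word_deg_eq_mdeg)
  have "pbw (x_gen (i + j) * ?X) = pbw_mon (mset ((i + j) # ws))"
    by (simp add: pbw_single flip: sym_mon_add_mset)
  then have "e_gen i * word_prod (j # ws) - word_prod (j # ws) * e_gen i
      - pbw (sym_bracket (x_gen i) (sym_mon (mset (j # ws)))) =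
    witt_smult (witt_coeff i j) (word_prod ((i + j) # ws) - pbw_mon (mset ((i + j) # ws)))
    + e_gen j * (e_gen i * ?w - ?w * e_gen i - pbw (sym_bracket (x_gen i) ?X))
    + (e_gen j * pbw (sym_bracket (x_gen i) ?X) - pbw (x_gen j * sym_bracket (x_gen i) ?X))"
    by (simp only: mset.simps sym_mon_add_mset sym_bracket_x_gen_mult pbw.add pbw.scale
        word_prod_simps e_gen_swap[of i j])
      (simp add: env.scale_right_diff_distrib algebra_simps)
  then show ?case using low_words_add[OF low_words_add[OF 1 2] 3] by simp
qed

lemma pbw_in_low_words: "p \<in> sym_on (bideg d k) \<Longrightarrow> k < l \<Longrightarrow> pbw p \<in> low_words d l"
  unfolding low_words_eq env_span_pbw_mon
  using sym_on_mono[of "bideg d k" "{m. mdeg m = d \<and> size m < l}"] by (auto simp: bideg_def)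

text \<open>Either product alone may be one letter longer than \<open>u\<close>; the longest parts
  cancel, which is why the bound stays \<open>l\<close> instead of \<open>Suc l\<close>.\<close>

lemma commutator_low_words:
  fixes u :: "'k::field_char_0 witt_env"
  assumes "u \<in> low_words d l"
  shows "e_gen i * u - u * e_gen i \<in> low_words (nat_of_pnat i + d) l"
  using assms unfolding low_words_def[of d l]
proof (rule env_env.span_image_into[rotated 4, where f = "\<lambda>u. e_gen i * u - u * e_gen i"])
  show "e_gen i * x - x * e_gen i \<in> low_words (nat_of_pnat i + d) l"
    if x: "x \<in> {word_prod ws |ws. word_deg ws = d \<and> length ws < l}" for x :: "'k witt_env"
  proof -
    obtain ws where ws: "x = word_prod ws" "word_deg ws = d" "length ws < l" using x by auto
    have "e_gen i * x - x * e_gen i - pbw (sym_bracket (x_gen i) (sym_mon (mset ws)))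
        \<in> low_words (nat_of_pnat i + d) l"
      using commutator_word_prod[of i ws] low_words_mono[OF _ less_imp_le[OF ws(3)]] ws by auto
    moreover have "pbw (sym_bracket (x_gen i) (sym_mon (mset ws)) :: 'k witt_sym) \<in> low_words (nat_of_pnat i + d) l"
      by (rule pbw_in_low_words[OF sym_bracket_sym_mon[of i "mset ws"], unfolded size_mset
          word_deg_eq_mdeg[symmetric] ws(2), OF ws(3)])
    ultimately show ?thesis using low_words_add by (metis diff_add_cancel)
  qed
qed (simp_all add: algebra_simps witt_smult_mult_left witt_smult_mult_right subspace_low_words
  env.scale_right_diff_distrib)

lemma commutator_pbw:
  fixes p :: "'k::field_char_0 witt_sym"
  assumes "p \<in> sym_on (bideg d l)"
  shows "e_gen i * pbw p - pbw p * e_gen i - pbw (sym_bracket (x_gen i) p) \<in> low_words (nat_of_pnat i + d) l"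
  using assms unfolding sym_on_eq_span
proof (rule sym_env.span_image_into[rotated 4,
    where f = "\<lambda>p. e_gen i * pbw p - pbw p * e_gen i - pbw (sym_bracket (x_gen i) p)"])
  show "e_gen i * pbw x - pbw x * e_gen i - pbw (sym_bracket (x_gen i) x) \<in> low_words (nat_of_pnat i + d) l"
    if x: "x \<in> sym_mon ` bideg d l" for x :: "'k witt_sym"
  proof -
    obtain m where m: "x = sym_mon m" "mdeg m = d" "size m = l" using x unfolding bideg_def by blast
    show ?thesis
      using commutator_word_prod[of i "sorted_list_of_multiset m", where 'k = 'k] m(2,3)
      by (simp add: m(1) pbw_single word_deg_eq_mdeg pbw_mon_def flip: size_mset)
  qed
qed (simp_all add: subspace_low_words pbw.add pbw.scale distrib_left distrib_right
  witt_smult_mult_right witt_smult_mult_left env.scale_right_diff_distrib env.scale_right_distrib sym_bracket_add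
  sym_bracket_smult add_ac add_diff_eq diff_add_eq diff_diff_eq)

section \<open>Associated graded ideals\<close>

lemmas ideal_U_witt_closed =
  ideal_record_zero[where A = U_witt, simplified] ideal_record_add[where A = U_witt, simplified]
  ideal_record_mult_left[where A = U_witt, simplified] ideal_record_mult_right[where A = U_witt, simplified]

lemma ideal_U_witt_smult: "ideal J U_witt \<Longrightarrow> u \<in> J \<Longrightarrow> witt_smult c u \<in> J"
  using ideal_U_witt_closed(3)[of J u "witt_smult c 1"] by (simp add: witt_smult_mult_left)

lemma subspace_ideal_U_witt: "ideal J U_witt \<Longrightarrow> env.subspace J"
  by (rule env.subspaceI) (auto intro: ideal_U_witt_closed ideal_U_witt_smult)

subsection \<open>The degree filtration\<close>

definition env_less :: "nat \<Rightarrow> 'k::field_char_0 witt_env set" where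
  "env_less n = env.span (\<Union>k<n. U_deg k)"

definition deg_part :: "'k::field_char_0 witt_env set \<Rightarrow> nat \<Rightarrow> 'k witt_env set" where
  "deg_part J n = {v \<in> U_deg n. \<exists>u\<in>J. u - v \<in> env_less n}"

lemma subspace_env_less: "env.subspace (env_less n)"
  by (simp add: env_less_def)

lemma subspace_U_deg: "env.subspace (U_deg n)"
  by (simp add: U_deg_eq_low_words subspace_low_words)

lemma gr_d_eq: "gr_d J = env.span (\<Union>n. deg_part J n)"
  unfolding gr_d_def lspan_U_witt deg_part_def env_less_def by (rule arg_cong[where f = env.span]) auto

lemma subspace_deg_part:
  assumes "env.subspace J"
  shows "env.subspace (deg_part J n)"
proof (rule env.subspaceI)
  show "0 \<in> deg_part J n"
    using env.subspace_0[OF assms] env.subspace_0[OF subspace_U_deg] env.subspace_0[OF subspace_env_less]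
    by (force simp: deg_part_def)
  fix v w c assume "v \<in> deg_part J n"
  then obtain u where v: "v \<in> U_deg n" "u \<in> J" "u - v \<in> env_less n" by (auto simp: deg_part_def)
  have "witt_smult c u - witt_smult c v \<in> env_less n"
    using env.subspace_scale[OF subspace_env_less v(3), of c] by (simp add: env.scale_right_diff_distrib)
  then show "witt_smult c v \<in> deg_part J n"
    using v env.subspace_scale[OF assms] env.subspace_scale[OF subspace_U_deg]
    by (auto simp: deg_part_def)
  assume "w \<in> deg_part J n"
  then obtain t where w: "w \<in> U_deg n" "t \<in> J" "t - w \<in> env_less n" by (auto simp: deg_part_def)
  have "(u + t) - (v + w) \<in> env_less n"
    using env.subspace_add[OF subspace_env_less v(3) w(3)] by (simp add: algebra_simps)
  then show "v + w \<in> deg_part J n"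
    using v w env.subspace_add[OF assms] env.subspace_add[OF subspace_U_deg]
    by (auto simp: deg_part_def)
qed

text \<open>Each \<open>deg_part\<close> is a subspace contained in a single degree, so a
  homogeneous component of a sum of leading terms is again a leading term, possibly zero.\<close>

lemma env_proj_gr_d:
  assumes "env.subspace J" "u \<in> gr_d J"
  shows "env_proj n u \<in> deg_part J n"
  using assms(2) unfolding gr_d_eq
proof (rule env_env.span_image_into[rotated 4])
  show "env_proj n x \<in> deg_part J n" if "x \<in> (\<Union>n. deg_part J n)" for x
    using that env.subspace_0[OF subspace_deg_part[OF assms(1), of n]]
    by (auto simp: env_proj_U_deg deg_part_def[of J])
qed (simp_all add: env_proj.add env_proj.scale subspace_deg_part assms)

lemma deg_part_subset_gr_d: "deg_part J n \<subseteq> gr_d J"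
  unfolding gr_d_eq by (auto intro: env.span_base)

lemma env_proj_gr_d_closed: "env.subspace J \<Longrightarrow> u \<in> gr_d J \<Longrightarrow> env_proj n u \<in> gr_d J"
  using env_proj_gr_d deg_part_subset_gr_d by blast

lemma subspace_gr_d: "env.subspace (gr_d J)"
  by (simp add: gr_d_eq)

lemma
  fixes v :: "'k::field_char_0 witt_env"
  shows U_deg_mult_left: "v \<in> U_deg n \<Longrightarrow> e_gen i * v \<in> U_deg (nat_of_pnat i + n)"
    and U_deg_mult_right: "v \<in> U_deg n \<Longrightarrow> v * e_gen i \<in> U_deg (nat_of_pnat i + n)"
  using low_words_mult_left[of v n "Suc n" i] low_words_mult_right[of v n "Suc n" i]
    low_words_subset_U_deg[of "nat_of_pnat i + n" "Suc (Suc n)"]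
  by (auto simp: U_deg_eq_low_words[of n])

lemma U_deg_subset_env_less: "d < n \<Longrightarrow> (U_deg d :: 'k::field_char_0 witt_env set) \<subseteq> env_less n"
  unfolding env_less_def by (auto intro: env.span_base)

lemma
  fixes v :: "'k::field_char_0 witt_env"
  assumes "v \<in> env_less n"
  shows env_less_mult_left: "e_gen i * v \<in> env_less (nat_of_pnat i + n)"
    and env_less_mult_right: "v * e_gen i \<in> env_less (nat_of_pnat i + n)"
proof -
  have "e_gen i * x \<in> env_less (nat_of_pnat i + n) \<and> x * e_gen i \<in> env_less (nat_of_pnat i + n)"
    if x: "x \<in> (\<Union>k<n. U_deg k)" for x :: "'k witt_env"
  proof -
    obtain k where "k < n" "x \<in> U_deg k" using x by auto
    then show ?thesis
      using U_deg_mult_left[of x k i] U_deg_mult_right[of x k i]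
        U_deg_subset_env_less[of "nat_of_pnat i + k" "nat_of_pnat i + n", where 'k = 'k] by auto
  qed
  note * = this
  show "e_gen i * v \<in> env_less (nat_of_pnat i + n)"
    using assms unfolding env_less_def[of n]
    by (rule env_env.span_image_into[rotated 4])
      (use * in \<open>auto simp: distrib_left witt_smult_mult_right subspace_env_less\<close>)
  show "v * e_gen i \<in> env_less (nat_of_pnat i + n)"
    using assms unfolding env_less_def[of n]
    by (rule env_env.span_image_into[rotated 4])
      (use * in \<open>auto simp: distrib_right witt_smult_mult_left subspace_env_less\<close>)
qed

lemma ideal_env_of_gens:
  fixes I :: "'k::field_char_0 witt_env set"
  assumes I: "env.subspace I" "\<And>i u. u \<in> I \<Longrightarrow> e_gen i * u \<in> I" "\<And>i u. u \<in> I \<Longrightarrow> u * e_gen i \<in> I"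
  shows "ideal I U_witt"
proof (rule ideal_recordI)
  fix u x :: "'k witt_env" assume u: "u \<in> I"
  have "word_prod ws * u \<in> I" for ws
    by (induction ws) (use u I(2) in \<open>auto simp: mult.assoc\<close>)
  moreover have "u * word_prod ws \<in> I" for ws
    using u by (induction ws arbitrary: u) (use I(3) in \<open>auto simp flip: mult.assoc\<close>)
  moreover have x: "x \<in> env.span (range word_prod)" by (simp add: span_word_prod)
  ultimately show "x * u \<in> I" "u * x \<in> I"
    using env_env.span_image_into[OF _ _ _ I(1) x, of "\<lambda>x. x * u"]
      env_env.span_image_into[OF _ _ _ I(1) x, of "\<lambda>x. u * x"]
    by (auto simp: distrib_left distrib_right witt_smult_mult_left witt_smult_mult_right)
qed (use ring_U_witt env.subspace_0[OF I(1)] env.subspace_add[OF I(1)] in auto)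

text \<open>A generator \<open>e_gen i\<close> raises the leading degree and the bound on the lower
  terms by the same amount, on either side. So products of leading terms with generators are leading
  terms of the corresponding products, or zero.\<close>

lemma ideal_gr_d:
  fixes J :: "'k::field_char_0 witt_env set"
  assumes J: "ideal J U_witt"
  shows "ideal (gr_d J) U_witt"
proof (rule ideal_env_of_gens)
  have "e_gen i * v \<in> deg_part J (nat_of_pnat i + n) \<and> v * e_gen i \<in> deg_part J (nat_of_pnat i + n)"
    if v: "v \<in> deg_part J n" for v i n
  proof -
    obtain u where u: "v \<in> U_deg n" "u \<in> J" "u - v \<in> env_less n" using v by (auto simp: deg_part_def)
    have "e_gen i * u - e_gen i * v \<in> env_less (nat_of_pnat i + n)"
      "u * e_gen i - v * e_gen i \<in> env_less (nat_of_pnat i + n)"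
      using env_less_mult_left[OF u(3), of i] env_less_mult_right[OF u(3), of i]
      by (simp_all add: algebra_simps)
    then show ?thesis
      using ideal_U_witt_closed(3,4)[OF J u(2), of "e_gen i"] u(1)
      by (auto simp: deg_part_def U_deg_mult_left U_deg_mult_right)
  qed
  then have *: "e_gen i * v \<in> gr_d J \<and> v * e_gen i \<in> gr_d J" if "v \<in> (\<Union>n. deg_part J n)" for v i
    using that deg_part_subset_gr_d by blast
  fix i and u :: "'k witt_env" assume u: "u \<in> gr_d J"
  show "e_gen i * u \<in> gr_d J"
    using u unfolding gr_d_eq[of J]
    by (rule env_env.span_image_into[rotated 4])
      (use * in \<open>auto simp: distrib_left witt_smult_mult_right subspace_gr_d gr_d_eq[symmetric]\<close>)
  show "u * e_gen i \<in> gr_d J"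
    using u unfolding gr_d_eq[of J]
    by (rule env_env.span_image_into[rotated 4])
      (use * in \<open>auto simp: distrib_right witt_smult_mult_left subspace_gr_d gr_d_eq[symmetric]\<close>)
qed (rule subspace_gr_d)

subsection \<open>The order and degree-order filtrations\<close>

text \<open>The symbols of bidegree (d, l), which serve both filtrations. Taking the error in
  \<open>low_words d l\<close> forces the element \<open>u\<close> itself to be homogeneous of
  degree \<open>d\<close>.\<close>

definition gr_part :: "'k::field_char_0 witt_env set \<Rightarrow> nat \<Rightarrow> nat \<Rightarrow> 'k witt_sym set" where
  "gr_part I d l = {p \<in> sym_on (bideg d l). \<exists>u\<in>I. u - pbw p \<in> low_words d l}"

definition gr_sym :: "'k::field_char_0 witt_env set \<Rightarrow> 'k witt_sym set" where
  "gr_sym I = sym.span (\<Union>d l. gr_part I d l)"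

lemma sum_pm_filter:
  assumes "finite D" "f ` Poly_Mapping.keys p \<subseteq> D"
  shows "(\<Sum>d\<in>D. pm_filter (\<lambda>m. f m = d) p) = p"
proof (rule poly_mapping_eqI)
  fix m
  have "Poly_Mapping.lookup (\<Sum>d\<in>D. pm_filter (\<lambda>m. f m = d) p) m =
      (\<Sum>d\<in>D. if f m = d then Poly_Mapping.lookup p m else 0)"
    by (simp add: lookup_sum pm_filter.rep_eq when_def)
  also have "\<dots> = Poly_Mapping.lookup p m"
    using assms by (cases "m \<in> Poly_Mapping.keys p") (auto simp: in_keys_iff)
  finally show "Poly_Mapping.lookup (\<Sum>d\<in>D. pm_filter (\<lambda>m. f m = d) p) m = Poly_Mapping.lookup p m" .
qed

text \<open>
  \<open>A n\<close> are the monomials of filtration degree \<open>n\<close>, and \<open>s n d\<close> is the size of those among them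
  that have degree \<open>d\<close>.
\<close>

lemma span_symbols_eq_gr_sym:
  fixes I :: "'k::field_char_0 witt_env set" and L :: "nat \<Rightarrow> 'k witt_env set"
  assumes I: "\<And>u d. u \<in> I \<Longrightarrow> env_proj d u \<in> I"
    and A: "\<And>n d. A n \<inter> {m. mdeg m = d} \<subseteq> bideg d (s n d)"
    and L: "\<And>w n d. w \<in> L n \<Longrightarrow> env_proj d w \<in> low_words d (s n d)"
    and AL: "\<And>d l. \<exists>n. bideg d l \<subseteq> A n \<and> low_words d l \<subseteq> L n"
  shows "sym.span {p. \<exists>n. \<exists>u\<in>I. p \<in> sym_on (A n) \<and> u - pbw p \<in> L n} = gr_sym I"
proof
  show "gr_sym I \<subseteq> sym.span {p. \<exists>n. \<exists>u\<in>I. p \<in> sym_on (A n) \<and> u - pbw p \<in> L n}"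
    unfolding gr_sym_def
  proof (rule sym.span_mono, safe)
    fix p d l assume "p \<in> gr_part I d l"
    moreover obtain n where "bideg d l \<subseteq> A n" "low_words d l \<subseteq> L n" using AL by blast
    ultimately show "\<exists>n. \<exists>u\<in>I. p \<in> sym_on (A n) \<and> u - pbw p \<in> L n"
      using sym_on_mono unfolding gr_part_def by blast
  qed
  show "sym.span {p. \<exists>n. \<exists>u\<in>I. p \<in> sym_on (A n) \<and> u - pbw p \<in> L n} \<subseteq> gr_sym I"
  proof (rule sym.span_minimal)
    show "sym.subspace (gr_sym I)" by (simp add: gr_sym_def)
    show "{p. \<exists>n. \<exists>u\<in>I. p \<in> sym_on (A n) \<and> u - pbw p \<in> L n} \<subseteq> gr_sym I"
    proof safe
      fix p n u assume p: "p \<in> sym_on (A n)" and u: "u \<in> I" "u - pbw p \<in> L n"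
      \<comment> \<open>A symbol of filtration degree \<open>n\<close> may mix several degrees. As
        \<open>I\<close> contains the components of its elements, each component of \<open>p\<close>
        is a symbol in its own right.\<close>
      have "pm_filter (\<lambda>m. mdeg m = d) p \<in> gr_part I d (s n d)" for d
      proof -
        have "env_proj d u - pbw (pm_filter (\<lambda>m. mdeg m = d) p) \<in> low_words d (s n d)"
          using L[OF u(2), of d] by (simp add: env_proj.diff env_proj_pbw)
        moreover have "pm_filter (\<lambda>m. mdeg m = d) p \<in> sym_on (bideg d (s n d))"
          using pm_filter_sym_on[OF p, of "{m. mdeg m = d}"] sym_on_mono[OF A[of n d]] by auto
        ultimately show ?thesis using I[OF u(1)] by (auto simp: gr_part_def)
      qed
      then have "(\<Sum>d\<in>mdeg ` Poly_Mapping.keys p. pm_filter (\<lambda>m. mdeg m = d) p) \<in> gr_sym I"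
        unfolding gr_sym_def by (intro sym.span_sum sym.span_base) blast
      then show "p \<in> gr_sym I" by (simp add: sum_pm_filter)
    qed
  qed
qed

lemma S_ord_eq: "S_ord n = sym_on {m. size m = n}"
proof -
  have "{sym_mon m :: 'a witt_sym | m. size m = n} = sym_mon ` {m. size m = n}" by auto
  then show ?thesis by (simp only: S_ord_def lspan_S_witt sym_on_eq_span)
qed

lemma S_do_eq: "S_do n = sym_on {m. mdeg m + size m = n}"
proof -
  have "{sym_mon m :: 'a witt_sym | m. (\<Sum>i\<in>#m. nat_of_pnat i) + size m = n} =
      sym_mon ` {m. mdeg m + size m = n}" by (auto simp: mdeg_def)
  then show ?thesis by (simp only: S_do_def lspan_S_witt sym_on_eq_span)
qed

lemma env_span_UN_subset:
  "(\<And>k. k \<in> N \<Longrightarrow> X k \<subseteq> env.span Y) \<Longrightarrow> env.span (\<Union>k\<in>N. X k) \<subseteq> env.span Y"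
  by (rule env.span_minimal) auto

lemma gr_o_eq_gr_sym:
  fixes I :: "'k::field_char_0 witt_env set"
  assumes I: "\<And>u d. u \<in> I \<Longrightarrow> env_proj d u \<in> I"
  shows "gr_o I = gr_sym I"
  unfolding gr_o_def lspan_S_witt lspan_U_witt is_symbol_def S_ord_eq
proof (rule span_symbols_eq_gr_sym[OF I])
  show "{m. size m = n} \<inter> {m. mdeg m = d} \<subseteq> bideg d n" for n d by (auto simp: bideg_def)
  show "env_proj d w \<in> low_words d n" if "w \<in> env.span (\<Union>k<n. ord_filt k)" for w :: "'k witt_env" and n d
  proof -
    have "env.span (\<Union>k<n. ord_filt k) \<subseteq> env.span {word_prod ws :: 'k witt_env | ws. length ws < n}"
      unfolding ord_filt_def lspan_U_witt by (intro env_span_UN_subset env.span_mono) auto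
    then have "w \<in> env.span {word_prod ws | ws. length ws < n}" using that by auto
    then show ?thesis
      by (rule env_env.span_image_into[rotated 4]) (auto simp: env_proj.add env_proj.scale subspace_low_words env_proj_word_prod word_prod_in_low_words)
  qed
  show "\<exists>n. bideg d l \<subseteq> {m. size m = n} \<and> low_words d l \<subseteq> env.span (\<Union>k<n. ord_filt k :: 'k witt_env set)" for d l
  proof (intro exI conjI)
    show "bideg d l \<subseteq> {m. size m = l}" by (auto simp: bideg_def)
    have "word_prod ws \<in> env.span (\<Union>k<l. ord_filt k :: 'k witt_env set)" if "length ws < l" for ws
      using that by (intro env.span_base) (auto simp: ord_filt_def lspan_U_witt intro: env.span_base)
    then show "low_words d l \<subseteq> env.span (\<Union>k<l. ord_filt k :: 'k witt_env set)"
      unfolding low_words_def by (intro env.span_minimal) auto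
  qed
qed

lemma gr_do_eq_gr_sym:
  fixes I :: "'k::field_char_0 witt_env set"
  assumes I: "\<And>u d. u \<in> I \<Longrightarrow> env_proj d u \<in> I"
  shows "gr_do I = gr_sym I"
  unfolding gr_do_def lspan_S_witt lspan_U_witt is_symbol_def S_do_eq
proof (rule span_symbols_eq_gr_sym[OF I])
  \<comment> \<open>In degree \<open>d\<close> the filtration degree \<open>n\<close> leaves length
    n - d. Truncated subtraction is harmless: for d > n no monomial remains.\<close>
  show "{m. mdeg m + size m = n} \<inter> {m. mdeg m = d} \<subseteq> bideg d (n - d)" for n d by (auto simp: bideg_def)
  show "env_proj d w \<in> low_words d (n - d)" if "w \<in> env.span (\<Union>k<n. do_filt k)" for w :: "'k witt_env" and n d
  proof -
    have "env.span (\<Union>k<n. do_filt k) \<subseteq>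
        env.span {word_prod ws :: 'k witt_env | ws. word_deg ws + length ws < n}"
      unfolding do_filt_def lspan_U_witt by (intro env_span_UN_subset env.span_mono) auto
    then have "w \<in> env.span {word_prod ws | ws. word_deg ws + length ws < n}" using that by auto
    then show ?thesis
      by (rule env_env.span_image_into[rotated 4]) (auto simp: env_proj.add env_proj.scale subspace_low_words env_proj_word_prod word_prod_in_low_words)
  qed
  show "\<exists>n. bideg d l \<subseteq> {m. mdeg m + size m = n} \<and>
      low_words d l \<subseteq> env.span (\<Union>k<n. do_filt k :: 'k witt_env set)" for d l
  proof (intro exI conjI)
    show "bideg d l \<subseteq> {m. mdeg m + size m = d + l}" by (auto simp: bideg_def)
    \<comment> \<open>\<open>do_filt\<close> is spanned by sorted words, so
      \<open>low_words d l\<close> is taken in its straightened form.\<close>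
    have "pbw_mon m \<in> env.span (\<Union>k<d + l. do_filt k :: 'k witt_env set)" if "mdeg m = d" "size m < l" for m
    proof -
      have "word_deg (sorted_list_of_multiset m) + length (sorted_list_of_multiset m) = d + size m"
        using that by (simp add: word_deg_eq_mdeg flip: size_mset)
      then have "pbw_mon m \<in> (do_filt (d + size m) :: 'k witt_env set)"
        unfolding do_filt_def lspan_U_witt pbw_mon_def by (intro env.span_base) auto
      then show ?thesis using that by (intro env.span_base) auto
    qed
    then show "low_words d l \<subseteq> env.span (\<Union>k<d + l. do_filt k :: 'k witt_env set)"
      unfolding low_words_eq by (intro env.span_minimal) auto
  qed
qed

subsection \<open>The Poisson ideal of symbols\<close>

lemma subspace_gr_part:
  assumes I: "env.subspace I"
  shows "sym.subspace (gr_part I d l)"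
proof (rule sym.subspaceI)
  show "0 \<in> gr_part I d l"
    using sym.subspace_0[OF subspace_sym_on] env.subspace_0[OF I]
    by (auto simp: gr_part_def pbw.zero intro!: bexI[of _ 0])
  fix p q c assume "p \<in> gr_part I d l"
  then obtain u where p: "p \<in> sym_on (bideg d l)" "u \<in> I" "u - pbw p \<in> low_words d l"
    by (auto simp: gr_part_def)
  have "witt_smult c u - pbw (sym_smult c p) \<in> low_words d l"
    using low_words_scale[OF p(3), of c] by (simp add: pbw.scale env.scale_right_diff_distrib)
  then show "sym_smult c p \<in> gr_part I d l"
    using env.subspace_scale[OF I p(2)] sym.subspace_scale[OF subspace_sym_on p(1)]
    unfolding gr_part_def by blast
  assume "q \<in> gr_part I d l"
  then obtain v where q: "q \<in> sym_on (bideg d l)" "v \<in> I" "v - pbw q \<in> low_words d l"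
    by (auto simp: gr_part_def)
  have "(u + v) - pbw (p + q) \<in> low_words d l"
    using low_words_add[OF p(3) q(3)] by (simp add: pbw.add algebra_simps)
  then show "p + q \<in> gr_part I d l"
    using env.subspace_add[OF I p(2) q(2)] sym.subspace_add[OF subspace_sym_on p(1) q(1)]
    unfolding gr_part_def by blast
qed

lemma subspace_gr_sym: "sym.subspace (gr_sym I)"
  by (simp add: gr_sym_def)

lemma gr_part_subset_gr_sym: "gr_part I d l \<subseteq> gr_sym I"
  unfolding gr_sym_def by (rule subsetI, rule sym.span_base) blast

text \<open>The ideal of symbols is bigraded: each generating piece is a subspace in one bidegree,
  so truncation to (d, l) fixes it or kills it.\<close>

lemma pm_filter_gr_sym:
  assumes I: "env.subspace I" and p: "p \<in> gr_sym I"
  shows "pm_filter (\<lambda>m. m \<in> bideg d l) p \<in> gr_part I d l"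
  using p unfolding gr_sym_def
proof (rule sym_sym.span_image_into[rotated 4])
  show "pm_filter (\<lambda>m. m \<in> bideg d l) x \<in> gr_part I d l" if x: "x \<in> (\<Union>d l. gr_part I d l)" for x
  proof -
    obtain d' l' where x: "x \<in> gr_part I d' l'" using x by blast
    then have on: "x \<in> sym_on (bideg d' l')" by (simp add: gr_part_def)
    show ?thesis
    proof (cases "d = d' \<and> l = l'")
      case True
      then show ?thesis using x pm_filter_id[OF on order_refl] by simp
    next
      case False
      then have "bideg d' l' \<inter> bideg d l = {}" by (auto simp: bideg_def)
      then show ?thesis
        using pm_filter_disjoint[OF on] sym.subspace_0[OF subspace_gr_part[OF I]] by simp
    qed
  qed
qed (simp_all add: pm_filter_add pm_filter_scale subspace_gr_part[OF I])

lemma gr_part_mult_x_gen: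
  assumes I: "ideal I U_witt" and p: "p \<in> gr_part I d l"
  shows "x_gen i * p \<in> gr_part I (nat_of_pnat i + d) (Suc l)"
proof -
  obtain u where u: "p \<in> sym_on (bideg d l)" "u \<in> I" "u - pbw p \<in> low_words d l"
    using p by (auto simp: gr_part_def)
  have "e_gen i * (u - pbw p) + (e_gen i * pbw p - pbw (x_gen i * p))
      \<in> low_words (nat_of_pnat i + d) (Suc l)"
    by (intro low_words_add low_words_mult_left e_gen_mult_pbw u)
  then have "e_gen i * u - pbw (x_gen i * p) \<in> low_words (nat_of_pnat i + d) (Suc l)"
    by (simp add: algebra_simps)
  then show ?thesis
    using x_gen_mult_sym_on[OF u(1)] ideal_U_witt_closed(3)[OF I u(2)] unfolding gr_part_def by blast
qed

text \<open>The commutator of \<open>e_gen i\<close> with \<open>u\<close> lies in the two-sided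
  ideal and has the bracket as its symbol; the error of \<open>u\<close> stays short enough because
  commutators do not lengthen words.\<close>

lemma gr_part_bracket_x_gen:
  assumes I: "ideal I U_witt" and p: "p \<in> gr_part I d l"
  shows "sym_bracket (x_gen i) p \<in> gr_part I (nat_of_pnat i + d) l"
proof -
  obtain u where u: "p \<in> sym_on (bideg d l)" "u \<in> I" "u - pbw p \<in> low_words d l"
    using p by (auto simp: gr_part_def)
  have "(e_gen i * (u - pbw p) - (u - pbw p) * e_gen i) +
      (e_gen i * pbw p - pbw p * e_gen i - pbw (sym_bracket (x_gen i) p)) \<in> low_words (nat_of_pnat i + d) l"
    by (intro low_words_add commutator_low_words commutator_pbw u)
  then have "(e_gen i * u - u * e_gen i) - pbw (sym_bracket (x_gen i) p) \<in> low_words (nat_of_pnat i + d) l"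
    by (simp add: algebra_simps)
  moreover have "e_gen i * u - u * e_gen i \<in> I"
    by (intro env.subspace_diff[OF subspace_ideal_U_witt[OF I]] ideal_U_witt_closed[OF I] u)
  ultimately show ?thesis
    using sym_bracket_sym_on[OF u(1)] unfolding gr_part_def by blast
qed

lemma
  assumes I: "ideal I U_witt" and p: "p \<in> gr_sym I"
  shows gr_sym_mult_x_gen: "x_gen i * p \<in> gr_sym I"
    and gr_sym_bracket_x_gen: "sym_bracket (x_gen i) p \<in> gr_sym I"
proof -
  have 1: "x_gen i * x \<in> gr_sym I" if "x \<in> (\<Union>d l. gr_part I d l)" for x
    using that gr_part_mult_x_gen[OF I] gr_part_subset_gr_sym by blast
  show "x_gen i * p \<in> gr_sym I"
    by (rule sym_sym.span_image_into[OF _ _ 1 subspace_gr_sym p[unfolded gr_sym_def]])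
      (simp_all add: distrib_left sym_smult_mult_right)
  have 2: "sym_bracket (x_gen i) x \<in> gr_sym I" if "x \<in> (\<Union>d l. gr_part I d l)" for x
    using that gr_part_bracket_x_gen[OF I] gr_part_subset_gr_sym by blast
  show "sym_bracket (x_gen i) p \<in> gr_sym I"
    by (rule sym_sym.span_image_into[OF _ _ 2 subspace_gr_sym p[unfolded gr_sym_def]])
      (simp_all add: sym_bracket_add sym_bracket_smult)
qed

lemma gr_sym_mult:
  assumes I: "ideal I U_witt" and p: "p \<in> gr_sym I"
  shows "q * p \<in> gr_sym I"
proof (induction q rule: poly_mapping_induct_single)
  case (1 m c)
  show ?case
  proof (induction m)
    case empty
    then show ?case using sym.subspace_scale[OF subspace_gr_sym p] by simp
  next
    case (add i m)
    then show ?case using gr_sym_mult_x_gen[OF I] by (simp add: sym_mon_add_mset mult.assoc)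
  qed
qed (simp add: distrib_right sym.subspace_add[OF subspace_gr_sym])

lemma sym_bracket_add_left: "sym_bracket (p + q) r = sym_bracket p r + sym_bracket q r"
  using sym_bracket_antisym[of "p + q" r] sym_bracket_antisym[of p r] sym_bracket_antisym[of q r]
  by (simp add: sym_bracket_add)

lemma sym_bracket_mult_left: "sym_bracket (p * q) r = sym_bracket p r * q + p * sym_bracket q r"
  using sym_bracket_antisym[of "p * q" r] sym_bracket_antisym[of p r] sym_bracket_antisym[of q r]
  by (simp add: sym_bracket_Leibniz)

lemma sym_bracket_const_left: "sym_bracket (Poly_Mapping.single 0 c) p = 0"
  using sym_bracket_antisym[of "Poly_Mapping.single 0 c" p] by (simp add: sym_bracket_const)

lemma gr_sym_bracket:
  assumes I: "ideal I U_witt" and p: "p \<in> gr_sym I"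
  shows "sym_bracket q p \<in> gr_sym I"
proof (induction q rule: poly_mapping_induct_single)
  case (1 m c)
  show ?case
  proof (induction m)
    case empty
    then show ?case using sym.subspace_0[OF subspace_gr_sym] by (simp add: sym_bracket_const_left)
  next
    case (add i m)
    have "sym_bracket (x_gen i) p * Poly_Mapping.single m c \<in> gr_sym I"
      using gr_sym_mult[OF I gr_sym_bracket_x_gen[OF I p, of i], of "Poly_Mapping.single m c"]
      by (simp add: mult.commute)
    then show ?case
      unfolding sym_mon_add_mset sym_bracket_mult_left
      by (intro sym.subspace_add[OF subspace_gr_sym] gr_sym_mult_x_gen[OF I add])
  qed
qed (simp add: sym_bracket_add_left sym.subspace_add[OF subspace_gr_sym])

lemma poisson_ideal_gr_sym:
  fixes I :: "'k::field_char_0 witt_env set"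
  assumes I: "ideal I U_witt"
  shows "poisson_ideal S_witt (gr_sym I)"
proof -
  have "ideal (gr_sym I) S_witt"
  proof (rule ideal_recordI[OF ring_S_witt])
    fix p q :: "'k witt_sym" assume p: "p \<in> gr_sym I"
    show "q * p \<in> gr_sym I" "p * q \<in> gr_sym I"
      using gr_sym_mult[OF I p, of q] by (simp_all add: mult.commute)
  qed (auto intro: sym.subspace_0[OF subspace_gr_sym] sym.subspace_add[OF subspace_gr_sym])
  then show ?thesis using gr_sym_bracket[OF I] by (simp add: poisson_ideal_def)
qed

section \<open>Standard monomials\<close>

text \<open>The third component only breaks ties between monomials of equal bidegree, by numbering
  lists of naturals, and makes the key injective.\<close>

definition mon_key :: "pnat multiset \<Rightarrow> nat \<times> nat \<times> nat" where
  "mon_key m = (mdeg m, size m, to_nat (map nat_of_pnat (sorted_list_of_multiset m)))"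

lemma inj_mon_key: "inj mon_key"
proof (rule injI)
  fix m n assume "mon_key m = mon_key n"
  then have "map nat_of_pnat (sorted_list_of_multiset m) = map nat_of_pnat (sorted_list_of_multiset n)"
    by (simp add: mon_key_def)
  then have "sorted_list_of_multiset m = sorted_list_of_multiset n"
    by (rule map_injective) (simp add: inj_on_def nat_of_pnat_inject)
  then show "m = n" by (metis mset_sorted_list_of_multiset)
qed

definition mon_below :: "pnat multiset \<Rightarrow> pnat multiset set" where
  "mon_below m = {m'. mon_key m' < mon_key m}"

lemma mon_below_cases:
  assumes "m' \<in> mon_below m"
  obtains "mdeg m' < mdeg m" | "mdeg m' = mdeg m" "size m' < size m" | "m' \<in> bideg (mdeg m) (size m)"
  using assms by (auto simp: mon_below_def mon_key_def bideg_def order_le_less)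

lemma mon_belowI:
  "mdeg m' < mdeg m \<Longrightarrow> m' \<in> mon_below m"
  "mdeg m' = mdeg m \<Longrightarrow> size m' < size m \<Longrightarrow> m' \<in> mon_below m"
  by (simp_all add: mon_below_def mon_key_def)

text \<open>The negation of being standard: some element of \<open>J\<close> has \<open>m\<close> as
  its leading monomial, with coefficient 1.\<close>

definition env_reducible :: "'k::field_char_0 witt_env set \<Rightarrow> pnat multiset \<Rightarrow> bool" where
  "env_reducible J m \<longleftrightarrow> (\<exists>w\<in>env.span (pbw_mon ` mon_below m). pbw_mon m - w \<in> J)"

definition sym_reducible :: "'k::field_char_0 witt_sym set \<Rightarrow> pnat multiset \<Rightarrow> bool" where
  "sym_reducible K m \<longleftrightarrow> (\<exists>w\<in>sym.span (sym_mon ` mon_below m). sym_mon m - w \<in> K)"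

lemma pbw_mon_in_U_deg: "pbw_mon m \<in> (U_deg (mdeg m) :: 'k::field_char_0 witt_env set)"
  unfolding U_deg_eq_span_mon by (rule env.span_base) auto

text \<open>All monomials of smaller degree precede \<open>m\<close>, and no predecessor has larger
  degree. So the part of lower degree can be added to a reduction of \<open>m\<close> or dropped
  from it.\<close>

lemma env_reducible_gr_d:
  fixes J :: "'k::field_char_0 witt_env set"
  assumes J: "env.subspace J"
  shows "env_reducible (gr_d J) m \<longleftrightarrow> env_reducible J m"
proof
  let ?d = "mdeg m" and ?B = "env.span (pbw_mon ` mon_below m) :: 'k witt_env set"
  have proj: "env_proj ?d w \<in> ?B" if "w \<in> ?B" for w
    using that
    by (rule env_env.span_image_into[rotated 4])
      (auto simp: env_proj.add env_proj.scale env_proj_pbw_mon env.span_base env.span_zero)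
  have low: "env_less ?d \<subseteq> ?B"
    unfolding env_less_def span_U_deg_less by (intro env.span_mono image_mono) (auto intro: mon_belowI)
  show "env_reducible J m" if red: "env_reducible (gr_d J) m"
  proof -
    obtain w where w: "w \<in> ?B" "pbw_mon m - w \<in> gr_d J" using red by (auto simp: env_reducible_def)
    then have "pbw_mon m - env_proj ?d w \<in> deg_part J ?d"
      using env_proj_gr_d[OF J w(2), of ?d] by (simp add: env_proj.diff env_proj_pbw_mon)
    then obtain u where u: "u \<in> J" "u - (pbw_mon m - env_proj ?d w) \<in> env_less ?d"
      by (auto simp: deg_part_def)
    \<comment> \<open>This is \<open>pbw_mon m - u\<close>, written so that its membership in
      \<open>?B\<close> is visible.\<close>
    have "env_proj ?d w - (u - (pbw_mon m - env_proj ?d w)) \<in> ?B"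
      using proj[OF w(1)] u(2) low env.span_diff by blast
    then show ?thesis using u(1) unfolding env_reducible_def by (intro bexI) auto
  qed
  show "env_reducible (gr_d J) m" if red: "env_reducible J m"
  proof -
    obtain w where w: "w \<in> ?B" "pbw_mon m - w \<in> J" using red by (auto simp: env_reducible_def)
    have "w - env_proj ?d w \<in> env_less ?d"
      using w(1)
    proof (rule env_env.span_image_into[rotated 4, where f = "\<lambda>w. w - env_proj ?d w"])
      show "x - env_proj ?d x \<in> env_less ?d" if x: "x \<in> pbw_mon ` mon_below m" for x :: "'k witt_env"
      proof -
        obtain m' where m': "x = pbw_mon m'" "m' \<in> mon_below m" using x by blast
        from m'(2) have "mdeg m' < ?d \<or> mdeg m' = ?d" by (cases rule: mon_below_cases) (auto simp: bideg_def)
        then show ?thesis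
          using pbw_mon_in_U_deg[of m', where 'k = 'k] U_deg_subset_env_less[of "mdeg m'" ?d]
            env.subspace_0[OF subspace_env_less]
          by (auto simp: m'(1) env_proj_pbw_mon)
      qed
    qed (simp_all add: env_proj.add env_proj.scale env.scale_right_diff_distrib subspace_env_less)
    then have "env_proj ?d w - w \<in> env_less ?d"
      using env.subspace_neg[OF subspace_env_less, of "w - env_proj ?d w"] by simp
    moreover have "pbw_mon m - env_proj ?d w \<in> U_deg ?d"
      by (intro env.subspace_diff[OF subspace_U_deg] pbw_mon_in_U_deg env_proj_in_U_deg)
    ultimately have "pbw_mon m - env_proj ?d w \<in> deg_part J ?d"
      using w(2) unfolding deg_part_def by (auto intro!: bexI[of _ "pbw_mon m - w"])
    then show ?thesis
      using proj[OF w(1)] deg_part_subset_gr_d unfolding env_reducible_def by blast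
  qed
qed

text \<open>The same exchange one level down: within the degree of \<open>m\<close>, all shorter
  monomials precede \<open>m\<close> and no predecessor is longer. So shorter terms can be added or
  dropped.\<close>

lemma sym_reducible_gr_sym:
  fixes I :: "'k::field_char_0 witt_env set"
  assumes I: "env.subspace I" and graded: "\<And>u d. u \<in> I \<Longrightarrow> env_proj d u \<in> I"
  shows "sym_reducible (gr_sym I) m \<longleftrightarrow> env_reducible I m"
proof
  let ?d = "mdeg m" and ?l = "size m"
  let ?B = "env.span (pbw_mon ` mon_below m) :: 'k witt_env set"
  let ?top = "pm_filter (\<lambda>m. m \<in> bideg ?d ?l) :: 'k witt_sym \<Rightarrow> _"
  have on_m: "sym_mon m \<in> (sym_on (bideg ?d ?l) :: 'k witt_sym set)" by (simp add: sym_on_def bideg_def)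
  show "env_reducible I m" if red: "sym_reducible (gr_sym I) m"
  proof -
    obtain q where q: "q \<in> sym_on (mon_below m)" "sym_mon m - q \<in> gr_sym I"
      using red by (auto simp: sym_reducible_def sym_on_eq_span)
    then have "sym_mon m - ?top q \<in> gr_part I ?d ?l"
      using pm_filter_gr_sym[OF I q(2), of ?d ?l] pm_filter_id[OF on_m order_refl]
      by (simp add: pm_filter_diff)
    then obtain u where u: "u \<in> I" "u - pbw (sym_mon m - ?top q) \<in> low_words ?d ?l"
      by (auto simp: gr_part_def)
    have "low_words ?d ?l \<subseteq> ?B"
      unfolding low_words_eq by (intro env.span_mono image_mono) (auto intro: mon_belowI)
    moreover have "pbw (?top q) \<in> ?B"
      unfolding env_span_pbw_mon
      using pm_filter_sym_on[OF q(1)] sym_on_mono[of "mon_below m \<inter> _" "mon_below m"] by blast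
    ultimately have "pbw (?top q) - (u - pbw (sym_mon m - ?top q)) \<in> ?B"
      using u(2) env.span_diff by blast
    then show ?thesis
      using u(1) unfolding env_reducible_def by (intro bexI) (auto simp: pbw.diff pbw_single)
  qed
  show "sym_reducible (gr_sym I) m" if red: "env_reducible I m"
  proof -
    obtain q where q: "q \<in> sym_on (mon_below m)" "pbw_mon m - pbw q \<in> I"
      using red by (auto simp: env_reducible_def env_span_pbw_mon)
    \<comment> \<open>Gradedness of \<open>I\<close> allows the terms of lower degree to be dropped
      first; what is left differs from its top part by shorter words.\<close>
    let ?q = "pm_filter (\<lambda>m. mdeg m = ?d) q"
    have "pbw_mon m - pbw ?q \<in> I"
      using graded[OF q(2), of ?d] by (simp add: env_proj.diff env_proj_pbw_mon env_proj_pbw)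
    \<comment> \<open>A predecessor of \<open>m\<close> of equal degree that is not in the bidegree
      of \<open>m\<close> must be shorter than \<open>m\<close>.\<close>
    moreover have "pbw (?q - ?top q) \<in> low_words ?d ?l"
      unfolding low_words_eq env_span_pbw_mon
    proof (intro imageI)
      have "m' \<in> {m'. mdeg m' = ?d \<and> size m' < ?l}" if m': "m' \<in> Poly_Mapping.keys (?q - ?top q)" for m'
      proof -
        have "Poly_Mapping.lookup q m' \<noteq> 0" "mdeg m' = ?d" "m' \<notin> bideg ?d ?l"
          using m' by (auto simp: in_keys_iff lookup_minus pm_filter.rep_eq when_def bideg_def split: if_splits)
        moreover from this have "m' \<in> mon_below m" using q(1) by (auto simp: sym_on_def in_keys_iff)
        ultimately show ?thesis by (auto elim: mon_below_cases)
      qed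
      then show "?q - ?top q \<in> sym_on {m'. mdeg m' = ?d \<and> size m' < ?l}"
        unfolding sym_on_def by blast
    qed
    then have "pbw_mon m - pbw ?q - pbw (sym_mon m - ?top q) \<in> low_words ?d ?l"
      using low_words_diff[OF low_words_0, of "pbw (?q - ?top q)"] by (simp add: pbw.diff pbw_single)
    moreover have top: "?top q \<in> sym_on (mon_below m \<inter> bideg ?d ?l)" by (rule pm_filter_sym_on[OF q(1)])
    moreover have "sym_mon m - ?top q \<in> sym_on (bideg ?d ?l)"
      using top sym_on_mono[of "mon_below m \<inter> bideg ?d ?l" "bideg ?d ?l"]
      by (intro sym.subspace_diff[OF subspace_sym_on] on_m) auto
    ultimately have "sym_mon m - ?top q \<in> gr_sym I"
      using gr_part_subset_gr_sym[of I ?d ?l] unfolding gr_part_def by blast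
    moreover have "?top q \<in> sym_on (mon_below m)"
      using top sym_on_mono[of "mon_below m \<inter> bideg ?d ?l" "mon_below m"] by auto
    ultimately show ?thesis unfolding sym_reducible_def sym_on_eq_span by blast
  qed
qed

section \<open>Growth of the quotients\<close>

lemma nat_of_pnat_of_nat: "n \<ge> 1 \<Longrightarrow> nat_of_pnat (pnat_of_nat n) = n"
  by (simp add: pnat_of_nat_inverse)

text \<open>Common core of both lower bounds: \<open>T i\<close> is multiplication by the i-th
  generator, and \<open>D\<close> is left multiplication by e_1 or the bracket with x_1. The
  commutator of \<open>D\<close> with \<open>T j\<close> yields \<open>T (1 + j)\<close> at the cost
  of one more step, but only for j at least 2, so indices 1 and 2 are hypotheses.\<close>

lemma (in vector_space) witt_action_filtered:
  fixes P :: "nat \<Rightarrow> 'b set"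
  assumes P: "\<And>n. subspace (P n)" "mono P"
    and T1: "\<And>n p. p \<in> P n \<Longrightarrow> T (pnat_of_nat 1) p \<in> P (Suc n)"
    and T2: "\<And>n p. p \<in> P n \<Longrightarrow> T (pnat_of_nat 2) p \<in> P (Suc n)"
    and D: "\<And>n p. p \<in> P n \<Longrightarrow> D p \<in> P (Suc n)"
    and comm: "\<And>j p. scale (of_nat (nat_of_pnat j) - 1) (T (pnat_of_nat 1 + j) p) = D (T j p) - T j (D p)"
    and char: "\<And>n::nat. n > 0 \<Longrightarrow> (of_nat n :: 'a) \<noteq> 0"
  shows "p \<in> P n \<Longrightarrow> T i p \<in> P (n + nat_of_pnat i)"
proof (induction "nat_of_pnat i" arbitrary: i n p rule: less_induct)
  case less
  have mono: "x \<in> P k \<Longrightarrow> k \<le> l \<Longrightarrow> x \<in> P l" for x k l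
    using monoD[OF P(2)] by blast
  have i: "nat_of_pnat i \<ge> 1" by (rule nat_of_pnat_ge_1)
  have inv: "pnat_of_nat (nat_of_pnat i) = i" by (rule nat_of_pnat_inverse)
  consider "nat_of_pnat i = 1" | "nat_of_pnat i = 2" | "nat_of_pnat i \<ge> 3" using i by linarith
  then show ?case
  proof cases
    case 1
    then show ?thesis using T1[OF less.prems] inv by simp
  next
    case 2
    then show ?thesis using mono[OF T2[OF less.prems], of "n + 2"] inv by simp
  next
    case 3
    define j where "j = pnat_of_nat (nat_of_pnat i - 1)"
    have j: "nat_of_pnat j = nat_of_pnat i - 1" unfolding j_def using 3 by (intro nat_of_pnat_of_nat) simp
    have ij: "i = pnat_of_nat 1 + j"
      using j 3 by (simp add: nat_of_pnat_inject[symmetric] nat_of_pnat_of_nat)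
    have "T j p \<in> P (n + nat_of_pnat j)" using j 3 less.prems by (intro less.hyps) auto
    from D[OF this] have "D (T j p) \<in> P (n + nat_of_pnat i)" using j 3 by simp
    moreover have "T j (D p) \<in> P (Suc n + nat_of_pnat j)"
      using j 3 D[OF less.prems] by (intro less.hyps) auto
    then have "T j (D p) \<in> P (n + nat_of_pnat i)" using j 3 by simp
    ultimately have "scale (of_nat (nat_of_pnat j) - 1) (T i p) \<in> P (n + nat_of_pnat i)"
      unfolding ij comm by (rule subspace_diff[OF P(1)])
    moreover have "(of_nat (nat_of_pnat j) - 1 :: 'a) = of_nat (nat_of_pnat i - 2)"
      using 3 by (simp add: j of_nat_diff)
    moreover have "(of_nat (nat_of_pnat i - 2) :: 'a) \<noteq> 0" using 3 by (intro char) simp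
    ultimately show ?thesis
      using subspace_scale[OF P(1), of _ _ "inverse (of_nat (nat_of_pnat i - 2))"] by fastforce
  qed
qed

section \<open>Growth of quotients of the enveloping algebra\<close>

definition env_upto :: "nat \<Rightarrow> 'k::field_char_0 witt_env set" where
  "env_upto n = env.span {word_prod ws | ws. word_deg ws \<le> n}"

definition standard_count :: "(pnat multiset \<Rightarrow> bool) \<Rightarrow> nat \<Rightarrow> nat" where
  "standard_count R n = card {m. mdeg m \<le> n \<and> \<not> R m}"

lemma env_upto_eq: "(env_upto n :: 'k::field_char_0 witt_env set) = env.span (pbw_mon ` {m. mdeg m \<le> n})"
proof
  have "word_prod ws \<in> env.span (pbw_mon ` {m. mdeg m \<le> n} :: 'k witt_env set)" if "word_deg ws \<le> n" for ws
  proof -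
    have "word_prod ws \<in> (U_deg (word_deg ws) :: 'k witt_env set)"
      unfolding U_deg_def lspan_U_witt by (rule env.span_base) auto
    moreover have "(U_deg (word_deg ws) :: 'k witt_env set) \<subseteq> env.span (pbw_mon ` {m. mdeg m \<le> n})"
      unfolding U_deg_eq_span_mon using that by (intro env.span_mono) auto
    ultimately show ?thesis by auto
  qed
  then show "env_upto n \<subseteq> (env.span (pbw_mon ` {m. mdeg m \<le> n}) :: 'k witt_env set)"
    unfolding env_upto_def by (intro env.span_minimal) auto
  show "env.span (pbw_mon ` {m. mdeg m \<le> n}) \<subseteq> (env_upto n :: 'k witt_env set)"
    unfolding env_upto_def by (rule env.span_mono) (auto simp: pbw_mon_def word_deg_eq_mdeg)
qed

lemma subspace_env_upto: "env.subspace (env_upto n)"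
  by (simp add: env_upto_def)

lemma env_upto_mono: "m \<le> n \<Longrightarrow> env_upto m \<subseteq> env_upto n"
  unfolding env_upto_def by (rule env.span_mono) auto

lemma env_upto_mult:
  fixes u v :: "'k::field_char_0 witt_env"
  assumes "u \<in> env_upto a" "v \<in> env_upto b"
  shows "u * v \<in> env_upto (a + b)"
proof -
  have words: "word_prod vs * word_prod ws \<in> (env_upto (a + b) :: 'k witt_env set)"
    if "word_deg vs \<le> a" "word_deg ws \<le> b" for vs ws
    unfolding env_upto_def using that by (intro env.span_base) (auto intro!: exI[of _ "vs @ ws"])
  have "u * word_prod ws \<in> env_upto (a + b)" if ws: "word_deg ws \<le> b" for ws
    using assms(1) unfolding env_upto_def[of a]
    by (rule env_env.span_image_into[rotated 4])
      (use words ws in \<open>auto simp: distrib_right witt_smult_mult_left subspace_env_upto\<close>)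
  note * = this
  show ?thesis
    using assms(2) unfolding env_upto_def[of b]
    by (rule env_env.span_image_into[rotated 4])
      (use * in \<open>auto simp: distrib_left witt_smult_mult_right subspace_env_upto\<close>)
qed

lemma finite_subset_env_upto:
  fixes F :: "'k::field_char_0 witt_env set"
  assumes "finite F"
  obtains D where "D \<ge> 1" "F \<subseteq> env_upto D"
proof -
  have "\<exists>D. u \<in> env_upto D" for u :: "'k witt_env"
  proof -
    obtain D where D: "u = (\<Sum>d\<le>D. env_proj d u)" using env_decompose[of u] by blast
    have "env_proj d u \<in> env_upto D" if "d \<le> D" for d
    proof -
      have "(U_deg d :: 'k witt_env set) \<subseteq> env_upto D"
        unfolding U_deg_eq_span_mon env_upto_eq using that by (intro env.span_mono) auto
      then show ?thesis using env_proj_in_U_deg by blast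
    qed
    then have "(\<Sum>d\<le>D. env_proj d u) \<in> env_upto D"
      unfolding env_upto_def by (intro env.span_sum) auto
    then show ?thesis using D by metis
  qed
  then obtain D where D: "u \<in> env_upto (D u)" for u :: "'k witt_env" by metis
  show ?thesis
  proof (rule that[of "Max (insert 1 (D ` F))"])
    show "Max (insert 1 (D ` F)) \<ge> 1" using assms by simp
    have "D u \<le> Max (insert 1 (D ` F))" if "u \<in> F" for u using that assms by simp
    then show "F \<subseteq> env_upto (Max (insert 1 (D ` F)))" using D env_upto_mono by blast
  qed
qed

text \<open>As the degree is compared first, the monomials of degree at most \<open>n\<close> form
  an initial segment, so whether a monomial is standard does not depend on the truncation at
  \<open>n\<close>.\<close>

lemma ordered_monomials:
  "finite {m. mdeg m \<le> n}" "inj_on mon_key {m. mdeg m \<le> n}"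
  "mdeg m \<le> n \<Longrightarrow> {m' \<in> {m. mdeg m \<le> n}. mon_key m' < mon_key m} = mon_below m"
  using finite_mdeg_le inj_on_subset[OF inj_mon_key]
  by (auto simp: mon_below_def elim: mon_below_cases[unfolded mon_below_def bideg_def mem_Collect_eq])

lemma limsup_sandwich:
  fixes g :: "'v \<Rightarrow> nat \<Rightarrow> nat"
  assumes upper: "\<And>v. v \<in> X \<Longrightarrow> \<exists>D\<ge>1. \<forall>n. g v n \<le> f (D * n)"
    and lower: "\<exists>v\<in>X. \<forall>n. f n \<le> g v n"
  shows "(SUP v\<in>X. limsup (\<lambda>n. log_dim n (g v n))) = limsup (\<lambda>n. log_dim n (f n))"
proof (rule antisym)
  show "(SUP v\<in>X. limsup (\<lambda>n. log_dim n (g v n))) \<le> limsup (\<lambda>n. log_dim n (f n))"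
  proof (rule SUP_least)
    fix v assume "v \<in> X"
    then obtain D where "D \<ge> 1" "\<And>n. g v n \<le> f (D * n)" using upper by blast
    then show "limsup (\<lambda>n. log_dim n (g v n)) \<le> limsup (\<lambda>n. log_dim n (f n))"
      by (intro limsup_log_dim_le)
  qed
  obtain v where v: "v \<in> X" "\<And>n. f n \<le> g v n" using lower by blast
  have "limsup (\<lambda>n. log_dim n (f n)) \<le> limsup (\<lambda>n. log_dim n (g v n))"
    using v(2) by (intro limsup_log_dim_le[of _ _ 1]) simp_all
  then show "limsup (\<lambda>n. log_dim n (f n)) \<le> (SUP v\<in>X. limsup (\<lambda>n. log_dim n (g v n)))"
    by (rule SUP_upper2[OF v(1)])
qed

lemma GKdim_quot_U_witt:
  fixes J :: "'k::field_char_0 witt_env set"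
  assumes J: "ideal J U_witt"
  shows "GKdim (quot_algebra U_witt J) = limsup (\<lambda>n. log_dim n (standard_count (env_reducible J) n))"
proof -
  let ?Q = "quot_algebra U_witt J" and ?\<pi> = "\<lambda>u. J +>\<^bsub>U_witt\<^esub> u"
  have "vs_quotient (smult U_witt) ?Q ?\<pi> J"
    using J env.vector_space_axioms vectorspace_U_witt ideal_U_witt_smult[OF J]
    by (intro vs_quotientI) (simp_all add: fun_eq_iff)
  then interpret Q: vs_quotient witt_smult ?Q ?\<pi> J by simp
  interpret J: ideal J U_witt by fact
  have mult: "?\<pi> u \<otimes>\<^bsub>?Q\<^esub> ?\<pi> v = ?\<pi> (u * v)" for u v
    using J.rcoset_mult_add[of u v] by simp
  \<comment> \<open>Powers commute with the projection, so both bounds are inclusions to be proved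
    before passing to the quotient.\<close>
  have power: "alg_power ?Q (?\<pi> ` V) k = ?\<pi> ` alg_power U_witt V k" for V k
  proof (induction k)
    case 0
    show ?case using Q.lspan_proj[of "{1}"] by (simp add: lspan_U_witt)
  next
    case (Suc k)
    have "{v \<otimes>\<^bsub>?Q\<^esub> w | v w. v \<in> ?\<pi> ` V \<and> w \<in> ?\<pi> ` alg_power U_witt V k} =
        ?\<pi> ` {v * w | v w. v \<in> V \<and> w \<in> alg_power U_witt V k}"
      using mult by (auto simp: image_iff) metis+
    then show ?case using Suc Q.lspan_proj by (simp add: lspan_U_witt)
  qed
  let ?P = "\<lambda>V n. env.span (\<Union>k\<le>n. alg_power U_witt V k) :: 'k witt_env set"
  have union: "lspan ?Q (\<Union>k\<le>n. alg_power ?Q (?\<pi> ` V) k) = ?\<pi> ` ?P V n" for V n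
    by (simp add: power flip: image_UN Q.lspan_proj)
  have count: "ldim ?Q (?\<pi> ` env_upto n) = standard_count (env_reducible J) n" for n
  proof -
    have "{m \<in> {m. mdeg m \<le> n}. \<not> (\<exists>w\<in>env.span (pbw_mon ` {m' \<in> {m. mdeg m \<le> n}. mon_key m' < mon_key m}).
        pbw_mon m - w \<in> J)} = {m. mdeg m \<le> n \<and> \<not> env_reducible J m}"
      using ordered_monomials(3) by (auto simp: env_reducible_def)
    then show ?thesis
      using Q.ldim_proj_ordered_family[OF ordered_monomials(1,2), of pbw_mon n]
      by (simp only: env_upto_eq standard_count_def)
  qed
  have dim_mono: "ldim ?Q (?\<pi> ` W) \<le> ldim ?Q (?\<pi> ` W')"
    if "env.subspace W" "env.subspace W'" "W \<subseteq> W'" "W' \<subseteq> env_upto n" for W W' n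
    using that finite_mdeg_le by (intro Q.ldim_proj_mono[of "pbw_mon ` {m. mdeg m \<le> n}"])
      (simp_all add: env_upto_eq)
  have upper_P: "?P V n \<subseteq> env_upto (D * n)" if V: "V \<subseteq> env_upto D" for V D n
  proof -
    have "alg_power U_witt V k \<subseteq> env_upto (D * k)" for k
    proof (induction k)
      case 0
      show ?case
        unfolding alg_power.simps lspan_U_witt
        by (rule env.span_minimal) (auto simp: subspace_env_upto env_upto_def intro!: env.span_base exI[of _ "[]"])
    next
      case (Suc k)
      have "v * w \<in> env_upto (D * Suc k)" if "v \<in> V" "w \<in> alg_power U_witt V k" for v w
        using that V Suc env_upto_mult[of v D w "D * k"] by auto
      then show ?case
        unfolding alg_power.simps lspan_U_witt
        by (intro env.span_minimal subspace_env_upto) auto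
    qed
    then have "alg_power U_witt V k \<subseteq> env_upto (D * n)" if "k \<le> n" for k
      using env_upto_mono[of "D * k" "D * n"] that by force
    then show ?thesis by (intro env.span_minimal) (auto simp: subspace_env_upto)
  qed
  have lower_P: "env_upto n \<subseteq> ?P (env.span {e_gen (pnat_of_nat 1), e_gen (pnat_of_nat 2)}) n" for n
  proof -
    let ?V = "env.span {e_gen (pnat_of_nat 1), e_gen (pnat_of_nat 2)} :: 'k witt_env set"
    have step: "v * u \<in> ?P ?V (Suc n)" if v: "v \<in> ?V" and u: "u \<in> ?P ?V n" for u v n
      using u
    proof (rule env_env.span_image_into[rotated 4])
      show "v * x \<in> ?P ?V (Suc n)" if "x \<in> (\<Union>k\<le>n. alg_power U_witt ?V k)" for x
      proof -
        obtain k where "k \<le> n" "x \<in> alg_power U_witt ?V k" using \<open>x \<in> _\<close> by blast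
        then have "v * x \<in> alg_power U_witt ?V (Suc k)" "Suc k \<le> Suc n"
          using v by (auto simp: lspan_U_witt intro!: env.span_base)
        then show ?thesis by (intro env.span_base) blast
      qed
    qed (simp_all add: distrib_left witt_smult_mult_right)
    have gens: "e_gen (pnat_of_nat 1) \<in> ?V" "e_gen (pnat_of_nat 2) \<in> ?V"
      by (simp_all add: env.span_base)
    have P_mono: "mono (?P ?V)"
      by (intro monoI env.span_mono UN_mono) auto
    have char: "(of_nat k :: 'k) \<noteq> 0" if "k > 0" for k :: nat using that by simp
    \<comment> \<open>The left factor of index \<open>i\<close> costs \<open>i\<close> steps,
      whatever it multiplies; a word is then built up letter by letter at a total cost of its
      degree.\<close>
    have e_step: "e_gen i * u \<in> ?P ?V (n + nat_of_pnat i)" if u: "u \<in> ?P ?V n" for u n i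
    proof (rule env.witt_action_filtered[where P = "?P ?V" and T = "\<lambda>i u. e_gen i * u"
          and D = "\<lambda>u. e_gen (pnat_of_nat 1) * u", OF _ P_mono _ _ _ _ char u])
      show "witt_smult (of_nat (nat_of_pnat j) - 1) (e_gen (pnat_of_nat 1 + j) * p) =
          e_gen (pnat_of_nat 1) * (e_gen j * p) - e_gen j * (e_gen (pnat_of_nat 1) * p)"
        for j and p :: "'k witt_env"
        unfolding e_gen_swap[of "pnat_of_nat 1" j p] by (simp add: witt_coeff_def nat_of_pnat_of_nat)
    qed (use step gens in \<open>blast intro: env.subspace_span\<close>)+
    have "word_prod ws \<in> ?P ?V (word_deg ws)" for ws
    proof (induction ws)
      case Nil
      have "(1 :: 'k witt_env) \<in> alg_power U_witt ?V 0" by (simp add: lspan_U_witt env.span_base)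
      then show ?case by (auto intro: env.span_base)
    next
      case (Cons i ws)
      then show ?case using e_step[OF Cons, of i] by (simp add: add.commute)
    qed
    then have "word_prod ws \<in> ?P ?V n" if "word_deg ws \<le> n" for ws
      using monoD[OF P_mono that] by blast
    then show ?thesis unfolding env_upto_def by (intro env.span_minimal) auto
  qed
  show ?thesis
    unfolding GKdim_def
  proof (rule limsup_sandwich)
    fix V assume "V \<in> {V. fin_dim_subspace ?Q V}"
    then obtain F where F: "finite F" "V = ?\<pi> ` env.span F"
      by (auto elim: Q.fin_dim_subspaceE)
    obtain D where D: "D \<ge> 1" "F \<subseteq> env_upto D" using finite_subset_env_upto[OF F(1)] .
    have "env.span F \<subseteq> env_upto D" by (rule env.span_minimal[OF D(2) subspace_env_upto])
    then have "ldim ?Q (lspan ?Q (\<Union>k\<le>n. alg_power ?Q V k)) \<le> standard_count (env_reducible J) (D * n)" for n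
      unfolding F(2) union count[symmetric]
      by (intro dim_mono[OF env.subspace_span subspace_env_upto _ order_refl] upper_P)
    then show "\<exists>D\<ge>1. \<forall>n. ldim ?Q (lspan ?Q (\<Union>k\<le>n. alg_power ?Q V k)) \<le> standard_count (env_reducible J) (D * n)"
      using D(1) by blast
  next
    let ?V = "env.span {e_gen (pnat_of_nat 1), e_gen (pnat_of_nat 2)} :: 'k witt_env set"
    \<comment> \<open>This crude bound supplies the finite-dimensional ambient space that the
      monotonicity of \<open>ldim\<close> asks for.\<close>
    have V: "?V \<subseteq> env_upto 2"
    proof (rule env.span_minimal[OF _ subspace_env_upto])
      have "e_gen (pnat_of_nat k) \<in> (env_upto 2 :: 'k witt_env set)" if "1 \<le> k" "k \<le> 2" for k
        unfolding env_upto_def using that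
        by (intro env.span_base) (auto simp: nat_of_pnat_of_nat intro!: exI[of _ "[pnat_of_nat k]"])
      then show "{e_gen (pnat_of_nat 1), e_gen (pnat_of_nat 2)} \<subseteq> (env_upto 2 :: 'k witt_env set)" by simp
    qed
    have "standard_count (env_reducible J) n
        \<le> ldim ?Q (lspan ?Q (\<Union>k\<le>n. alg_power ?Q (?\<pi> ` ?V) k))" for n
      unfolding union count[symmetric]
      using upper_P[OF V, of n] lower_P[of n]
      by (intro dim_mono[of _ _ "2 * n"] subspace_env_upto) simp_all
    moreover have "fin_dim_subspace ?Q (?\<pi> ` ?V)" by (rule Q.fin_dim_subspace_proj) simp
    ultimately show "\<exists>V\<in>{V. fin_dim_subspace ?Q V}. \<forall>n. standard_count (env_reducible J) n
        \<le> ldim ?Q (lspan ?Q (\<Union>k\<le>n. alg_power ?Q V k))"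
      by blast
  qed
qed

section \<open>Growth of Poisson quotients of the symmetric algebra\<close>

definition sym_upto :: "nat \<Rightarrow> 'k::field_char_0 witt_sym set" where
  "sym_upto n = sym_on {m. mdeg m \<le> n}"

lemma subspace_sym_upto: "sym.subspace (sym_upto n)"
  by (simp add: sym_upto_def subspace_sym_on)

lemma sym_upto_mono: "m \<le> n \<Longrightarrow> sym_upto m \<subseteq> sym_upto n"
  unfolding sym_upto_def by (rule sym_on_mono) auto

lemma sym_upto_mult:
  "p \<in> sym_upto a \<Longrightarrow> q \<in> sym_upto b \<Longrightarrow> p * q \<in> sym_upto (a + b)"
  using Poly_Mapping.keys_mult[of p q] by (fastforce simp: sym_upto_def sym_on_def)

lemma x_gen_in_sym_upto: "nat_of_pnat i \<le> n \<Longrightarrow> x_gen i \<in> sym_upto n"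
  by (simp add: sym_upto_def sym_on_def x_gen_def)

lemma bracket_x_gen_sym_upto:
  fixes q :: "'k::field_char_0 witt_sym"
  assumes "q \<in> sym_upto b"
  shows "sym_bracket (x_gen i) q \<in> sym_upto (nat_of_pnat i + b)"
  using assms unfolding sym_upto_def[of b] sym_on_eq_span
proof (rule sym_sym.span_image_into[rotated 4])
  show "sym_bracket (x_gen i) x \<in> sym_upto (nat_of_pnat i + b)"
    if x: "x \<in> sym_mon ` {m. mdeg m \<le> b}" for x :: "'k witt_sym"
  proof -
    obtain m where m: "x = sym_mon m" "mdeg m \<le> b" using x by blast
    have "sym_on (bideg (nat_of_pnat i + mdeg m) (size m)) \<subseteq> sym_upto (nat_of_pnat i + b)"
      unfolding sym_upto_def using m(2) by (intro sym_on_mono) (auto simp: bideg_def)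
    then show ?thesis using sym_bracket_sym_mon[of i m] by (auto simp: m(1))
  qed
qed (simp_all add: sym_bracket_add sym_bracket_smult subspace_sym_upto)

lemma sym_bracket_smult_left: "sym_bracket (sym_smult c p) q = sym_smult c (sym_bracket p q)"
  by (simp add: sym_bracket_mult_left sym_bracket_const_left)

text \<open>A bracket merges one letter of each factor into their sum, which keeps the total degree.
  The Leibniz rule in the first argument reduces this to brackets with generators.\<close>

lemma sym_upto_bracket:
  fixes p q :: "'k::field_char_0 witt_sym"
  assumes "p \<in> sym_upto a" and q: "q \<in> sym_upto b"
  shows "sym_bracket p q \<in> sym_upto (a + b)"
  using assms(1) unfolding sym_upto_def[of a] sym_on_eq_span
proof (rule sym_sym.span_image_into[rotated 4])
  have "sym_bracket (sym_mon m) q \<in> sym_upto (mdeg m + b)" for m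
  proof (induction m)
    case empty
    then show ?case using sym.subspace_0[OF subspace_sym_upto] sym_bracket_const_left[of 1 q] by simp
  next
    case (add i m)
    have "sym_mon m \<in> (sym_upto (mdeg m) :: 'k witt_sym set)" by (simp add: sym_upto_def sym_on_def)
    then have "sym_bracket (x_gen i) q * sym_mon m \<in> sym_upto (nat_of_pnat i + b + mdeg m)"
      by (intro sym_upto_mult bracket_x_gen_sym_upto q)
    moreover have "x_gen i * sym_bracket (sym_mon m) q \<in> sym_upto (nat_of_pnat i + (mdeg m + b))"
      by (intro sym_upto_mult add x_gen_in_sym_upto order_refl)
    ultimately show ?case
      unfolding sym_mon_add_mset sym_bracket_mult_left
      by (intro sym.subspace_add[OF subspace_sym_upto]) (simp_all add: add_ac)
  qed
  then show "sym_bracket x q \<in> sym_upto (a + b)" if "x \<in> sym_mon ` {m. mdeg m \<le> a}" for x :: "'k witt_sym"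
    using that sym_upto_mono[of "_ + b" "a + b"] by fastforce
qed (simp_all add: sym_bracket_add_left sym_bracket_smult_left subspace_sym_upto)

lemma finite_subset_sym_upto:
  fixes F :: "'k::field_char_0 witt_sym set"
  assumes "finite F"
  obtains D where "D \<ge> 1" "F \<subseteq> sym_upto D"
proof
  let ?D = "Max (insert 1 (\<Union>p\<in>F. mdeg ` Poly_Mapping.keys p))"
  show "?D \<ge> 1" using assms by simp
  have "mdeg m \<le> ?D" if "p \<in> F" "m \<in> Poly_Mapping.keys p" for p m
    using that assms by (intro Max_ge) auto
  then show "F \<subseteq> sym_upto ?D" by (auto simp: sym_upto_def sym_on_def)
qed

lemma PGKdim_quot_S_witt:
  fixes K :: "'k::field_char_0 witt_sym set"
  assumes K: "poisson_ideal S_witt K"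
  shows "PGKdim (quot_poisson S_witt K) = limsup (\<lambda>n. log_dim n (standard_count (sym_reducible K) n))"
proof -
  let ?Q = "quot_poisson S_witt K" and ?\<pi> = "\<lambda>p. K +>\<^bsub>S_witt\<^esub> p"
  have ideal: "ideal K S_witt" using K by (simp add: poisson_ideal_def)
  interpret K: ideal K S_witt by fact
  have smult_K: "sym_smult c p \<in> K" if "p \<in> K" for c p
    using K.I_l_closed[OF that, of "Poly_Mapping.single 0 c"] by simp
  have "vs_quotient (smult S_witt) ?Q ?\<pi> K"
    using ideal sym.vector_space_axioms vectorspace_S_witt smult_K
    by (intro vs_quotientI) (simp_all add: fun_eq_iff)
  then interpret Q: vs_quotient sym_smult ?Q ?\<pi> K by simp
  have mult: "?\<pi> p \<otimes>\<^bsub>?Q\<^esub> ?\<pi> q = ?\<pi> (p * q)" for p q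
    using K.rcoset_mult_add[of p q] by simp
  \<comment> \<open>The quotient bracket is a union over all representatives; it is a single coset
    because brackets with elements of \<open>K\<close>, in either argument, stay in
    \<open>K\<close>.\<close>
  have bracket: "pbracket ?Q (?\<pi> p) (?\<pi> q) = ?\<pi> (sym_bracket p q)" for p q
  proof -
    have eq: "?\<pi> (sym_bracket p' q') = ?\<pi> (sym_bracket p q)" if pq: "p' \<in> ?\<pi> p" "q' \<in> ?\<pi> q" for p' q'
    proof -
      obtain k l where kl: "k \<in> K" "p' = k + p" "l \<in> K" "q' = l + q"
        using pq by (auto simp: a_r_coset_def')
      have br: "sym_bracket x y \<in> K" if "y \<in> K" for x y
        using K that by (simp add: poisson_ideal_def)
      have "- sym_bracket q' k \<in> K" using smult_K[OF br[OF kl(1)], of "- 1" q'] by (simp add: single_uminus)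
      then have "sym_bracket k q' \<in> K" using sym_bracket_antisym[of k q'] by simp
      moreover have "sym_bracket p' q' - sym_bracket p q = sym_bracket k q' + sym_bracket p l"
        by (simp add: kl sym_bracket_add sym_bracket_add_left)
      ultimately have "sym_bracket p' q' - sym_bracket p q \<in> K"
        using ideal_record_add[OF ideal] br[OF kl(3)] by simp
      then show ?thesis using Q.proj_eq_iff by blast
    qed
    have self: "p \<in> ?\<pi> p" "q \<in> ?\<pi> q" using K.a_rcos_self by simp_all
    have "pbracket ?Q (?\<pi> p) (?\<pi> q) = (\<Union>x\<in>?\<pi> p. \<Union>y\<in>?\<pi> q. ?\<pi> (sym_bracket x y))" by simp
    also have "\<dots> = (\<Union>x\<in>?\<pi> p. \<Union>y\<in>?\<pi> q. ?\<pi> (sym_bracket p q))" by (intro SUP_cong refl eq)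
    also have "\<dots> = ?\<pi> (sym_bracket p q)" using self by blast
    finally show ?thesis .
  qed
  have power: "poisson_power ?Q (?\<pi> ` V) k = ?\<pi> ` poisson_power S_witt V k" for V k
  proof (induction k)
    case 0
    show ?case using Q.lspan_proj[of "{1}"] by (simp add: lspan_S_witt)
  next
    case (Suc k)
    have "{v \<otimes>\<^bsub>?Q\<^esub> w | v w. v \<in> ?\<pi> ` V \<and> w \<in> ?\<pi> ` poisson_power S_witt V k} \<union>
        {pbracket ?Q v w | v w. v \<in> ?\<pi> ` V \<and> w \<in> ?\<pi> ` poisson_power S_witt V k} =
        ?\<pi> ` ({v * w | v w. v \<in> V \<and> w \<in> poisson_power S_witt V k} \<union>
          {sym_bracket v w | v w. v \<in> V \<and> w \<in> poisson_power S_witt V k})"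
      unfolding image_Un
    proof (rule arg_cong2[where f = "(\<union>)"])
      show "{v \<otimes>\<^bsub>?Q\<^esub> w | v w. v \<in> ?\<pi> ` V \<and> w \<in> ?\<pi> ` poisson_power S_witt V k} =
          ?\<pi> ` {v * w | v w. v \<in> V \<and> w \<in> poisson_power S_witt V k}"
        using mult by (auto simp: image_iff) metis+
      show "{pbracket ?Q v w | v w. v \<in> ?\<pi> ` V \<and> w \<in> ?\<pi> ` poisson_power S_witt V k} =
          ?\<pi> ` {sym_bracket v w | v w. v \<in> V \<and> w \<in> poisson_power S_witt V k}"
        using bracket by (auto simp: image_iff simp del: quot_poisson_simps) metis+
    qed
    then show ?case using Suc Q.lspan_proj by (simp add: lspan_S_witt del: quot_poisson_simps)
  qed
  let ?P = "\<lambda>V n. sym.span (\<Union>k\<le>n. poisson_power S_witt V k) :: 'k witt_sym set"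
  have pd: "poisson_pd ?Q (?\<pi> ` V) n = ldim ?Q (?\<pi> ` ?P V n)" for V n
    by (simp add: poisson_pd_def power flip: image_UN Q.lspan_proj)
  have count: "ldim ?Q (?\<pi> ` sym_upto n) = standard_count (sym_reducible K) n" for n
  proof -
    have "{m \<in> {m. mdeg m \<le> n}. \<not> (\<exists>w\<in>sym.span (sym_mon ` {m' \<in> {m. mdeg m \<le> n}. mon_key m' < mon_key m}).
        sym_mon m - w \<in> K)} = {m. mdeg m \<le> n \<and> \<not> sym_reducible K m}"
      using ordered_monomials(3) by (auto simp: sym_reducible_def)
    then show ?thesis
      using Q.ldim_proj_ordered_family[OF ordered_monomials(1,2), of sym_mon n]
      by (simp only: sym_upto_def sym_on_eq_span standard_count_def)
  qed
  have dim_mono: "ldim ?Q (?\<pi> ` W) \<le> ldim ?Q (?\<pi> ` W')"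
    if "sym.subspace W" "sym.subspace W'" "W \<subseteq> W'" "W' \<subseteq> sym_upto n" for W W' n
    using that finite_mdeg_le by (intro Q.ldim_proj_mono[of "sym_mon ` {m. mdeg m \<le> n}"])
      (simp_all add: sym_upto_def sym_on_eq_span)
  have upper_P: "?P V n \<subseteq> sym_upto (D * n)" if V: "V \<subseteq> sym_upto D" for V D n
  proof -
    have "poisson_power S_witt V k \<subseteq> sym_upto (D * k)" for k
    proof (induction k)
      case 0
      show ?case
        unfolding poisson_power.simps lspan_S_witt
        by (rule sym.span_minimal[OF _ subspace_sym_upto]) (simp add: sym_upto_def sym_on_def)
    next
      case (Suc k)
      have "v * w \<in> sym_upto (D * Suc k) \<and> sym_bracket v w \<in> sym_upto (D * Suc k)"
        if "v \<in> V" "w \<in> poisson_power S_witt V k" for v w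
        using that V Suc sym_upto_mult[of v D w "D * k"] sym_upto_bracket[of v D w "D * k"] by auto
      then show ?case
        unfolding poisson_power.simps lspan_S_witt
        by (intro sym.span_minimal subspace_sym_upto) auto
    qed
    then have "poisson_power S_witt V k \<subseteq> sym_upto (D * n)" if "k \<le> n" for k
      using sym_upto_mono[of "D * k" "D * n"] that by force
    then show ?thesis by (intro sym.span_minimal) (auto simp: subspace_sym_upto)
  qed
  let ?V = "sym.span {x_gen (pnat_of_nat 1), x_gen (pnat_of_nat 2)} :: 'k witt_sym set"
  have lower_P: "sym_upto n \<subseteq> ?P ?V n" for n
  proof -
    have step: "v * p \<in> ?P ?V (Suc n) \<and> sym_bracket v p \<in> ?P ?V (Suc n)"
      if v: "v \<in> ?V" and p: "p \<in> ?P ?V n" for p v n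
    proof -
      have *: "v * x \<in> ?P ?V (Suc n) \<and> sym_bracket v x \<in> ?P ?V (Suc n)"
        if "x \<in> (\<Union>k\<le>n. poisson_power S_witt ?V k)" for x
      proof -
        obtain k where "k \<le> n" "x \<in> poisson_power S_witt ?V k" using \<open>x \<in> _\<close> by blast
        then have "v * x \<in> poisson_power S_witt ?V (Suc k)"
          "sym_bracket v x \<in> poisson_power S_witt ?V (Suc k)" "Suc k \<le> Suc n"
          using v by (auto simp: lspan_S_witt intro!: sym.span_base)
        then show ?thesis by (intro conjI sym.span_base) blast+
      qed
      show ?thesis
      proof
        show "v * p \<in> ?P ?V (Suc n)"
          by (rule sym_sym.span_image_into[OF _ _ conjunct1[OF *] sym.subspace_span p])
            (simp_all add: distrib_left sym_smult_mult_right)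
        show "sym_bracket v p \<in> ?P ?V (Suc n)"
          by (rule sym_sym.span_image_into[OF _ _ conjunct2[OF *] sym.subspace_span p])
            (simp_all add: sym_bracket_add sym_bracket_smult)
      qed
    qed
    have gens: "x_gen (pnat_of_nat 1) \<in> ?V" "x_gen (pnat_of_nat 2) \<in> ?V"
      by (simp_all add: sym.span_base)
    have P_mono: "mono (?P ?V)"
      by (intro monoI sym.span_mono UN_mono) auto
    have char: "(of_nat k :: 'k) \<noteq> 0" if "k > 0" for k :: nat using that by simp
    \<comment> \<open>Here the role of \<open>D\<close> is played by the bracket with x_1, which
      also costs one step; its commutator with multiplication by x_j is multiplication by {x_1,
      x_j}.\<close>
    have x_step: "x_gen i * p \<in> ?P ?V (n + nat_of_pnat i)" if p: "p \<in> ?P ?V n" for p n i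
    proof (rule sym.witt_action_filtered[where P = "?P ?V" and T = "\<lambda>i p. x_gen i * p"
          and D = "sym_bracket (x_gen (pnat_of_nat 1))", OF _ P_mono _ _ _ _ char p])
      show "sym_smult (of_nat (nat_of_pnat j) - 1) (x_gen (pnat_of_nat 1 + j) * q) =
          sym_bracket (x_gen (pnat_of_nat 1)) (x_gen j * q) -
          x_gen j * sym_bracket (x_gen (pnat_of_nat 1)) q" for j and q :: "'k witt_sym"
        by (simp add: sym_bracket_x_gen_mult witt_coeff_def nat_of_pnat_of_nat)
    qed (use step gens in \<open>blast intro: sym.subspace_span\<close>)+
    have "sym_mon m \<in> ?P ?V (mdeg m)" for m
    proof (induction m)
      case empty
      have "(1 :: 'k witt_sym) \<in> poisson_power S_witt ?V 0" by (simp add: lspan_S_witt sym.span_base)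
      then show ?case by (auto intro: sym.span_base)
    next
      case (add i m)
      then show ?case using x_step[OF add, of i] by (simp add: sym_mon_add_mset add.commute)
    qed
    then have "sym_mon m \<in> ?P ?V n" if "mdeg m \<le> n" for m
      using monoD[OF P_mono that] by blast
    then show ?thesis unfolding sym_upto_def sym_on_eq_span by (intro sym.span_minimal) auto
  qed
  \<comment> \<open>\<open>PGKdim\<close> admits only subspaces that come with the Poisson
    subalgebra they generate; for this one it is the whole quotient.\<close>
  have generates: "poisson_generates ?Q (?\<pi> ` ?V) (carrier ?Q)"
    unfolding poisson_generates_def
  proof (intro conjI allI impI)
    have "VectorSpace.subspace class_ring (carrier ?Q) ?Q"
      using Q.subspace_proj_image[OF sym.subspace_UNIV] Q.carrier_Q by simp
    moreover have "\<one>\<^bsub>?Q\<^esub> = ?\<pi> 1" by simp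
    ultimately show "poisson_subalgebra ?Q (carrier ?Q)"
      unfolding poisson_subalgebra_def Q.carrier_Q using mult bracket
      by (auto simp del: quot_poisson_simps)
    show "?\<pi> ` ?V \<subseteq> carrier ?Q" unfolding Q.carrier_Q by blast
    fix C assume C: "poisson_subalgebra ?Q C \<and> ?\<pi> ` ?V \<subseteq> C"
    \<comment> \<open>The preimage of \<open>C\<close> is a subspace that contains all Poisson
      powers of \<open>?V\<close>, hence every \<open>sym_upto n\<close> by \<open>lower_P\<close>,
      and these exhaust the symmetric algebra.\<close>
    let ?C = "{p. ?\<pi> p \<in> C}"
    have sub: "sym.subspace ?C"
      using C by (intro Q.subspace_proj_vimage) (simp add: poisson_subalgebra_def)
    have "poisson_power S_witt ?V k \<subseteq> ?C" for k
    proof (induction k)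
      case 0
      have "?\<pi> 1 \<in> C" using C by (simp add: poisson_subalgebra_def)
      then show ?case
        unfolding poisson_power.simps lspan_S_witt by (intro sym.span_minimal sub) simp
    next
      case (Suc k)
      have "?\<pi> (v * w) \<in> C \<and> ?\<pi> (sym_bracket v w) \<in> C"
        if "v \<in> ?V" "w \<in> poisson_power S_witt ?V k" for v w
      proof -
        have "?\<pi> v \<in> C" "?\<pi> w \<in> C" using that C Suc by blast+
        then have "?\<pi> v \<otimes>\<^bsub>?Q\<^esub> ?\<pi> w \<in> C \<and> pbracket ?Q (?\<pi> v) (?\<pi> w) \<in> C"
          using C unfolding poisson_subalgebra_def by blast
        then show ?thesis unfolding mult bracket .
      qed
      then show ?case
        unfolding poisson_power.simps lspan_S_witt by (intro sym.span_minimal sub) auto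
    qed
    then have "?P ?V n \<subseteq> ?C" for n by (intro sym.span_minimal sub) blast
    then have "sym_upto n \<subseteq> ?C" for n using lower_P by blast
    moreover have "\<exists>n. p \<in> sym_upto n" for p :: "'k witt_sym"
      using finite_subset_sym_upto[of "{p}"] by blast
    ultimately show "carrier ?Q \<subseteq> C" unfolding Q.carrier_Q by blast
  qed
  have "PGKdim ?Q = (SUP V\<in>{V. fin_dim_subspace ?Q V \<and> (\<exists>B. poisson_generates ?Q V B)}.
      limsup (\<lambda>n. log_dim n (poisson_pd ?Q V n)))"
    unfolding PGKdim_def by (rule arg_cong[where f = Sup]) auto
  also have "\<dots> = limsup (\<lambda>n. log_dim n (standard_count (sym_reducible K) n))"
  proof (rule limsup_sandwich)
    fix V assume "V \<in> {V. fin_dim_subspace ?Q V \<and> (\<exists>B. poisson_generates ?Q V B)}"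
    then obtain F where F: "finite F" "V = ?\<pi> ` sym.span F"
      by (auto elim: Q.fin_dim_subspaceE)
    obtain D where D: "D \<ge> 1" "F \<subseteq> sym_upto D" using finite_subset_sym_upto[OF F(1)] .
    have "sym.span F \<subseteq> sym_upto D" by (rule sym.span_minimal[OF D(2) subspace_sym_upto])
    then have "poisson_pd ?Q V n \<le> standard_count (sym_reducible K) (D * n)" for n
      unfolding F(2) pd count[symmetric]
      by (intro dim_mono[OF sym.subspace_span subspace_sym_upto _ order_refl] upper_P)
    then show "\<exists>D\<ge>1. \<forall>n. poisson_pd ?Q V n \<le> standard_count (sym_reducible K) (D * n)"
      using D(1) by blast
  next
    have V: "?V \<subseteq> sym_upto 2"
      by (rule sym.span_minimal[OF _ subspace_sym_upto])
        (simp add: x_gen_in_sym_upto nat_of_pnat_of_nat)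
    have "standard_count (sym_reducible K) n \<le> poisson_pd ?Q (?\<pi> ` ?V) n" for n
      unfolding pd count[symmetric]
      using upper_P[OF V, of n] lower_P[of n]
      by (intro dim_mono[of _ _ "2 * n"] subspace_sym_upto) simp_all
    moreover have "fin_dim_subspace ?Q (?\<pi> ` ?V)" by (rule Q.fin_dim_subspace_proj) simp
    ultimately show "\<exists>V\<in>{V. fin_dim_subspace ?Q V \<and> (\<exists>B. poisson_generates ?Q V B)}.
        \<forall>n. standard_count (sym_reducible K) n \<le> poisson_pd ?Q V n"
      using generates by blast
  qed
  finally show ?thesis .
qed

theorem theorem3p19:
  fixes J I :: "'k::field_char_0 witt_env set"
    and K :: "'k witt_sym set"
  assumes "ideal J U_witt"
    and "I = gr_d J"
    and "K = gr_o I"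
  shows "ideal I U_witt
    \<and> gr_o I = gr_do I
    \<and> poisson_ideal S_witt K
    \<and> GKdim (quot_algebra U_witt J) = GKdim (quot_algebra U_witt I)
    \<and> GKdim (quot_algebra U_witt I) = PGKdim (quot_poisson S_witt K)"
proof -
  have J: "env.subspace J" by (rule subspace_ideal_U_witt[OF assms(1)])
  have I: "ideal I U_witt" unfolding assms(2) by (rule ideal_gr_d[OF assms(1)])
  have graded: "env_proj d u \<in> I" if "u \<in> I" for u d
    using that env_proj_gr_d_closed[OF J] by (simp add: assms(2))
  have K: "K = gr_sym I" using gr_o_eq_gr_sym[OF graded] by (simp add: assms(3))
  have "env_reducible J = env_reducible I"
    using env_reducible_gr_d[OF J] by (auto simp: assms(2))
  moreover have "sym_reducible K = env_reducible I"
    using sym_reducible_gr_sym[OF subspace_ideal_U_witt[OF I] graded] by (auto simp: K)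
  moreover have "poisson_ideal S_witt K" unfolding K by (rule poisson_ideal_gr_sym[OF I])
  ultimately show ?thesis
    using I gr_do_eq_gr_sym[OF graded] gr_o_eq_gr_sym[OF graded]
      GKdim_quot_U_witt[OF I] GKdim_quot_U_witt[OF assms(1)] PGKdim_quot_S_witt[of K]
    by simp
qed

end
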